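(* There are functors $$\{\mathrm{X_2Lie}\}\xleftarrow{\ \mathrm{Prim}\ }\{\mathrm{X_2Hopf}^{cc}\}\xrightarrow{\ \mathrm{Gl}\ }\{\mathrm{X_2Grp}\}$$ between the categories of 2-crossed modules of Lie algebras, of cocommutative Hopf algebras over $\kappa$, and of groups, respectively (sending $K\to I\to H$ to $\mathrm{Prim}(K)\to\mathrm{Prim}(I)\to\mathrm{Prim}(H)$ and to $\mathrm{Gl}(K)\to\mathrm{Gl}(I)\to\mathrm{Gl}(H)$, with restricted structure), extending to the 2-crossed module level the functors $\{\mathrm{XLie}\}\xleftarrow{\mathrm{Prim}}\{\mathrm{XHopf}^{cc}\}\xrightarrow{\mathrm{Gl}}\{\mathrm{XGrp}\}$ between the corresponding categories of crossed modules (which send $I\to H$ to $\mathrm{Prim}(I)\to\mathrm{Prim}(H)$ and to $\mathrm{Gl}(I)\to\mathrm{Gl}(H)$).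
   Context: All Hopf algebras are cocommutative over an arbitrary field $\kappa$, with coproduct $\delta(x)=\sum_{(x)}x'\otimes x''$ (iterated: $x',x'',x''',\dots$), counit $\epsilon$, antipode $S$. The zero object is $\kappa$; the zero morphism $A\to B$ is $x\mapsto\epsilon(x)1_B$. Adjoint action: $x\vartriangleright_{ad}y=\sum_{(x)}x'\,y\,S(x'')$. $\mathrm{Prim}(H)=\{x\in H:\delta(x)=x\otimes1_H+1_H\otimes x\}$ is a Lie algebra under $[x,y]=xy-yx$. $\mathrm{Gl}(H)=\{x\in H:\delta(x)=x\otimes x,\ \epsilon(x)=1\}$ is a group under the product of $H$, with $x^{-1}=S(x)$. An $H$-module bialgebra $I$ is a bialgebra with an $H$-module structure $\vartriangleright_\rho\colon H\otimes I\to I$ such that $x\vartriangleright_\rho 1=\epsilon(x)1$, $x\vartriangleright_\rho(uv)=\sum(x'\vartriangleright_\rho u)(x''\vartriangleright_\rho v)$, $\delta(x\vartriangleright_\rho v)=\sum(x'\vartriangleright_\rho v')\otimes(x''\vartriangleright_\rho v'')$, $\epsilon(x\vartriangleright_\rho v)=\epsilon(x)\epsilon(v)$. Crossed modules. Hopf algebras: a Hopf algebra map $\partial\colon I\to H$ with an $H$-module bialgebra structure on $I$ such that $\partial(x\vartriangleright_\rho v)=x\vartriangleright_{ad}\partial(v)$ and $\partial(u)\vartriangleright_\rho v=u\vartriangleright_{ad}v$. Groups: a homomorphism $\partial\colon E\to G$ with an action of $G$ on $E$ by automorphisms such that $\partial(g\triangleright e)=g\,\partial(e)\,g^{-1}$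 and $\partial(e)\triangleright f=efe^{-1}$. Lie algebras: a Lie algebra map $\partial\colon\mathfrak e\to\mathfrak g$ with an action of $\mathfrak g$ on $\mathfrak e$ by derivations such that $\partial(g\triangleright e)=[g,\partial(e)]$ and $\partial(e)\triangleright f=[e,f]$. A crossed module $I\to H$ is regarded as the 2-crossed module $\kappa\to I\to H$ (trivial first term); likewise for groups and Lie algebras. A 2-crossed module of Hopf algebras is a chain complex $K\xrightarrow{\partial_2}I\xrightarrow{\partial_1}H$ of Hopf algebras ($\partial_1\partial_2$ is the zero morphism) with actions $\vartriangleright_\rho$ of $H$ on $I$ and $K$, and on itself by the adjoint action, together with a bilinear map (Peiffer lifting) $\{\ ,\ \}$ from pairs of elements of $I$ to $K$ which is $H$-equivariant, i.e. $a\vartriangleright_\rho\{x,y\}=\sum_{(a)}\{a'\vartriangleright_\rho x,a''\vartriangleright_\rho y\}$, such that for all $x,y,z\in I$, $k,l\in K$: 1) it is a complex of $H$-module bialgebras: $\partial_2(a\vartriangleright_\rho k)=a\vartriangleright_\rho\partial_2(k)$ and $\partial_1(a\vartriangleright_\rho x)=a\vartriangleright_{ad}\partial_1(x)$ for $a\in H$; 2) $\partial_2\{x,y\}=\sum_{(x)(y)}(x'\vartriangleright_{ad}y')\,\big(\partial_1(x'')\vartriangleright_\rho S(y'')\big)$; 3) $\{\partial_2(k),\partial_2(l)\}=\sum_{(l)}(k\vartriangleright_{ad}l')\,S(l'')$; 4) $\{x,yz\}=\sum_{(x)(y)}\{x',y'\}\,\big((\partial_1(x'')\vartriangleright_\rho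 y'')\vartriangleright'_\rho\{x''',z\}\big)$; 5) $\{xy,z\}=\sum_{(x)(y)(z)}\{x',y'\vartriangleright_{ad}z'\}\,\big(\partial_1(x'')\vartriangleright_\rho\{y'',z''\}\big)$; 6) $\sum_{(k)(x)}\{\partial_2(k'),x'\}\{x'',\partial_2(k'')\}=\sum_{(k)}k'\,\big(\partial_1(x)\vartriangleright_\rho S(k'')\big)$; where in 4) the action of $I$ on $K$ is $x\vartriangleright'_\rho k=\sum_{(k)}k'\,\{\partial_2(S(k'')),x\}$, such that $(\partial_2\colon K\to I,\vartriangleright'_\rho)$ becomes a crossed module. A 2-crossed module of groups is a chain complex of groups $L\xrightarrow{\partial_2}E\xrightarrow{\partial_1}G$ with left actions $\triangleright$ of $G$ on $E,L$ and a $G$-equivariant function $\{\ ,\ \}$ from pairs of elements of $E$ to $L$ ($g\triangleright\{e,f\}=\{g\triangleright e,g\triangleright f\}$), such that for all $l,m\in L$, $e,f,g\in E$: 1) it is a complex of $G$-modules, where $G$ acts on itself by conjugation; 2) $\partial_2\{e,f\}=(efe^{-1})(\partial_1(e)\triangleright f^{-1})$; 3) $\{\partial_2(l),\partial_2(m)\}=lml^{-1}m^{-1}$; 4) $\{e,fg\}=\{e,f\}\,\big((\partial_1(e)\triangleright f)\triangleright'\{e,g\}\big)$; 5) $\{ef,g\}=\{e,fgf^{-1}\}\,\big(\partial_1(e)\triangleright\{f,g\}\big)$; 6) $\{\partial_2(l),e\}\{e,\partial_2(l)\}=l\,(\partial_1(e)\triangleright l^{-1})$; where $e\triangleright'l=l\{\partial_2(l^{-1}),e\}$,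 which turns $(\partial_2,\triangleright')$ into a crossed module. A 2-crossed module of Lie algebras is a chain complex of Lie algebras $\mathfrak l\xrightarrow{\partial_2}\mathfrak e\xrightarrow{\partial_1}\mathfrak g$ with left actions $\triangleright$ of $\mathfrak g$ on $\mathfrak e,\mathfrak l$ and a bilinear $\mathfrak g$-equivariant map $\{\ ,\ \}$ from pairs of elements of $\mathfrak e$ to $\mathfrak l$ ($g\triangleright\{u,v\}=\{g\triangleright u,v\}+\{u,g\triangleright v\}$), such that for all $x,y\in\mathfrak l$, $u,v,w\in\mathfrak e$: 1) it is a complex of $\mathfrak g$-modules, with $\mathfrak g$ acting on itself by the adjoint representation; 2) $\partial_2\{u,v\}=[u,v]-\partial_1(u)\triangleright v$; 3) $\{\partial_2(x),\partial_2(y)\}=[x,y]$; 4) $\{u,[v,w]\}=\{\partial_2\{u,v\},w\}-\{\partial_2\{u,w\},v\}$; 5) $\{[u,v],w\}=\partial_1(u)\triangleright\{v,w\}+\{u,[v,w]\}-\partial_1(v)\triangleright\{u,w\}-\{v,[u,w]\}$; 6) $\{\partial_2(x),v\}+\{v,\partial_2(x)\}=-\partial_1(v)\triangleright x$. Putting $v\triangleright'x=-\{\partial_2(x),v\}$ turns $(\partial_2,\triangleright')$ into a crossed module of Lie algebras. Morphisms of (2-)crossed modules, in each of the three settings, are tuples of structure maps (Hopf algebra maps, group homomorphisms, Lie algebra maps), one in each degree, commuting with the boundary maps and preserving the actions and (for 2-crossed modules) the Peiffer liftings.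
   Formalization: The Peiffer lifting of a 2-crossed module of Hopf algebras is additionally required to be a coalgebra map (compatible with coproduct and counit); with bare bilinearity it need not restrict to group-like elements, so the stated functor would not exist. *)

theory Defs
  imports "HOL-Algebra.Module" "HOL-Algebra.AbelCoset" "HOL-Algebra.Bij"
begin

section \<open>Categories and functors\<close>

text \<open>Hom-sets are indexed by source and target and need not be disjoint, so identities, composition
  and the arrow part of a functor receive the objects as arguments; \<open>Cmp C X Y Z g f\<close> is
  \<open>g\<close> after \<open>f\<close> for \<open>f : X \<rightarrow> Y\<close> and \<open>g : Y \<rightarrow> Z\<close>.\<close>

record ('o, 'm) cat =
  Obj :: "'o set"
  Hom :: "'o \<Rightarrow> 'o \<Rightarrow> 'm set"
  Idn :: "'o \<Rightarrow> 'm"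
  Cmp :: "'o \<Rightarrow> 'o \<Rightarrow> 'o \<Rightarrow> 'm \<Rightarrow> 'm \<Rightarrow> 'm"

definition is_category :: "('o, 'm) cat \<Rightarrow> bool" where
  "is_category C \<longleftrightarrow>
    (\<forall>X\<in>Obj C. Idn C X \<in> Hom C X X) \<and>
    (\<forall>X\<in>Obj C. \<forall>Y\<in>Obj C. \<forall>Z\<in>Obj C. \<forall>f\<in>Hom C X Y. \<forall>g\<in>Hom C Y Z.
       Cmp C X Y Z g f \<in> Hom C X Z) \<and>
    (\<forall>X\<in>Obj C. \<forall>Y\<in>Obj C. \<forall>f\<in>Hom C X Y.
       Cmp C X X Y f (Idn C X) = f \<and> Cmp C X Y Y (Idn C Y) f = f) \<and>
    (\<forall>W\<in>Obj C. \<forall>X\<in>Obj C. \<forall>Y\<in>Obj C. \<forall>Z\<in>Obj C.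
       \<forall>f\<in>Hom C W X. \<forall>g\<in>Hom C X Y. \<forall>h\<in>Hom C Y Z.
       Cmp C W Y Z h (Cmp C W X Y g f) = Cmp C W X Z (Cmp C X Y Z h g) f)"

record ('o, 'm, 'p, 'n) funct =
  fobj :: "'o \<Rightarrow> 'p"
  farr :: "'o \<Rightarrow> 'o \<Rightarrow> 'm \<Rightarrow> 'n"

definition is_functor ::
  "('o, 'm) cat \<Rightarrow> ('p, 'n) cat \<Rightarrow> ('o, 'm, 'p, 'n) funct \<Rightarrow> bool" where
  "is_functor C D F \<longleftrightarrow> is_category C \<and> is_category D \<and>
    (\<forall>X\<in>Obj C. fobj F X \<in> Obj D) \<and>
    (\<forall>X\<in>Obj C. \<forall>Y\<in>Obj C. \<forall>f\<in>Hom C X Y. farr F X Y f \<in> Hom D (fobj F X) (fobj F Y)) \<and>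
    (\<forall>X\<in>Obj C. farr F X X (Idn C X) = Idn D (fobj F X)) \<and>
    (\<forall>X\<in>Obj C. \<forall>Y\<in>Obj C. \<forall>Z\<in>Obj C. \<forall>f\<in>Hom C X Y. \<forall>g\<in>Hom C Y Z.
       farr F X Z (Cmp C X Y Z g f)
         = Cmp D (fobj F X) (fobj F Y) (fobj F Z) (farr F Y Z g) (farr F X Y f))"

definition funct_comp ::
  "('p, 'n, 'q, 'r) funct \<Rightarrow> ('o, 'm, 'p, 'n) funct \<Rightarrow> ('o, 'm, 'q, 'r) funct" where
  "funct_comp G F = \<lparr>
     fobj = \<lambda>X. fobj G (fobj F X),
     farr = \<lambda>X Y f. farr G (fobj F X) (fobj F Y) (farr F X Y f)\<rparr>"

definition funct_eq ::
  "('o, 'm) cat \<Rightarrow> ('o, 'm, 'p, 'n) funct \<Rightarrow> ('o, 'm, 'p, 'n) funct \<Rightarrow> bool" where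
  "funct_eq C F G \<longleftrightarrow>
    (\<forall>X\<in>Obj C. fobj F X = fobj G X) \<and>
    (\<forall>X\<in>Obj C. \<forall>Y\<in>Obj C. \<forall>f\<in>Hom C X Y. farr F X Y f = farr G X Y f)"


section \<open>Linear maps and tensor products\<close>

text \<open>Vector spaces are HOL-Algebra modules over a field \<open>\<kappa>\<close>. The record type of modules also
  carries \<open>mult\<close> and \<open>one\<close>, which the locale \<open>module\<close> ignores; where there is no product they are
  set to \<open>undefined\<close>.\<close>

definition linear_map ::
  "'k ring \<Rightarrow> ('k, 'a, 'x) module_scheme \<Rightarrow> ('k, 'b, 'y) module_scheme \<Rightarrow> ('a \<Rightarrow> 'b) \<Rightarrow> bool" where
  "linear_map \<kappa> A B f \<longleftrightarrow> f \<in> carrier A \<rightarrow> carrier B \<and>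
    (\<forall>x\<in>carrier A. \<forall>y\<in>carrier A. f (x \<oplus>\<^bsub>A\<^esub> y) = f x \<oplus>\<^bsub>B\<^esub> f y) \<and>
    (\<forall>r\<in>carrier \<kappa>. \<forall>x\<in>carrier A. f (r \<odot>\<^bsub>A\<^esub> x) = r \<odot>\<^bsub>B\<^esub> f x)"

definition bilinear_map ::
  "'k ring \<Rightarrow> ('k, 'a, 'x) module_scheme \<Rightarrow> ('k, 'b, 'y) module_scheme \<Rightarrow>
    ('k, 'c, 'z) module_scheme \<Rightarrow> ('a \<Rightarrow> 'b \<Rightarrow> 'c) \<Rightarrow> bool" where
  "bilinear_map \<kappa> A B C f \<longleftrightarrow>
    (\<forall>x\<in>carrier A. linear_map \<kappa> B C (f x)) \<and>
    (\<forall>y\<in>carrier B. linear_map \<kappa> A C (\<lambda>x. f x y))"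

definition free_module :: "'k ring \<Rightarrow> 's set \<Rightarrow> ('k, 's \<Rightarrow> 'k) module" where
  "free_module \<kappa> S = \<lparr>
     carrier = {t. range t \<subseteq> carrier \<kappa> \<and> {s. t s \<noteq> \<zero>\<^bsub>\<kappa>\<^esub>} \<subseteq> S \<and> finite {s. t s \<noteq> \<zero>\<^bsub>\<kappa>\<^esub>}},
     mult = undefined,
     one = undefined,
     zero = \<lambda>s. \<zero>\<^bsub>\<kappa>\<^esub>,
     add = \<lambda>t u s. t s \<oplus>\<^bsub>\<kappa>\<^esub> u s,
     smult = \<lambda>r t s. r \<otimes>\<^bsub>\<kappa>\<^esub> t s\<rparr>"

definition free_gen :: "'k ring \<Rightarrow> 's \<Rightarrow> 's \<Rightarrow> 'k" where
  "free_gen \<kappa> s = (\<lambda>s'. if s' = s then \<one>\<^bsub>\<kappa>\<^esub> else \<zero>\<^bsub>\<kappa>\<^esub>)"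

definition tensor_relations ::
  "'k ring \<Rightarrow> ('k, 'a, 'x) module_scheme \<Rightarrow> ('k, 'b, 'y) module_scheme \<Rightarrow> ('a \<times> 'b \<Rightarrow> 'k) set" where
  "tensor_relations \<kappa> A B = (let F = free_module \<kappa> (carrier A \<times> carrier B) in
     {free_gen \<kappa> (x \<oplus>\<^bsub>A\<^esub> x', y) \<ominus>\<^bsub>F\<^esub> (free_gen \<kappa> (x, y) \<oplus>\<^bsub>F\<^esub> free_gen \<kappa> (x', y)) | x x' y.
        x \<in> carrier A \<and> x' \<in> carrier A \<and> y \<in> carrier B} \<union>
     {free_gen \<kappa> (x, y \<oplus>\<^bsub>B\<^esub> y') \<ominus>\<^bsub>F\<^esub> (free_gen \<kappa> (x, y) \<oplus>\<^bsub>F\<^esub> free_gen \<kappa> (x, y')) | x y y'.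
        x \<in> carrier A \<and> y \<in> carrier B \<and> y' \<in> carrier B} \<union>
     {free_gen \<kappa> (r \<odot>\<^bsub>A\<^esub> x, y) \<ominus>\<^bsub>F\<^esub> r \<odot>\<^bsub>F\<^esub> free_gen \<kappa> (x, y) | r x y.
        r \<in> carrier \<kappa> \<and> x \<in> carrier A \<and> y \<in> carrier B} \<union>
     {free_gen \<kappa> (x, r \<odot>\<^bsub>B\<^esub> y) \<ominus>\<^bsub>F\<^esub> r \<odot>\<^bsub>F\<^esub> free_gen \<kappa> (x, y) | r x y.
        r \<in> carrier \<kappa> \<and> x \<in> carrier A \<and> y \<in> carrier B})"

definition tensor_kernel ::
  "'k ring \<Rightarrow> ('k, 'a, 'x) module_scheme \<Rightarrow> ('k, 'b, 'y) module_scheme \<Rightarrow> ('a \<times> 'b \<Rightarrow> 'k) set" where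
  "tensor_kernel \<kappa> A B =
     \<Inter>{N. submodule N \<kappa> (free_module \<kappa> (carrier A \<times> carrier B)) \<and> tensor_relations \<kappa> A B \<subseteq> N}"

text \<open>\<open>A \<otimes> B\<close> is the quotient of the free vector space on \<open>A \<times> B\<close>; its elements are cosets.\<close>

definition tensor ::
  "'k ring \<Rightarrow> ('k, 'a, 'x) module_scheme \<Rightarrow> ('k, 'b, 'y) module_scheme \<Rightarrow>
    ('k, ('a \<times> 'b \<Rightarrow> 'k) set) module" where
  "tensor \<kappa> A B = (let F = free_module \<kappa> (carrier A \<times> carrier B); N = tensor_kernel \<kappa> A B in \<lparr>
     carrier = a_rcosets\<^bsub>F\<^esub> N,
     mult = undefined,
     one = undefined,
     zero = N,
     add = \<lambda>T U. T <+>\<^bsub>F\<^esub> U,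
     smult = \<lambda>r T. \<Union>t\<in>T. N +>\<^bsub>F\<^esub> (r \<odot>\<^bsub>F\<^esub> t)\<rparr>)"

definition tens ::
  "'k ring \<Rightarrow> ('k, 'a, 'x) module_scheme \<Rightarrow> ('k, 'b, 'y) module_scheme \<Rightarrow> 'a \<Rightarrow> 'b \<Rightarrow>
    ('a \<times> 'b \<Rightarrow> 'k) set" where
  "tens \<kappa> A B x y =
     tensor_kernel \<kappa> A B +>\<^bsub>free_module \<kappa> (carrier A \<times> carrier B)\<^esub> free_gen \<kappa> (x, y)"

text \<open>The linear map \<open>A \<otimes> B \<rightarrow> V\<close> induced by a bilinear map \<open>f\<close>: a coset is evaluated on an arbitrary
  representative, which for bilinear \<open>f\<close> does not affect the result. Only used with bilinear \<open>f\<close>.\<close>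

definition tensor_lift ::
  "'k ring \<Rightarrow> ('k, 'c, 'z) module_scheme \<Rightarrow> ('a \<Rightarrow> 'b \<Rightarrow> 'c) \<Rightarrow> ('a \<times> 'b \<Rightarrow> 'k) set \<Rightarrow> 'c" where
  "tensor_lift \<kappa> V f T = (let t = (SOME t. t \<in> T) in
     \<Oplus>\<^bsub>V\<^esub>p\<in>{p. t p \<noteq> \<zero>\<^bsub>\<kappa>\<^esub>}. t p \<odot>\<^bsub>V\<^esub> f (fst p) (snd p))"


section \<open>Cocommutative Hopf algebras\<close>

record ('k, 'a) hopf = "('k, 'a) module" +
  comult :: "'a \<Rightarrow> ('a \<times> 'a \<Rightarrow> 'k) set"
  counit :: "'a \<Rightarrow> 'k"
  antipode :: "'a \<Rightarrow> 'a"

text \<open>Sweedler sums: \<open>sweedler \<kappa> H V x f\<close> is the element \<open>\<Sum> f x' x''\<close> of \<open>V\<close>. Longer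
  Sweedler sums are obtained by nesting.\<close>

definition sweedler ::
  "'k ring \<Rightarrow> ('k, 'a) hopf \<Rightarrow> ('k, 'c, 'z) module_scheme \<Rightarrow> 'a \<Rightarrow> ('a \<Rightarrow> 'a \<Rightarrow> 'c) \<Rightarrow> 'c" where
  "sweedler \<kappa> H V x f = tensor_lift \<kappa> V f (comult H x)"

text \<open>Coassociativity is expressed in \<open>H \<otimes> (H \<otimes> H)\<close>, the left-hand side being
  \<open>(\<delta> \<otimes> id) \<circ> \<delta>\<close> followed by the associator.\<close>

locale cocomm_hopf_algebra = module \<kappa> H + ring H
  for \<kappa> :: "'k ring" and H :: "('k, 'a) hopf" +
  assumes smult_mult_left: "\<lbrakk>r \<in> carrier \<kappa>; x \<in> carrier H; y \<in> carrier H\<rbrakk> \<Longrightarrow>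
      (r \<odot>\<^bsub>H\<^esub> x) \<otimes>\<^bsub>H\<^esub> y = r \<odot>\<^bsub>H\<^esub> (x \<otimes>\<^bsub>H\<^esub> y)"
    and smult_mult_right: "\<lbrakk>r \<in> carrier \<kappa>; x \<in> carrier H; y \<in> carrier H\<rbrakk> \<Longrightarrow>
      x \<otimes>\<^bsub>H\<^esub> (r \<odot>\<^bsub>H\<^esub> y) = r \<odot>\<^bsub>H\<^esub> (x \<otimes>\<^bsub>H\<^esub> y)"
    and comult_linear: "linear_map \<kappa> H (tensor \<kappa> H H) (comult H)"
    and counit_closed: "counit H \<in> carrier H \<rightarrow> carrier \<kappa>"
    and counit_add: "\<lbrakk>x \<in> carrier H; y \<in> carrier H\<rbrakk> \<Longrightarrow>
      counit H (x \<oplus>\<^bsub>H\<^esub> y) = counit H x \<oplus>\<^bsub>\<kappa>\<^esub> counit H y"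
    and counit_smult: "\<lbrakk>r \<in> carrier \<kappa>; x \<in> carrier H\<rbrakk> \<Longrightarrow>
      counit H (r \<odot>\<^bsub>H\<^esub> x) = r \<otimes>\<^bsub>\<kappa>\<^esub> counit H x"
    and coassoc: "x \<in> carrier H \<Longrightarrow>
      sweedler \<kappa> H (tensor \<kappa> H (tensor \<kappa> H H)) x (\<lambda>x1 x2.
        sweedler \<kappa> H (tensor \<kappa> H (tensor \<kappa> H H)) x1 (\<lambda>x11 x12.
          tens \<kappa> H (tensor \<kappa> H H) x11 (tens \<kappa> H H x12 x2)))
      = sweedler \<kappa> H (tensor \<kappa> H (tensor \<kappa> H H)) x (\<lambda>x1 x2.
          tens \<kappa> H (tensor \<kappa> H H) x1 (comult H x2))"
    and counit_left: "x \<in> carrier H \<Longrightarrow>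
      sweedler \<kappa> H H x (\<lambda>x1 x2. counit H x1 \<odot>\<^bsub>H\<^esub> x2) = x"
    and counit_right: "x \<in> carrier H \<Longrightarrow>
      sweedler \<kappa> H H x (\<lambda>x1 x2. counit H x2 \<odot>\<^bsub>H\<^esub> x1) = x"
    and comult_mult: "\<lbrakk>x \<in> carrier H; y \<in> carrier H\<rbrakk> \<Longrightarrow>
      comult H (x \<otimes>\<^bsub>H\<^esub> y) =
        sweedler \<kappa> H (tensor \<kappa> H H) x (\<lambda>x1 x2. sweedler \<kappa> H (tensor \<kappa> H H) y (\<lambda>y1 y2.
          tens \<kappa> H H (x1 \<otimes>\<^bsub>H\<^esub> y1) (x2 \<otimes>\<^bsub>H\<^esub> y2)))"
    and comult_one: "comult H \<one>\<^bsub>H\<^esub> = tens \<kappa> H H \<one>\<^bsub>H\<^esub> \<one>\<^bsub>H\<^esub>"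
    and counit_mult: "\<lbrakk>x \<in> carrier H; y \<in> carrier H\<rbrakk> \<Longrightarrow>
      counit H (x \<otimes>\<^bsub>H\<^esub> y) = counit H x \<otimes>\<^bsub>\<kappa>\<^esub> counit H y"
    and counit_one: "counit H \<one>\<^bsub>H\<^esub> = \<one>\<^bsub>\<kappa>\<^esub>"
    and antipode_linear: "linear_map \<kappa> H H (antipode H)"
    and antipode_left: "x \<in> carrier H \<Longrightarrow>
      sweedler \<kappa> H H x (\<lambda>x1 x2. antipode H x1 \<otimes>\<^bsub>H\<^esub> x2) = counit H x \<odot>\<^bsub>H\<^esub> \<one>\<^bsub>H\<^esub>"
    and antipode_right: "x \<in> carrier H \<Longrightarrow>
      sweedler \<kappa> H H x (\<lambda>x1 x2. x1 \<otimes>\<^bsub>H\<^esub> antipode H x2) = counit H x \<odot>\<^bsub>H\<^esub> \<one>\<^bsub>H\<^esub>"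
    and cocomm: "x \<in> carrier H \<Longrightarrow>
      sweedler \<kappa> H (tensor \<kappa> H H) x (\<lambda>x1 x2. tens \<kappa> H H x2 x1) = comult H x"

definition hopf_hom :: "'k ring \<Rightarrow> ('k, 'a) hopf \<Rightarrow> ('k, 'b) hopf \<Rightarrow> ('a \<Rightarrow> 'b) \<Rightarrow> bool" where
  "hopf_hom \<kappa> A B f \<longleftrightarrow> linear_map \<kappa> A B f \<and>
    (\<forall>x\<in>carrier A. \<forall>y\<in>carrier A. f (x \<otimes>\<^bsub>A\<^esub> y) = f x \<otimes>\<^bsub>B\<^esub> f y) \<and>
    f \<one>\<^bsub>A\<^esub> = \<one>\<^bsub>B\<^esub> \<and>
    (\<forall>x\<in>carrier A. comult B (f x)
       = sweedler \<kappa> A (tensor \<kappa> B B) x (\<lambda>x1 x2. tens \<kappa> B B (f x1) (f x2))) \<and>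
    (\<forall>x\<in>carrier A. counit B (f x) = counit A x)"

definition hopf_ad :: "'k ring \<Rightarrow> ('k, 'a) hopf \<Rightarrow> 'a \<Rightarrow> 'a \<Rightarrow> 'a" where
  "hopf_ad \<kappa> H x y = sweedler \<kappa> H H x (\<lambda>x1 x2. x1 \<otimes>\<^bsub>H\<^esub> y \<otimes>\<^bsub>H\<^esub> antipode H x2)"

text \<open>The zero object: \<open>\<kappa>\<close> itself, with \<open>\<delta>(r) = r \<otimes> 1\<close>.\<close>

definition hopf_zero :: "'k ring \<Rightarrow> ('k, 'k) hopf" where
  "hopf_zero \<kappa> = (let M = \<lparr>carrier = carrier \<kappa>, mult = mult \<kappa>, one = one \<kappa>, zero = zero \<kappa>,
       add = add \<kappa>, smult = mult \<kappa>\<rparr>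
     in \<lparr>carrier = carrier \<kappa>, mult = mult \<kappa>, one = one \<kappa>, zero = zero \<kappa>,
       add = add \<kappa>, smult = mult \<kappa>,
       comult = \<lambda>r. tens \<kappa> M M r \<one>\<^bsub>\<kappa>\<^esub>, counit = \<lambda>r. r, antipode = \<lambda>r. r\<rparr>)"

locale module_bialgebra =
  fixes \<kappa> :: "'k ring" and H :: "('k, 'h) hopf" and I :: "('k, 'i) hopf"
    and act :: "'h \<Rightarrow> 'i \<Rightarrow> 'i" (infixr "\<rhd>" 75)
  assumes act_bilinear: "bilinear_map \<kappa> H I I (\<rhd>)"
    and one_act: "v \<in> carrier I \<Longrightarrow> \<one>\<^bsub>H\<^esub> \<rhd> v = v"
    and mult_act: "\<lbrakk>x \<in> carrier H; y \<in> carrier H; v \<in> carrier I\<rbrakk> \<Longrightarrow>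
      (x \<otimes>\<^bsub>H\<^esub> y) \<rhd> v = x \<rhd> y \<rhd> v"
    and act_one: "x \<in> carrier H \<Longrightarrow> x \<rhd> \<one>\<^bsub>I\<^esub> = counit H x \<odot>\<^bsub>I\<^esub> \<one>\<^bsub>I\<^esub>"
    and act_mult: "\<lbrakk>x \<in> carrier H; u \<in> carrier I; v \<in> carrier I\<rbrakk> \<Longrightarrow>
      x \<rhd> (u \<otimes>\<^bsub>I\<^esub> v) = sweedler \<kappa> H I x (\<lambda>x1 x2. (x1 \<rhd> u) \<otimes>\<^bsub>I\<^esub> (x2 \<rhd> v))"
    and act_comult: "\<lbrakk>x \<in> carrier H; v \<in> carrier I\<rbrakk> \<Longrightarrow>
      comult I (x \<rhd> v) =
        sweedler \<kappa> H (tensor \<kappa> I I) x (\<lambda>x1 x2. sweedler \<kappa> I (tensor \<kappa> I I) v (\<lambda>v1 v2.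
          tens \<kappa> I I (x1 \<rhd> v1) (x2 \<rhd> v2)))"
    and act_counit: "\<lbrakk>x \<in> carrier H; v \<in> carrier I\<rbrakk> \<Longrightarrow>
      counit I (x \<rhd> v) = counit H x \<otimes>\<^bsub>\<kappa>\<^esub> counit I v"

locale hopf_xmod =
  fixes \<kappa> :: "'k ring" and I :: "('k, 'i) hopf" and H :: "('k, 'h) hopf"
    and d :: "'i \<Rightarrow> 'h" ("\<partial>")
    and act :: "'h \<Rightarrow> 'i \<Rightarrow> 'i" (infixr "\<rhd>" 75)
  assumes hopf_I: "cocomm_hopf_algebra \<kappa> I"
    and hopf_H: "cocomm_hopf_algebra \<kappa> H"
    and hom_d: "hopf_hom \<kappa> I H \<partial>"
    and act: "module_bialgebra \<kappa> H I (\<rhd>)"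
    and d_act: "\<lbrakk>x \<in> carrier H; v \<in> carrier I\<rbrakk> \<Longrightarrow> \<partial> (x \<rhd> v) = hopf_ad \<kappa> H x (\<partial> v)"
    and peiffer: "\<lbrakk>u \<in> carrier I; v \<in> carrier I\<rbrakk> \<Longrightarrow> \<partial> u \<rhd> v = hopf_ad \<kappa> I u v"

text \<open>The action \<open>\<rhd>'\<close> of \<open>I\<close> on \<open>K\<close> attached to a Peiffer lifting \<open>pf\<close>.\<close>

definition hopf_lift_act ::
  "'k ring \<Rightarrow> ('k, 'l) hopf \<Rightarrow> ('l \<Rightarrow> 'i) \<Rightarrow> ('i \<Rightarrow> 'i \<Rightarrow> 'l) \<Rightarrow> 'i \<Rightarrow> 'l \<Rightarrow> 'l" where
  "hopf_lift_act \<kappa> K d2 pf x k =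
     sweedler \<kappa> K K k (\<lambda>k1 k2. k1 \<otimes>\<^bsub>K\<^esub> pf (d2 (antipode K k2)) x)"

text \<open>The Peiffer lifting is required to be a morphism \<open>I \<otimes> I \<rightarrow> K\<close> of coalgebras
  (\<open>lift_comult\<close>, \<open>lift_counit\<close>). Mere bilinearity would not suffice for restricting it to
  group-like or primitive elements: for \<open>H = \<rat>\<close>, \<open>I = \<rat>[\<int>]\<close> with generator \<open>t\<close>,
  \<open>K = \<rat>[\<int>/2]\<close> with generator \<open>s\<close> and zero boundary maps, \<open>{t^a, t^b} = u^(a b)\<close> with
  \<open>u = (3 - s)/2\<close> satisfies all other conditions, but \<open>{t, t} = u\<close> is not group-like.\<close>

locale hopf_x2mod =
  fixes \<kappa> :: "'k ring" and K :: "('k, 'l) hopf" and I :: "('k, 'i) hopf" and H :: "('k, 'h) hopf"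
    and d2 :: "'l \<Rightarrow> 'i" ("\<partial>\<^sub>2") and d1 :: "'i \<Rightarrow> 'h" ("\<partial>\<^sub>1")
    and actI :: "'h \<Rightarrow> 'i \<Rightarrow> 'i" (infixr "\<rhd>\<^sub>I" 75)
    and actK :: "'h \<Rightarrow> 'l \<Rightarrow> 'l" (infixr "\<rhd>\<^sub>K" 75)
    and pf :: "'i \<Rightarrow> 'i \<Rightarrow> 'l"
  assumes hopf_K: "cocomm_hopf_algebra \<kappa> K"
    and hopf_I: "cocomm_hopf_algebra \<kappa> I"
    and hopf_H: "cocomm_hopf_algebra \<kappa> H"
    and hom_d2: "hopf_hom \<kappa> K I \<partial>\<^sub>2"
    and hom_d1: "hopf_hom \<kappa> I H \<partial>\<^sub>1"
    and chain_complex: "k \<in> carrier K \<Longrightarrow> \<partial>\<^sub>1 (\<partial>\<^sub>2 k) = counit K k \<odot>\<^bsub>H\<^esub> \<one>\<^bsub>H\<^esub>"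
    and actI: "module_bialgebra \<kappa> H I (\<rhd>\<^sub>I)"
    and actK: "module_bialgebra \<kappa> H K (\<rhd>\<^sub>K)"
    and lift_bilinear: "bilinear_map \<kappa> I I K pf"
    and lift_comult: "\<lbrakk>x \<in> carrier I; y \<in> carrier I\<rbrakk> \<Longrightarrow>
      comult K (pf x y) =
        sweedler \<kappa> I (tensor \<kappa> K K) x (\<lambda>x1 x2. sweedler \<kappa> I (tensor \<kappa> K K) y (\<lambda>y1 y2.
          tens \<kappa> K K (pf x1 y1) (pf x2 y2)))"
    and lift_counit: "\<lbrakk>x \<in> carrier I; y \<in> carrier I\<rbrakk> \<Longrightarrow>
      counit K (pf x y) = counit I x \<otimes>\<^bsub>\<kappa>\<^esub> counit I y"
    and lift_equivariant: "\<lbrakk>a \<in> carrier H; x \<in> carrier I; y \<in> carrier I\<rbrakk> \<Longrightarrow>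
      a \<rhd>\<^sub>K pf x y = sweedler \<kappa> H K a (\<lambda>a1 a2. pf (a1 \<rhd>\<^sub>I x) (a2 \<rhd>\<^sub>I y))"
    and d2_act: "\<lbrakk>a \<in> carrier H; k \<in> carrier K\<rbrakk> \<Longrightarrow> \<partial>\<^sub>2 (a \<rhd>\<^sub>K k) = a \<rhd>\<^sub>I \<partial>\<^sub>2 k"
    and d1_act: "\<lbrakk>a \<in> carrier H; x \<in> carrier I\<rbrakk> \<Longrightarrow> \<partial>\<^sub>1 (a \<rhd>\<^sub>I x) = hopf_ad \<kappa> H a (\<partial>\<^sub>1 x)"
    and d2_lift: "\<lbrakk>x \<in> carrier I; y \<in> carrier I\<rbrakk> \<Longrightarrow>
      \<partial>\<^sub>2 (pf x y) =
        sweedler \<kappa> I I x (\<lambda>x1 x2. sweedler \<kappa> I I y (\<lambda>y1 y2.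
          hopf_ad \<kappa> I x1 y1 \<otimes>\<^bsub>I\<^esub> (\<partial>\<^sub>1 x2 \<rhd>\<^sub>I antipode I y2)))"
    and lift_d2: "\<lbrakk>k \<in> carrier K; l \<in> carrier K\<rbrakk> \<Longrightarrow>
      pf (\<partial>\<^sub>2 k) (\<partial>\<^sub>2 l) = sweedler \<kappa> K K l (\<lambda>l1 l2. hopf_ad \<kappa> K k l1 \<otimes>\<^bsub>K\<^esub> antipode K l2)"
    and lift_mult_right: "\<lbrakk>x \<in> carrier I; y \<in> carrier I; z \<in> carrier I\<rbrakk> \<Longrightarrow>
      pf x (y \<otimes>\<^bsub>I\<^esub> z) =
        sweedler \<kappa> I K x (\<lambda>x1 x23. sweedler \<kappa> I K x23 (\<lambda>x2 x3. sweedler \<kappa> I K y (\<lambda>y1 y2.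
          pf x1 y1 \<otimes>\<^bsub>K\<^esub> hopf_lift_act \<kappa> K \<partial>\<^sub>2 pf (\<partial>\<^sub>1 x2 \<rhd>\<^sub>I y2) (pf x3 z))))"
    and lift_mult_left: "\<lbrakk>x \<in> carrier I; y \<in> carrier I; z \<in> carrier I\<rbrakk> \<Longrightarrow>
      pf (x \<otimes>\<^bsub>I\<^esub> y) z =
        sweedler \<kappa> I K x (\<lambda>x1 x2. sweedler \<kappa> I K y (\<lambda>y1 y2. sweedler \<kappa> I K z (\<lambda>z1 z2.
          pf x1 (hopf_ad \<kappa> I y1 z1) \<otimes>\<^bsub>K\<^esub> (\<partial>\<^sub>1 x2 \<rhd>\<^sub>K pf y2 z2))))"
    and lift_d2_symm: "\<lbrakk>k \<in> carrier K; x \<in> carrier I\<rbrakk> \<Longrightarrow>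
      sweedler \<kappa> K K k (\<lambda>k1 k2. sweedler \<kappa> I K x (\<lambda>x1 x2.
        pf (\<partial>\<^sub>2 k1) x1 \<otimes>\<^bsub>K\<^esub> pf x2 (\<partial>\<^sub>2 k2)))
      = sweedler \<kappa> K K k (\<lambda>k1 k2. k1 \<otimes>\<^bsub>K\<^esub> (\<partial>\<^sub>1 x \<rhd>\<^sub>K antipode K k2))"
    and lift_xmod: "hopf_xmod \<kappa> K I \<partial>\<^sub>2 (hopf_lift_act \<kappa> K \<partial>\<^sub>2 pf)"


section \<open>Crossed modules and 2-crossed modules of groups\<close>

locale grp_action =
  fixes G :: "'g monoid" and E :: "'e monoid" and act :: "'g \<Rightarrow> 'e \<Rightarrow> 'e"
  assumes action_hom: "(\<lambda>g. restrict (act g) (carrier E)) \<in> hom G (AutoGroup E)"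

locale grp_xmod =
  fixes E :: "'e monoid" and G :: "'g monoid"
    and d :: "'e \<Rightarrow> 'g" ("\<partial>")
    and act :: "'g \<Rightarrow> 'e \<Rightarrow> 'e" (infixr "\<rhd>" 75)
  assumes group_E: "group E"
    and group_G: "group G"
    and hom_d: "\<partial> \<in> hom E G"
    and act: "grp_action G E (\<rhd>)"
    and d_act: "\<lbrakk>g \<in> carrier G; e \<in> carrier E\<rbrakk> \<Longrightarrow>
      \<partial> (g \<rhd> e) = g \<otimes>\<^bsub>G\<^esub> \<partial> e \<otimes>\<^bsub>G\<^esub> inv\<^bsub>G\<^esub> g"
    and peiffer: "\<lbrakk>e \<in> carrier E; f \<in> carrier E\<rbrakk> \<Longrightarrow>
      \<partial> e \<rhd> f = e \<otimes>\<^bsub>E\<^esub> f \<otimes>\<^bsub>E\<^esub> inv\<^bsub>E\<^esub> e"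

definition grp_lift_act ::
  "'l monoid \<Rightarrow> ('l \<Rightarrow> 'e) \<Rightarrow> ('e \<Rightarrow> 'e \<Rightarrow> 'l) \<Rightarrow> 'e \<Rightarrow> 'l \<Rightarrow> 'l" where
  "grp_lift_act L d2 pf e l = l \<otimes>\<^bsub>L\<^esub> pf (d2 (inv\<^bsub>L\<^esub> l)) e"

locale grp_x2mod =
  fixes L :: "'l monoid" and E :: "'e monoid" and G :: "'g monoid"
    and d2 :: "'l \<Rightarrow> 'e" ("\<partial>\<^sub>2") and d1 :: "'e \<Rightarrow> 'g" ("\<partial>\<^sub>1")
    and actE :: "'g \<Rightarrow> 'e \<Rightarrow> 'e" (infixr "\<rhd>\<^sub>E" 75)
    and actL :: "'g \<Rightarrow> 'l \<Rightarrow> 'l" (infixr "\<rhd>\<^sub>L" 75)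
    and pf :: "'e \<Rightarrow> 'e \<Rightarrow> 'l"
  assumes group_L: "group L"
    and group_E: "group E"
    and group_G: "group G"
    and hom_d2: "\<partial>\<^sub>2 \<in> hom L E"
    and hom_d1: "\<partial>\<^sub>1 \<in> hom E G"
    and chain_complex: "l \<in> carrier L \<Longrightarrow> \<partial>\<^sub>1 (\<partial>\<^sub>2 l) = \<one>\<^bsub>G\<^esub>"
    and actE: "grp_action G E (\<rhd>\<^sub>E)"
    and actL: "grp_action G L (\<rhd>\<^sub>L)"
    and lift_closed: "pf \<in> carrier E \<rightarrow> carrier E \<rightarrow> carrier L"
    and lift_equivariant: "\<lbrakk>g \<in> carrier G; e \<in> carrier E; f \<in> carrier E\<rbrakk> \<Longrightarrow>
      g \<rhd>\<^sub>L pf e f = pf (g \<rhd>\<^sub>E e) (g \<rhd>\<^sub>E f)"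
    and d2_act: "\<lbrakk>g \<in> carrier G; l \<in> carrier L\<rbrakk> \<Longrightarrow> \<partial>\<^sub>2 (g \<rhd>\<^sub>L l) = g \<rhd>\<^sub>E \<partial>\<^sub>2 l"
    and d1_act: "\<lbrakk>g \<in> carrier G; e \<in> carrier E\<rbrakk> \<Longrightarrow>
      \<partial>\<^sub>1 (g \<rhd>\<^sub>E e) = g \<otimes>\<^bsub>G\<^esub> \<partial>\<^sub>1 e \<otimes>\<^bsub>G\<^esub> inv\<^bsub>G\<^esub> g"
    and d2_lift: "\<lbrakk>e \<in> carrier E; f \<in> carrier E\<rbrakk> \<Longrightarrow>
      \<partial>\<^sub>2 (pf e f) = (e \<otimes>\<^bsub>E\<^esub> f \<otimes>\<^bsub>E\<^esub> inv\<^bsub>E\<^esub> e) \<otimes>\<^bsub>E\<^esub> (\<partial>\<^sub>1 e \<rhd>\<^sub>E inv\<^bsub>E\<^esub> f)"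
    and lift_d2: "\<lbrakk>l \<in> carrier L; m \<in> carrier L\<rbrakk> \<Longrightarrow>
      pf (\<partial>\<^sub>2 l) (\<partial>\<^sub>2 m) = l \<otimes>\<^bsub>L\<^esub> m \<otimes>\<^bsub>L\<^esub> inv\<^bsub>L\<^esub> l \<otimes>\<^bsub>L\<^esub> inv\<^bsub>L\<^esub> m"
    and lift_mult_right: "\<lbrakk>e \<in> carrier E; f \<in> carrier E; h \<in> carrier E\<rbrakk> \<Longrightarrow>
      pf e (f \<otimes>\<^bsub>E\<^esub> h) = pf e f \<otimes>\<^bsub>L\<^esub> grp_lift_act L \<partial>\<^sub>2 pf (\<partial>\<^sub>1 e \<rhd>\<^sub>E f) (pf e h)"
    and lift_mult_left: "\<lbrakk>e \<in> carrier E; f \<in> carrier E; h \<in> carrier E\<rbrakk> \<Longrightarrow>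
      pf (e \<otimes>\<^bsub>E\<^esub> f) h = pf e (f \<otimes>\<^bsub>E\<^esub> h \<otimes>\<^bsub>E\<^esub> inv\<^bsub>E\<^esub> f) \<otimes>\<^bsub>L\<^esub> (\<partial>\<^sub>1 e \<rhd>\<^sub>L pf f h)"
    and lift_d2_symm: "\<lbrakk>l \<in> carrier L; e \<in> carrier E\<rbrakk> \<Longrightarrow>
      pf (\<partial>\<^sub>2 l) e \<otimes>\<^bsub>L\<^esub> pf e (\<partial>\<^sub>2 l) = l \<otimes>\<^bsub>L\<^esub> (\<partial>\<^sub>1 e \<rhd>\<^sub>L inv\<^bsub>L\<^esub> l)"
    and lift_xmod: "grp_xmod L E \<partial>\<^sub>2 (grp_lift_act L \<partial>\<^sub>2 pf)"


section \<open>Crossed modules and 2-crossed modules of Lie algebras\<close>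

record ('k, 'a) lie = "('k, 'a) module" +
  bracket :: "'a \<Rightarrow> 'a \<Rightarrow> 'a"

locale lie_algebra = module \<kappa> L for \<kappa> :: "'k ring" and L :: "('k, 'a) lie" +
  assumes bracket_bilinear: "bilinear_map \<kappa> L L L (bracket L)"
    and bracket_alt: "x \<in> carrier L \<Longrightarrow> bracket L x x = \<zero>\<^bsub>L\<^esub>"
    and jacobi: "\<lbrakk>x \<in> carrier L; y \<in> carrier L; z \<in> carrier L\<rbrakk> \<Longrightarrow>
      bracket L x (bracket L y z) \<oplus>\<^bsub>L\<^esub> bracket L y (bracket L z x)
        \<oplus>\<^bsub>L\<^esub> bracket L z (bracket L x y) = \<zero>\<^bsub>L\<^esub>"

definition lie_hom :: "'k ring \<Rightarrow> ('k, 'a) lie \<Rightarrow> ('k, 'b) lie \<Rightarrow> ('a \<Rightarrow> 'b) \<Rightarrow> bool" where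
  "lie_hom \<kappa> A B f \<longleftrightarrow> linear_map \<kappa> A B f \<and>
    (\<forall>x\<in>carrier A. \<forall>y\<in>carrier A. f (bracket A x y) = bracket B (f x) (f y))"

locale lie_action =
  fixes \<kappa> :: "'k ring" and G :: "('k, 'g) lie" and E :: "('k, 'e) lie"
    and act :: "'g \<Rightarrow> 'e \<Rightarrow> 'e" (infixr "\<rhd>" 75)
  assumes act_bilinear: "bilinear_map \<kappa> G E E (\<rhd>)"
    and bracket_act: "\<lbrakk>g \<in> carrier G; h \<in> carrier G; e \<in> carrier E\<rbrakk> \<Longrightarrow>
      bracket G g h \<rhd> e = (g \<rhd> h \<rhd> e) \<ominus>\<^bsub>E\<^esub> (h \<rhd> g \<rhd> e)"
    and act_bracket: "\<lbrakk>g \<in> carrier G; e \<in> carrier E; f \<in> carrier E\<rbrakk> \<Longrightarrow>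
      g \<rhd> bracket E e f = bracket E (g \<rhd> e) f \<oplus>\<^bsub>E\<^esub> bracket E e (g \<rhd> f)"

locale lie_xmod =
  fixes \<kappa> :: "'k ring" and E :: "('k, 'e) lie" and G :: "('k, 'g) lie"
    and d :: "'e \<Rightarrow> 'g" ("\<partial>")
    and act :: "'g \<Rightarrow> 'e \<Rightarrow> 'e" (infixr "\<rhd>" 75)
  assumes lie_E: "lie_algebra \<kappa> E"
    and lie_G: "lie_algebra \<kappa> G"
    and hom_d: "lie_hom \<kappa> E G \<partial>"
    and act: "lie_action \<kappa> G E (\<rhd>)"
    and d_act: "\<lbrakk>g \<in> carrier G; e \<in> carrier E\<rbrakk> \<Longrightarrow> \<partial> (g \<rhd> e) = bracket G g (\<partial> e)"
    and peiffer: "\<lbrakk>e \<in> carrier E; f \<in> carrier E\<rbrakk> \<Longrightarrow> \<partial> e \<rhd> f = bracket E e f"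

definition lie_lift_act ::
  "('k, 'l) lie \<Rightarrow> ('l \<Rightarrow> 'e) \<Rightarrow> ('e \<Rightarrow> 'e \<Rightarrow> 'l) \<Rightarrow> 'e \<Rightarrow> 'l \<Rightarrow> 'l" where
  "lie_lift_act L d2 pf v x = \<ominus>\<^bsub>L\<^esub> pf (d2 x) v"

locale lie_x2mod =
  fixes \<kappa> :: "'k ring" and L :: "('k, 'l) lie" and E :: "('k, 'e) lie" and G :: "('k, 'g) lie"
    and d2 :: "'l \<Rightarrow> 'e" ("\<partial>\<^sub>2") and d1 :: "'e \<Rightarrow> 'g" ("\<partial>\<^sub>1")
    and actE :: "'g \<Rightarrow> 'e \<Rightarrow> 'e" (infixr "\<rhd>\<^sub>E" 75)
    and actL :: "'g \<Rightarrow> 'l \<Rightarrow> 'l" (infixr "\<rhd>\<^sub>L" 75)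
    and pf :: "'e \<Rightarrow> 'e \<Rightarrow> 'l"
  assumes lie_L: "lie_algebra \<kappa> L"
    and lie_E: "lie_algebra \<kappa> E"
    and lie_G: "lie_algebra \<kappa> G"
    and hom_d2: "lie_hom \<kappa> L E \<partial>\<^sub>2"
    and hom_d1: "lie_hom \<kappa> E G \<partial>\<^sub>1"
    and chain_complex: "x \<in> carrier L \<Longrightarrow> \<partial>\<^sub>1 (\<partial>\<^sub>2 x) = \<zero>\<^bsub>G\<^esub>"
    and actE: "lie_action \<kappa> G E (\<rhd>\<^sub>E)"
    and actL: "lie_action \<kappa> G L (\<rhd>\<^sub>L)"
    and lift_bilinear: "bilinear_map \<kappa> E E L pf"
    and lift_equivariant: "\<lbrakk>g \<in> carrier G; u \<in> carrier E; v \<in> carrier E\<rbrakk> \<Longrightarrow>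
      g \<rhd>\<^sub>L pf u v = pf (g \<rhd>\<^sub>E u) v \<oplus>\<^bsub>L\<^esub> pf u (g \<rhd>\<^sub>E v)"
    and d2_act: "\<lbrakk>g \<in> carrier G; x \<in> carrier L\<rbrakk> \<Longrightarrow> \<partial>\<^sub>2 (g \<rhd>\<^sub>L x) = g \<rhd>\<^sub>E \<partial>\<^sub>2 x"
    and d1_act: "\<lbrakk>g \<in> carrier G; u \<in> carrier E\<rbrakk> \<Longrightarrow> \<partial>\<^sub>1 (g \<rhd>\<^sub>E u) = bracket G g (\<partial>\<^sub>1 u)"
    and d2_lift: "\<lbrakk>u \<in> carrier E; v \<in> carrier E\<rbrakk> \<Longrightarrow>
      \<partial>\<^sub>2 (pf u v) = bracket E u v \<ominus>\<^bsub>E\<^esub> (\<partial>\<^sub>1 u \<rhd>\<^sub>E v)"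
    and lift_d2: "\<lbrakk>x \<in> carrier L; y \<in> carrier L\<rbrakk> \<Longrightarrow> pf (\<partial>\<^sub>2 x) (\<partial>\<^sub>2 y) = bracket L x y"
    and lift_bracket_right: "\<lbrakk>u \<in> carrier E; v \<in> carrier E; w \<in> carrier E\<rbrakk> \<Longrightarrow>
      pf u (bracket E v w) = pf (\<partial>\<^sub>2 (pf u v)) w \<ominus>\<^bsub>L\<^esub> pf (\<partial>\<^sub>2 (pf u w)) v"
    and lift_bracket_left: "\<lbrakk>u \<in> carrier E; v \<in> carrier E; w \<in> carrier E\<rbrakk> \<Longrightarrow>
      pf (bracket E u v) w =
        (\<partial>\<^sub>1 u \<rhd>\<^sub>L pf v w) \<oplus>\<^bsub>L\<^esub> pf u (bracket E v w)
          \<ominus>\<^bsub>L\<^esub> (\<partial>\<^sub>1 v \<rhd>\<^sub>L pf u w) \<ominus>\<^bsub>L\<^esub> pf v (bracket E u w)"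
    and lift_d2_symm: "\<lbrakk>x \<in> carrier L; v \<in> carrier E\<rbrakk> \<Longrightarrow>
      pf (\<partial>\<^sub>2 x) v \<oplus>\<^bsub>L\<^esub> pf v (\<partial>\<^sub>2 x) = \<ominus>\<^bsub>L\<^esub> (\<partial>\<^sub>1 v \<rhd>\<^sub>L x)"
    and lift_xmod: "lie_xmod \<kappa> L E \<partial>\<^sub>2 (lie_lift_act L \<partial>\<^sub>2 pf)"


section \<open>The six categories\<close>

text \<open>The data \<open>I \<rightarrow> H\<close> resp. \<open>K \<rightarrow> I \<rightarrow> H\<close> of a (2-)crossed module, uniformly for the three settings:
  the type parameters \<open>'L, 'E, 'G\<close> are the record types of the algebraic structures and
  \<open>'l, 'e, 'g\<close> the types of their elements.\<close>

record ('E, 'G, 'e, 'g) xmod =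
  xtop :: 'E
  xbase :: 'G
  xbd :: "'e \<Rightarrow> 'g"
  xact :: "'g \<Rightarrow> 'e \<Rightarrow> 'e"

record ('L, 'E, 'G, 'l, 'e, 'g) x2mod =
  top2 :: 'L
  mid2 :: 'E
  base2 :: 'G
  bd2 :: "'l \<Rightarrow> 'e"
  bd1 :: "'e \<Rightarrow> 'g"
  act_mid :: "'g \<Rightarrow> 'e \<Rightarrow> 'e"
  act_top :: "'g \<Rightarrow> 'l \<Rightarrow> 'l"
  plift :: "'e \<Rightarrow> 'e \<Rightarrow> 'l"

type_synonym ('e, 'g) mor2 = "('e \<Rightarrow> 'e) \<times> ('g \<Rightarrow> 'g)"
type_synonym ('l, 'e, 'g) mor3 = "('l \<Rightarrow> 'l) \<times> ('e \<Rightarrow> 'e) \<times> ('g \<Rightarrow> 'g)"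

text \<open>Components of morphisms are extensional functions, so that equality of morphisms is equality
  on the carriers.\<close>

definition xmod_cat ::
  "((('e, 'y) partial_object_scheme, ('g, 'z) partial_object_scheme, 'e, 'g) xmod \<Rightarrow> bool) \<Rightarrow>
   (('e, 'y) partial_object_scheme \<Rightarrow> ('e, 'y) partial_object_scheme \<Rightarrow> ('e \<Rightarrow> 'e) \<Rightarrow> bool) \<Rightarrow>
   (('g, 'z) partial_object_scheme \<Rightarrow> ('g, 'z) partial_object_scheme \<Rightarrow> ('g \<Rightarrow> 'g) \<Rightarrow> bool) \<Rightarrow>
   ((('e, 'y) partial_object_scheme, ('g, 'z) partial_object_scheme, 'e, 'g) xmod,
    ('e, 'g) mor2) cat" where
  "xmod_cat is_obj is_homE is_homG = \<lparr>
     Obj = {X. is_obj X},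
     Hom = (\<lambda>X Y. {(f2, f1).
       f2 \<in> extensional (carrier (xtop X)) \<and> f1 \<in> extensional (carrier (xbase X)) \<and>
       is_homE (xtop X) (xtop Y) f2 \<and> is_homG (xbase X) (xbase Y) f1 \<and>
       (\<forall>x\<in>carrier (xtop X). f1 (xbd X x) = xbd Y (f2 x)) \<and>
       (\<forall>a\<in>carrier (xbase X). \<forall>x\<in>carrier (xtop X). f2 (xact X a x) = xact Y (f1 a) (f2 x))}),
     Idn = (\<lambda>X. (\<lambda>x\<in>carrier (xtop X). x, \<lambda>a\<in>carrier (xbase X). a)),
     Cmp = (\<lambda>X Y Z (g2, g1) (f2, f1).
       (compose (carrier (xtop X)) g2 f2, compose (carrier (xbase X)) g1 f1))\<rparr>"

definition x2mod_cat ::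
  "((('l, 'x) partial_object_scheme, ('e, 'y) partial_object_scheme,
      ('g, 'z) partial_object_scheme, 'l, 'e, 'g) x2mod \<Rightarrow> bool) \<Rightarrow>
   (('l, 'x) partial_object_scheme \<Rightarrow> ('l, 'x) partial_object_scheme \<Rightarrow> ('l \<Rightarrow> 'l) \<Rightarrow> bool) \<Rightarrow>
   (('e, 'y) partial_object_scheme \<Rightarrow> ('e, 'y) partial_object_scheme \<Rightarrow> ('e \<Rightarrow> 'e) \<Rightarrow> bool) \<Rightarrow>
   (('g, 'z) partial_object_scheme \<Rightarrow> ('g, 'z) partial_object_scheme \<Rightarrow> ('g \<Rightarrow> 'g) \<Rightarrow> bool) \<Rightarrow>
   ((('l, 'x) partial_object_scheme, ('e, 'y) partial_object_scheme,
      ('g, 'z) partial_object_scheme, 'l, 'e, 'g) x2mod, ('l, 'e, 'g) mor3) cat" where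
  "x2mod_cat is_obj is_homL is_homE is_homG = \<lparr>
     Obj = {X. is_obj X},
     Hom = (\<lambda>X Y. {(f3, f2, f1).
       f3 \<in> extensional (carrier (top2 X)) \<and> f2 \<in> extensional (carrier (mid2 X)) \<and>
       f1 \<in> extensional (carrier (base2 X)) \<and>
       is_homL (top2 X) (top2 Y) f3 \<and> is_homE (mid2 X) (mid2 Y) f2 \<and>
       is_homG (base2 X) (base2 Y) f1 \<and>
       (\<forall>k\<in>carrier (top2 X). f2 (bd2 X k) = bd2 Y (f3 k)) \<and>
       (\<forall>x\<in>carrier (mid2 X). f1 (bd1 X x) = bd1 Y (f2 x)) \<and>
       (\<forall>a\<in>carrier (base2 X). \<forall>x\<in>carrier (mid2 X).
          f2 (act_mid X a x) = act_mid Y (f1 a) (f2 x)) \<and>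
       (\<forall>a\<in>carrier (base2 X). \<forall>k\<in>carrier (top2 X).
          f3 (act_top X a k) = act_top Y (f1 a) (f3 k)) \<and>
       (\<forall>x\<in>carrier (mid2 X). \<forall>y\<in>carrier (mid2 X).
          f3 (plift X x y) = plift Y (f2 x) (f2 y))}),
     Idn = (\<lambda>X. (\<lambda>k\<in>carrier (top2 X). k, \<lambda>x\<in>carrier (mid2 X). x, \<lambda>a\<in>carrier (base2 X). a)),
     Cmp = (\<lambda>X Y Z (g3, g2, g1) (f3, f2, f1).
       (compose (carrier (top2 X)) g3 f3, compose (carrier (mid2 X)) g2 f2,
        compose (carrier (base2 X)) g1 f1))\<rparr>"

type_synonym ('k, 'e, 'g) xhopf = "(('k, 'e) hopf, ('k, 'g) hopf, 'e, 'g) xmod"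
type_synonym ('k, 'e, 'g) xlie = "(('k, 'e) lie, ('k, 'g) lie, 'e, 'g) xmod"
type_synonym ('e, 'g) xgrp = "('e monoid, 'g monoid, 'e, 'g) xmod"
type_synonym ('k, 'l, 'e, 'g) x2hopf =
  "(('k, 'l) hopf, ('k, 'e) hopf, ('k, 'g) hopf, 'l, 'e, 'g) x2mod"
type_synonym ('k, 'l, 'e, 'g) x2lie =
  "(('k, 'l) lie, ('k, 'e) lie, ('k, 'g) lie, 'l, 'e, 'g) x2mod"
type_synonym ('l, 'e, 'g) x2grp = "('l monoid, 'e monoid, 'g monoid, 'l, 'e, 'g) x2mod"

definition XHopf :: "'k ring \<Rightarrow> (('k, 'e, 'g) xhopf, ('e, 'g) mor2) cat" where
  "XHopf \<kappa> = xmod_cat (\<lambda>X. hopf_xmod \<kappa> (xtop X) (xbase X) (xbd X) (xact X))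
     (hopf_hom \<kappa>) (hopf_hom \<kappa>)"

definition XLie :: "'k ring \<Rightarrow> (('k, 'e, 'g) xlie, ('e, 'g) mor2) cat" where
  "XLie \<kappa> = xmod_cat (\<lambda>X. lie_xmod \<kappa> (xtop X) (xbase X) (xbd X) (xact X))
     (lie_hom \<kappa>) (lie_hom \<kappa>)"

definition XGrp :: "(('e, 'g) xgrp, ('e, 'g) mor2) cat" where
  "XGrp = xmod_cat (\<lambda>X. grp_xmod (xtop X) (xbase X) (xbd X) (xact X))
     (\<lambda>A B f. f \<in> hom A B) (\<lambda>A B f. f \<in> hom A B)"

definition X2Hopf :: "'k ring \<Rightarrow> (('k, 'l, 'e, 'g) x2hopf, ('l, 'e, 'g) mor3) cat" where
  "X2Hopf \<kappa> = x2mod_cat (\<lambda>X. hopf_x2mod \<kappa> (top2 X) (mid2 X) (base2 X) (bd2 X) (bd1 X)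
       (act_mid X) (act_top X) (plift X))
     (hopf_hom \<kappa>) (hopf_hom \<kappa>) (hopf_hom \<kappa>)"

definition X2Lie :: "'k ring \<Rightarrow> (('k, 'l, 'e, 'g) x2lie, ('l, 'e, 'g) mor3) cat" where
  "X2Lie \<kappa> = x2mod_cat (\<lambda>X. lie_x2mod \<kappa> (top2 X) (mid2 X) (base2 X) (bd2 X) (bd1 X)
       (act_mid X) (act_top X) (plift X))
     (lie_hom \<kappa>) (lie_hom \<kappa>) (lie_hom \<kappa>)"

definition X2Grp :: "(('l, 'e, 'g) x2grp, ('l, 'e, 'g) mor3) cat" where
  "X2Grp = x2mod_cat (\<lambda>X. grp_x2mod (top2 X) (mid2 X) (base2 X) (bd2 X) (bd1 X)
       (act_mid X) (act_top X) (plift X))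
     (\<lambda>A B f. f \<in> hom A B) (\<lambda>A B f. f \<in> hom A B) (\<lambda>A B f. f \<in> hom A B)"


section \<open>Primitive and group-like elements\<close>

definition Prim :: "'k ring \<Rightarrow> ('k, 'a) hopf \<Rightarrow> 'a set" where
  "Prim \<kappa> H = {x \<in> carrier H.
     comult H x = tens \<kappa> H H x \<one>\<^bsub>H\<^esub> \<oplus>\<^bsub>tensor \<kappa> H H\<^esub> tens \<kappa> H H \<one>\<^bsub>H\<^esub> x}"

definition Gl :: "'k ring \<Rightarrow> ('k, 'a) hopf \<Rightarrow> 'a set" where
  "Gl \<kappa> H = {x \<in> carrier H. comult H x = tens \<kappa> H H x x \<and> counit H x = \<one>\<^bsub>\<kappa>\<^esub>}"

text \<open>All operations are restricted to the carriers, so that equality of the resulting records only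
  depends on the values on the carriers.\<close>

definition prim_lie :: "'k ring \<Rightarrow> ('k, 'a) hopf \<Rightarrow> ('k, 'a) lie" where
  "prim_lie \<kappa> H = \<lparr>
     carrier = Prim \<kappa> H,
     mult = undefined,
     one = undefined,
     zero = \<zero>\<^bsub>H\<^esub>,
     add = (\<lambda>x\<in>Prim \<kappa> H. \<lambda>y\<in>Prim \<kappa> H. x \<oplus>\<^bsub>H\<^esub> y),
     smult = (\<lambda>r\<in>carrier \<kappa>. \<lambda>x\<in>Prim \<kappa> H. r \<odot>\<^bsub>H\<^esub> x),
     bracket = (\<lambda>x\<in>Prim \<kappa> H. \<lambda>y\<in>Prim \<kappa> H. x \<otimes>\<^bsub>H\<^esub> y \<ominus>\<^bsub>H\<^esub> y \<otimes>\<^bsub>H\<^esub> x)\<rparr>"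

definition gl_grp :: "'k ring \<Rightarrow> ('k, 'a) hopf \<Rightarrow> 'a monoid" where
  "gl_grp \<kappa> H = \<lparr>
     carrier = Gl \<kappa> H,
     mult = (\<lambda>x\<in>Gl \<kappa> H. \<lambda>y\<in>Gl \<kappa> H. x \<otimes>\<^bsub>H\<^esub> y),
     one = \<one>\<^bsub>H\<^esub>\<rparr>"

definition Prim_X :: "'k ring \<Rightarrow>
    (('k, 'e, 'g) xhopf, ('e, 'g) mor2, ('k, 'e, 'g) xlie, ('e, 'g) mor2) funct" where
  "Prim_X \<kappa> = \<lparr>
     fobj = (\<lambda>X. let P = Prim \<kappa> (xtop X); Q = Prim \<kappa> (xbase X) in \<lparr>
       xtop = prim_lie \<kappa> (xtop X),
       xbase = prim_lie \<kappa> (xbase X),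
       xbd = (\<lambda>x\<in>P. xbd X x),
       xact = (\<lambda>a\<in>Q. \<lambda>x\<in>P. xact X a x)\<rparr>),
     farr = (\<lambda>X Y (f2, f1). (restrict f2 (Prim \<kappa> (xtop X)), restrict f1 (Prim \<kappa> (xbase X))))\<rparr>"

definition Gl_X :: "'k ring \<Rightarrow>
    (('k, 'e, 'g) xhopf, ('e, 'g) mor2, ('e, 'g) xgrp, ('e, 'g) mor2) funct" where
  "Gl_X \<kappa> = \<lparr>
     fobj = (\<lambda>X. let P = Gl \<kappa> (xtop X); Q = Gl \<kappa> (xbase X) in \<lparr>
       xtop = gl_grp \<kappa> (xtop X),
       xbase = gl_grp \<kappa> (xbase X),
       xbd = (\<lambda>x\<in>P. xbd X x),
       xact = (\<lambda>a\<in>Q. \<lambda>x\<in>P. xact X a x)\<rparr>),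
     farr = (\<lambda>X Y (f2, f1). (restrict f2 (Gl \<kappa> (xtop X)), restrict f1 (Gl \<kappa> (xbase X))))\<rparr>"

definition Prim_X2 :: "'k ring \<Rightarrow>
    (('k, 'l, 'e, 'g) x2hopf, ('l, 'e, 'g) mor3, ('k, 'l, 'e, 'g) x2lie, ('l, 'e, 'g) mor3) funct"
  where
  "Prim_X2 \<kappa> = \<lparr>
     fobj = (\<lambda>X. let P3 = Prim \<kappa> (top2 X); P2 = Prim \<kappa> (mid2 X); P1 = Prim \<kappa> (base2 X) in \<lparr>
       top2 = prim_lie \<kappa> (top2 X),
       mid2 = prim_lie \<kappa> (mid2 X),
       base2 = prim_lie \<kappa> (base2 X),
       bd2 = (\<lambda>k\<in>P3. bd2 X k),
       bd1 = (\<lambda>x\<in>P2. bd1 X x),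
       act_mid = (\<lambda>a\<in>P1. \<lambda>x\<in>P2. act_mid X a x),
       act_top = (\<lambda>a\<in>P1. \<lambda>k\<in>P3. act_top X a k),
       plift = (\<lambda>x\<in>P2. \<lambda>y\<in>P2. plift X x y)\<rparr>),
     farr = (\<lambda>X Y (f3, f2, f1). (restrict f3 (Prim \<kappa> (top2 X)),
       restrict f2 (Prim \<kappa> (mid2 X)), restrict f1 (Prim \<kappa> (base2 X))))\<rparr>"

definition Gl_X2 :: "'k ring \<Rightarrow>
    (('k, 'l, 'e, 'g) x2hopf, ('l, 'e, 'g) mor3, ('l, 'e, 'g) x2grp, ('l, 'e, 'g) mor3) funct"
  where
  "Gl_X2 \<kappa> = \<lparr>
     fobj = (\<lambda>X. let P3 = Gl \<kappa> (top2 X); P2 = Gl \<kappa> (mid2 X); P1 = Gl \<kappa> (base2 X) in \<lparr>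
       top2 = gl_grp \<kappa> (top2 X),
       mid2 = gl_grp \<kappa> (mid2 X),
       base2 = gl_grp \<kappa> (base2 X),
       bd2 = (\<lambda>k\<in>P3. bd2 X k),
       bd1 = (\<lambda>x\<in>P2. bd1 X x),
       act_mid = (\<lambda>a\<in>P1. \<lambda>x\<in>P2. act_mid X a x),
       act_top = (\<lambda>a\<in>P1. \<lambda>k\<in>P3. act_top X a k),
       plift = (\<lambda>x\<in>P2. \<lambda>y\<in>P2. plift X x y)\<rparr>),
     farr = (\<lambda>X Y (f3, f2, f1). (restrict f3 (Gl \<kappa> (top2 X)),
       restrict f2 (Gl \<kappa> (mid2 X)), restrict f1 (Gl \<kappa> (base2 X))))\<rparr>"


section \<open>Crossed modules as 2-crossed modules\<close>

text \<open>The zero Lie algebra and the trivial group are realized on a singleton \<open>{z}\<close>. For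
  \<open>z = 0\<close> resp. \<open>z = 1\<close> in \<open>\<kappa>\<close> they are \<open>Prim(\<kappa>)\<close> resp. \<open>Gl(\<kappa>)\<close>.\<close>

definition lie_zero :: "'k ring \<Rightarrow> 'l \<Rightarrow> ('k, 'l) lie" where
  "lie_zero \<kappa> z = \<lparr>
     carrier = {z},
     mult = undefined,
     one = undefined,
     zero = z,
     add = (\<lambda>x\<in>{z}. \<lambda>y\<in>{z}. z),
     smult = (\<lambda>r\<in>carrier \<kappa>. \<lambda>x\<in>{z}. z),
     bracket = (\<lambda>x\<in>{z}. \<lambda>y\<in>{z}. z)\<rparr>"

definition grp_trivial :: "'l \<Rightarrow> 'l monoid" where
  "grp_trivial z = \<lparr>carrier = {z}, mult = (\<lambda>x\<in>{z}. \<lambda>y\<in>{z}. z), one = z\<rparr>"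

definition Incl_Hopf :: "'k ring \<Rightarrow>
    (('k, 'e, 'g) xhopf, ('e, 'g) mor2, ('k, 'k, 'e, 'g) x2hopf, ('k, 'e, 'g) mor3) funct" where
  "Incl_Hopf \<kappa> = \<lparr>
     fobj = (\<lambda>X. \<lparr>
       top2 = hopf_zero \<kappa>,
       mid2 = xtop X,
       base2 = xbase X,
       bd2 = (\<lambda>r. r \<odot>\<^bsub>xtop X\<^esub> \<one>\<^bsub>xtop X\<^esub>),
       bd1 = xbd X,
       act_mid = xact X,
       act_top = (\<lambda>a r. counit (xbase X) a \<otimes>\<^bsub>\<kappa>\<^esub> r),
       plift = (\<lambda>x y. counit (xtop X) x \<otimes>\<^bsub>\<kappa>\<^esub> counit (xtop X) y)\<rparr>),
     farr = (\<lambda>X Y (f2, f1). (\<lambda>r\<in>carrier \<kappa>. r, f2, f1))\<rparr>"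

definition Incl_Lie :: "'k ring \<Rightarrow> 'l \<Rightarrow>
    (('k, 'e, 'g) xlie, ('e, 'g) mor2, ('k, 'l, 'e, 'g) x2lie, ('l, 'e, 'g) mor3) funct" where
  "Incl_Lie \<kappa> z = \<lparr>
     fobj = (\<lambda>X. \<lparr>
       top2 = lie_zero \<kappa> z,
       mid2 = xtop X,
       base2 = xbase X,
       bd2 = (\<lambda>l\<in>{z}. \<zero>\<^bsub>xtop X\<^esub>),
       bd1 = xbd X,
       act_mid = xact X,
       act_top = (\<lambda>a\<in>carrier (xbase X). \<lambda>l\<in>{z}. z),
       plift = (\<lambda>x\<in>carrier (xtop X). \<lambda>y\<in>carrier (xtop X). z)\<rparr>),
     farr = (\<lambda>X Y (f2, f1). (\<lambda>l\<in>{z}. z, f2, f1))\<rparr>"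

definition Incl_Grp :: "'l \<Rightarrow>
    (('e, 'g) xgrp, ('e, 'g) mor2, ('l, 'e, 'g) x2grp, ('l, 'e, 'g) mor3) funct" where
  "Incl_Grp z = \<lparr>
     fobj = (\<lambda>X. \<lparr>
       top2 = grp_trivial z,
       mid2 = xtop X,
       base2 = xbase X,
       bd2 = (\<lambda>l\<in>{z}. \<one>\<^bsub>xtop X\<^esub>),
       bd1 = xbd X,
       act_mid = xact X,
       act_top = (\<lambda>a\<in>carrier (xbase X). \<lambda>l\<in>{z}. z),
       plift = (\<lambda>x\<in>carrier (xtop X). \<lambda>y\<in>carrier (xtop X). z)\<rparr>),
     farr = (\<lambda>X Y (f2, f1). (\<lambda>l\<in>{z}. z, f2, f1))\<rparr>"

end

theory Submission
  imports Defs
begin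

text \<open>A Sweedler sum \<open>\<Sum> f x' x''\<close> with bilinear \<open>f\<close> has a single term \<open>f x x\<close> if \<open>x\<close> is group-like,
  and the two terms \<open>f x 1 + f 1 x\<close> if \<open>x\<close> is primitive (\<open>sweedler_Gl\<close>, \<open>sweedler_Prim\<close>).
  Together with \<open>S(x) = x\<^sup>-\<^sup>1\<close> resp. \<open>S(x) = -x\<close>, this turns the Hopf algebra axioms into those of groups
  resp. Lie algebras: the adjoint action becomes conjugation resp. the commutator, a module bialgebra
  becomes a group with automorphisms resp. a Lie algebra with derivations, and the Peiffer identities
  follow term by term (\<open>grp_x2mod_Gl\<close>, \<open>lie_x2mod_Prim\<close>). The lifting and the actions preserve
  group-like and primitive elements because they are compatible with the coproducts.

  In the primitive case the sums for iterated coproducts also contain terms with \<open>{x,1}\<close>, \<open>{1,x}\<close> and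
  \<open>{1,1}\<close>, whose values follow from the expansions of \<open>{x,1\<cdot>1}\<close> and \<open>{1\<cdot>1,x}\<close>:
  \<open>{1,1}\<close> is an idempotent group-like element, hence \<open>1\<close>, after which \<open>{x,1}\<close> and \<open>{1,x}\<close> equal
  their own doubles and vanish (\<open>lift_one_one\<close>, \<open>lift_one_right\<close>, \<open>lift_one_left\<close>).

  Functoriality is a formal matter of restricting tuples of maps to smaller carriers; the locales
  \<open>structured_homs\<close> and \<open>restriction\<close> treat it once for all three settings. A crossed module of Hopf
  algebras becomes a 2-crossed module with lifting \<open>{x,y} = \<epsilon>(x)\<epsilon>(y)\<close> (\<open>hopf_x2mod_incl\<close>). As \<open>\<kappa>\<close>
  has \<open>0\<close> as its only primitive and \<open>1\<close> as its only group-like element, the two squares of functors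
  commute on the nose.\<close>

section \<open>Linear and bilinear maps\<close>

text \<open>Makes the method \<open>algebra\<close> decide equations in abelian groups that are not rings, such as \<open>H \<otimes> H\<close>.\<close>

lemmas (in abelian_group) abelian_group_simprules
  [algebra abelian_group "zero G" "add G" "a_inv G" "a_minus G"] =
  a_closed zero_closed a_inv_closed minus_closed
  a_assoc l_zero l_neg a_comm minus_eq r_zero r_neg r_neg2 r_neg1 minus_add minus_minus minus_zero a_lcomm

lemma linear_mapI:
  assumes "\<And>x. x \<in> carrier A \<Longrightarrow> f x \<in> carrier B"
    and "\<And>x y. \<lbrakk>x \<in> carrier A; y \<in> carrier A\<rbrakk> \<Longrightarrow> f (x \<oplus>\<^bsub>A\<^esub> y) = f x \<oplus>\<^bsub>B\<^esub> f y"
    and "\<And>r x. \<lbrakk>r \<in> carrier \<kappa>; x \<in> carrier A\<rbrakk> \<Longrightarrow> f (r \<odot>\<^bsub>A\<^esub> x) = r \<odot>\<^bsub>B\<^esub> f x"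
  shows "linear_map \<kappa> A B f"
  using assms by (auto simp: linear_map_def)

lemma linear_mapD:
  assumes "linear_map \<kappa> A B f"
  shows "x \<in> carrier A \<Longrightarrow> f x \<in> carrier B"
    and "\<lbrakk>x \<in> carrier A; y \<in> carrier A\<rbrakk> \<Longrightarrow> f (x \<oplus>\<^bsub>A\<^esub> y) = f x \<oplus>\<^bsub>B\<^esub> f y"
    and "\<lbrakk>r \<in> carrier \<kappa>; x \<in> carrier A\<rbrakk> \<Longrightarrow> f (r \<odot>\<^bsub>A\<^esub> x) = r \<odot>\<^bsub>B\<^esub> f x"
  using assms by (auto simp: linear_map_def)

lemma bilinear_mapI:
  assumes "\<And>x. x \<in> carrier A \<Longrightarrow> linear_map \<kappa> B C (\<lambda>y. f x y)"
    and "\<And>y. y \<in> carrier B \<Longrightarrow> linear_map \<kappa> A C (\<lambda>x. f x y)"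
  shows "bilinear_map \<kappa> A B C f"
  using assms by (auto simp: bilinear_map_def)

lemma bilinear_mapD:
  assumes "bilinear_map \<kappa> A B C f"
  shows "x \<in> carrier A \<Longrightarrow> linear_map \<kappa> B C (f x)"
    and "y \<in> carrier B \<Longrightarrow> linear_map \<kappa> A C (\<lambda>x. f x y)"
  using assms by (auto simp: bilinear_map_def)

lemma bilinear_map_simps:
  assumes "bilinear_map \<kappa> A B C f"
  shows "\<lbrakk>x \<in> carrier A; y \<in> carrier B\<rbrakk> \<Longrightarrow> f x y \<in> carrier C"
    and "\<lbrakk>x \<in> carrier A; x' \<in> carrier A; y \<in> carrier B\<rbrakk> \<Longrightarrow> f (x \<oplus>\<^bsub>A\<^esub> x') y = f x y \<oplus>\<^bsub>C\<^esub> f x' y"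
    and "\<lbrakk>x \<in> carrier A; y \<in> carrier B; y' \<in> carrier B\<rbrakk> \<Longrightarrow> f x (y \<oplus>\<^bsub>B\<^esub> y') = f x y \<oplus>\<^bsub>C\<^esub> f x y'"
    and "\<lbrakk>r \<in> carrier \<kappa>; x \<in> carrier A; y \<in> carrier B\<rbrakk> \<Longrightarrow> f (r \<odot>\<^bsub>A\<^esub> x) y = r \<odot>\<^bsub>C\<^esub> f x y"
    and "\<lbrakk>r \<in> carrier \<kappa>; x \<in> carrier A; y \<in> carrier B\<rbrakk> \<Longrightarrow> f x (r \<odot>\<^bsub>B\<^esub> y) = r \<odot>\<^bsub>C\<^esub> f x y"
  by (simp_all add: linear_mapD[OF bilinear_mapD(1)[OF assms]] linear_mapD[OF bilinear_mapD(2)[OF assms]])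

lemma linear_map_cong:
  assumes "module \<kappa> A" and "\<And>x. x \<in> carrier A \<Longrightarrow> f x = g x"
  shows "linear_map \<kappa> A B f \<longleftrightarrow> linear_map \<kappa> A B g"
proof -
  interpret A: module \<kappa> A by fact
  show ?thesis using assms(2) by (auto simp: linear_map_def Pi_iff)
qed

lemma bilinear_map_cong:
  assumes "module \<kappa> A" "module \<kappa> B"
    and "\<And>x y. \<lbrakk>x \<in> carrier A; y \<in> carrier B\<rbrakk> \<Longrightarrow> f x y = g x y"
  shows "bilinear_map \<kappa> A B C f \<longleftrightarrow> bilinear_map \<kappa> A B C g"
proof -
  have "linear_map \<kappa> B C (f x) = linear_map \<kappa> B C (g x)" if "x \<in> carrier A" for x
    using that assms(3) by (intro linear_map_cong[OF assms(2)])
  moreover have "linear_map \<kappa> A C (\<lambda>x. f x y) = linear_map \<kappa> A C (\<lambda>x. g x y)"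
    if "y \<in> carrier B" for y
    using that assms(3) by (intro linear_map_cong[OF assms(1)])
  ultimately show ?thesis by (simp add: bilinear_map_def)
qed

lemma linear_map_comp:
  "\<lbrakk>linear_map \<kappa> B C g; linear_map \<kappa> A B f\<rbrakk> \<Longrightarrow> linear_map \<kappa> A C (\<lambda>x. g (f x))"
  by (auto simp: linear_map_def Pi_iff)

lemma linear_map_id: "linear_map \<kappa> A A (\<lambda>x. x)"
  by (auto simp: linear_map_def)

lemma linear_map_add:
  assumes "module \<kappa> B" "linear_map \<kappa> A B f" "linear_map \<kappa> A B g"
  shows "linear_map \<kappa> A B (\<lambda>x. f x \<oplus>\<^bsub>B\<^esub> g x)"
proof -
  interpret B: module \<kappa> B by fact
  show ?thesis
    by (rule linear_mapI) (simp_all add: linear_mapD[OF assms(2)] linear_mapD[OF assms(3)] B.M.a_ac B.smult_r_distr)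
qed

lemma linear_map_smult:
  assumes "module \<kappa> B" "linear_map \<kappa> A B f" "s \<in> carrier \<kappa>"
  shows "linear_map \<kappa> A B (\<lambda>x. s \<odot>\<^bsub>B\<^esub> f x)"
proof -
  interpret B: module \<kappa> B by fact
  show ?thesis using assms(3)
    by (intro linear_mapI)
      (simp_all add: linear_mapD[OF assms(2)] B.smult_r_distr B.smult_assoc1[symmetric] B.R.m_comm)
qed

lemma linear_map_zero:
  assumes "module \<kappa> A" "module \<kappa> B" "linear_map \<kappa> A B f"
  shows "f \<zero>\<^bsub>A\<^esub> = \<zero>\<^bsub>B\<^esub>"
proof -
  interpret A: module \<kappa> A by fact
  interpret B: module \<kappa> B by fact
  have "f \<zero>\<^bsub>A\<^esub> = f (\<zero>\<^bsub>\<kappa>\<^esub> \<odot>\<^bsub>A\<^esub> \<zero>\<^bsub>A\<^esub>)" by simp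
  also have "\<dots> = \<zero>\<^bsub>B\<^esub>"
    by (subst linear_mapD(3)[OF assms(3)]) (simp_all add: linear_mapD(1)[OF assms(3)])
  finally show ?thesis .
qed

lemma linear_map_neg:
  assumes "module \<kappa> A" "module \<kappa> B" "linear_map \<kappa> A B f" "x \<in> carrier A"
  shows "f (\<ominus>\<^bsub>A\<^esub> x) = \<ominus>\<^bsub>B\<^esub> f x"
proof -
  interpret A: module \<kappa> A by fact
  interpret B: module \<kappa> B by fact
  have "f x \<oplus>\<^bsub>B\<^esub> f (\<ominus>\<^bsub>A\<^esub> x) = f (x \<oplus>\<^bsub>A\<^esub> \<ominus>\<^bsub>A\<^esub> x)"
    using assms by (simp add: linear_mapD(2)[OF assms(3)])
  also have "\<dots> = \<zero>\<^bsub>B\<^esub>" using assms by (simp add: A.M.r_neg linear_map_zero)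
  finally show ?thesis
    using assms(4) B.M.add.inv_equality B.M.a_comm linear_mapD(1)[OF assms(3)] A.M.a_inv_closed by metis
qed

lemma linear_map_minus:
  assumes "module \<kappa> A" "module \<kappa> B" "linear_map \<kappa> A B f" "x \<in> carrier A" "y \<in> carrier A"
  shows "f (x \<ominus>\<^bsub>A\<^esub> y) = f x \<ominus>\<^bsub>B\<^esub> f y"
proof -
  interpret A: module \<kappa> A by fact
  interpret B: module \<kappa> B by fact
  show ?thesis using assms
    by (simp add: a_minus_def linear_mapD(2)[OF assms(3)] linear_map_neg[OF assms(1-3)])
qed

lemma module_minus_self: "\<lbrakk>module \<kappa> A; x \<in> carrier A\<rbrakk> \<Longrightarrow> x \<ominus>\<^bsub>A\<^esub> x = \<zero>\<^bsub>A\<^esub>"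
  by (simp add: a_minus_def abelian_group.r_neg module.axioms)

lemma module_minus_eq_zero:
  assumes "module \<kappa> A" "x \<in> carrier A" "y \<in> carrier A" "x \<ominus>\<^bsub>A\<^esub> y = \<zero>\<^bsub>A\<^esub>"
  shows "x = y"
proof -
  interpret A: module \<kappa> A by fact
  have "x = (x \<ominus>\<^bsub>A\<^esub> y) \<oplus>\<^bsub>A\<^esub> y"
    using assms(2,3) by (simp add: a_minus_def A.M.a_assoc A.M.l_neg)
  then show ?thesis using assms by simp
qed

lemma linear_map_uminus:
  assumes "module \<kappa> B" "linear_map \<kappa> A B f"
  shows "linear_map \<kappa> A B (\<lambda>x. \<ominus>\<^bsub>B\<^esub> f x)"
proof -
  interpret B: module \<kappa> B by fact
  show ?thesis
    by (rule linear_mapI) (simp_all add: linear_mapD[OF assms(2)] B.M.minus_add B.smult_r_minus)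
qed

lemma linear_map_diff:
  assumes "module \<kappa> B" "linear_map \<kappa> A B f" "linear_map \<kappa> A B g"
  shows "linear_map \<kappa> A B (\<lambda>x. f x \<ominus>\<^bsub>B\<^esub> g x)"
  unfolding a_minus_def by (intro linear_map_add linear_map_uminus assms)


lemma bilinear_map_zero:
  assumes "module \<kappa> A" "module \<kappa> B" "module \<kappa> C" "bilinear_map \<kappa> A B C f"
  shows "y \<in> carrier B \<Longrightarrow> f \<zero>\<^bsub>A\<^esub> y = \<zero>\<^bsub>C\<^esub>" "x \<in> carrier A \<Longrightarrow> f x \<zero>\<^bsub>B\<^esub> = \<zero>\<^bsub>C\<^esub>"
  using linear_map_zero[OF assms(1,3) bilinear_mapD(2)[OF assms(4)]]
    linear_map_zero[OF assms(2,3) bilinear_mapD(1)[OF assms(4)]] by simp_all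

lemma bilinear_map_minus:
  assumes "module \<kappa> A" "module \<kappa> B" "module \<kappa> C" "bilinear_map \<kappa> A B C f"
  shows "\<lbrakk>x \<in> carrier A; x' \<in> carrier A; y \<in> carrier B\<rbrakk> \<Longrightarrow> f (x \<ominus>\<^bsub>A\<^esub> x') y = f x y \<ominus>\<^bsub>C\<^esub> f x' y"
    and "\<lbrakk>x \<in> carrier A; y \<in> carrier B; y' \<in> carrier B\<rbrakk> \<Longrightarrow> f x (y \<ominus>\<^bsub>B\<^esub> y') = f x y \<ominus>\<^bsub>C\<^esub> f x y'"
  using linear_map_minus[OF assms(1,3) bilinear_mapD(2)[OF assms(4)]]
    linear_map_minus[OF assms(2,3) bilinear_mapD(1)[OF assms(4)]] by simp_all

lemma bilinear_map_neg:
  assumes "module \<kappa> A" "module \<kappa> B" "module \<kappa> C" "bilinear_map \<kappa> A B C f"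
  shows "\<lbrakk>x \<in> carrier A; y \<in> carrier B\<rbrakk> \<Longrightarrow> f (\<ominus>\<^bsub>A\<^esub> x) y = \<ominus>\<^bsub>C\<^esub> f x y"
    and "\<lbrakk>x \<in> carrier A; y \<in> carrier B\<rbrakk> \<Longrightarrow> f x (\<ominus>\<^bsub>B\<^esub> y) = \<ominus>\<^bsub>C\<^esub> f x y"
  using linear_map_neg[OF assms(1,3) bilinear_mapD(2)[OF assms(4)]]
    linear_map_neg[OF assms(2,3) bilinear_mapD(1)[OF assms(4)]] by simp_all


section \<open>Tensor products\<close>

subsection \<open>The free module on a set\<close>

lemma free_module_simps:
  "t \<in> carrier (free_module \<kappa> S) \<longleftrightarrow>
     range t \<subseteq> carrier \<kappa> \<and> {s. t s \<noteq> \<zero>\<^bsub>\<kappa>\<^esub>} \<subseteq> S \<and> finite {s. t s \<noteq> \<zero>\<^bsub>\<kappa>\<^esub>}"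
  "\<zero>\<^bsub>free_module \<kappa> S\<^esub> = (\<lambda>s. \<zero>\<^bsub>\<kappa>\<^esub>)"
  "t \<oplus>\<^bsub>free_module \<kappa> S\<^esub> u = (\<lambda>s. t s \<oplus>\<^bsub>\<kappa>\<^esub> u s)"
  "r \<odot>\<^bsub>free_module \<kappa> S\<^esub> t = (\<lambda>s. r \<otimes>\<^bsub>\<kappa>\<^esub> t s)"
  by (simp_all add: free_module_def)

lemma module_free_module:
  assumes "cring \<kappa>"
  shows "module \<kappa> (free_module \<kappa> S)"
proof -
  let ?F = "free_module \<kappa> S"
  interpret cring \<kappa> by fact
  have add: "(\<lambda>s. t s \<oplus>\<^bsub>\<kappa>\<^esub> u s) \<in> carrier (?F)"
    if "t \<in> carrier (?F)" "u \<in> carrier (?F)" for t u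
  proof -
    have "{s. t s \<oplus>\<^bsub>\<kappa>\<^esub> u s \<noteq> \<zero>\<^bsub>\<kappa>\<^esub>} \<subseteq> {s. t s \<noteq> \<zero>\<^bsub>\<kappa>\<^esub>} \<union> {s. u s \<noteq> \<zero>\<^bsub>\<kappa>\<^esub>}" by auto
    moreover from this have "finite {s. t s \<oplus>\<^bsub>\<kappa>\<^esub> u s \<noteq> \<zero>\<^bsub>\<kappa>\<^esub>}"
      using that by (auto simp: free_module_simps intro: finite_subset)
    moreover have "range (\<lambda>s. t s \<oplus>\<^bsub>\<kappa>\<^esub> u s) \<subseteq> carrier \<kappa>"
      using that by (auto simp: free_module_simps image_subset_iff)
    ultimately show ?thesis using that unfolding free_module_simps by blast
  qed
  have smult: "(\<lambda>s. r \<otimes>\<^bsub>\<kappa>\<^esub> t s) \<in> carrier (?F)"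
    if "t \<in> carrier (?F)" "r \<in> carrier \<kappa>" for r t
  proof -
    have "{s. r \<otimes>\<^bsub>\<kappa>\<^esub> t s \<noteq> \<zero>\<^bsub>\<kappa>\<^esub>} \<subseteq> {s. t s \<noteq> \<zero>\<^bsub>\<kappa>\<^esub>}" using that by auto
    moreover from this have "finite {s. r \<otimes>\<^bsub>\<kappa>\<^esub> t s \<noteq> \<zero>\<^bsub>\<kappa>\<^esub>}"
      using that by (auto simp: free_module_simps intro: finite_subset)
    moreover have "range (\<lambda>s. r \<otimes>\<^bsub>\<kappa>\<^esub> t s) \<subseteq> carrier \<kappa>"
      using that by (auto simp: free_module_simps image_subset_iff)
    ultimately show ?thesis using that unfolding free_module_simps by blast
  qed
  have inv: "\<exists>u\<in>carrier (?F). (\<lambda>s. u s \<oplus>\<^bsub>\<kappa>\<^esub> t s) = (\<lambda>s. \<zero>\<^bsub>\<kappa>\<^esub>)"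
    if "t \<in> carrier (?F)" for t
    using that smult[OF that, of "\<ominus>\<^bsub>\<kappa>\<^esub> \<one>\<^bsub>\<kappa>\<^esub>"]
    by (intro bexI[of _ "\<lambda>s. \<ominus>\<^bsub>\<kappa>\<^esub> \<one>\<^bsub>\<kappa>\<^esub> \<otimes>\<^bsub>\<kappa>\<^esub> t s"])
      (auto simp: free_module_simps image_subset_iff l_minus l_neg)
  have "abelian_group (?F)"
  proof (rule abelian_groupI)
    fix x assume "x \<in> carrier (?F)"
    from inv[OF this] show "\<exists>y\<in>carrier (?F). y \<oplus>\<^bsub>?F\<^esub> x = \<zero>\<^bsub>?F\<^esub>"
      by (simp add: free_module_simps(2-4))
  qed (use add in \<open>auto simp: free_module_simps(2-4) intro!: ext\<close>,
      auto simp: free_module_simps image_subset_iff a_ac)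
  then show ?thesis
    by (intro moduleI cring_axioms)
      (use smult in \<open>auto simp: free_module_simps(2-4) intro!: ext\<close>,
       auto simp: free_module_simps image_subset_iff l_distr r_distr m_assoc)
qed

lemma free_gen_closed:
  assumes "cring \<kappa>" "s \<in> S"
  shows "free_gen \<kappa> s \<in> carrier (free_module \<kappa> S)"
proof -
  interpret cring \<kappa> by fact
  have "{s'. free_gen \<kappa> s s' \<noteq> \<zero>\<^bsub>\<kappa>\<^esub>} \<subseteq> {s}" by (auto simp: free_gen_def)
  then show ?thesis using assms(2)
    by (auto simp: free_module_simps free_gen_def intro: finite_subset)
qed

lemma free_module_induct [consumes 2, case_names zero add]:
  assumes "cring \<kappa>" and t: "t \<in> carrier (free_module \<kappa> S)"
    and zero: "P \<zero>\<^bsub>free_module \<kappa> S\<^esub>"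
    and step: "\<And>r s u. \<lbrakk>r \<in> carrier \<kappa>; s \<in> S; u \<in> carrier (free_module \<kappa> S); P u\<rbrakk> \<Longrightarrow>
      P (r \<odot>\<^bsub>free_module \<kappa> S\<^esub> free_gen \<kappa> s \<oplus>\<^bsub>free_module \<kappa> S\<^esub> u)"
  shows "P t"
proof -
  let ?F = "free_module \<kappa> S"
  interpret cring \<kappa> by fact
  have "finite {s. t s \<noteq> \<zero>\<^bsub>\<kappa>\<^esub>}" using t by (simp add: free_module_simps)
  moreover have "P u" if "finite T" "u \<in> carrier (?F)" "{s. u s \<noteq> \<zero>\<^bsub>\<kappa>\<^esub>} \<subseteq> T" for T u
    using that
  proof (induction T arbitrary: u)
    case empty
    then have "u = \<zero>\<^bsub>?F\<^esub>" by (auto simp: free_module_simps)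
    then show ?case using zero by simp
  next
    case (insert s T)
    show ?case
    proof (cases "u s = \<zero>\<^bsub>\<kappa>\<^esub>")
      case True
      then show ?thesis using insert by auto
    next
      case False
      define v where "v = u(s := \<zero>\<^bsub>\<kappa>\<^esub>)"
      have sub: "{s'. v s' \<noteq> \<zero>\<^bsub>\<kappa>\<^esub>} \<subseteq> {s'. u s' \<noteq> \<zero>\<^bsub>\<kappa>\<^esub>}" by (auto simp: v_def)
      then have "v \<in> carrier (?F)"
        using insert.prems(1)
        by (auto simp: free_module_simps v_def image_subset_iff subset_iff intro: finite_subset)
      moreover have "{s'. v s' \<noteq> \<zero>\<^bsub>\<kappa>\<^esub>} \<subseteq> T" using insert.prems(2) by (auto simp: v_def)
      moreover have "s \<in> S" using False insert.prems(1) by (auto simp: free_module_simps)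
      moreover have "u s \<in> carrier \<kappa>" using insert.prems(1) by (auto simp: free_module_simps)
      ultimately have "P (u s \<odot>\<^bsub>?F\<^esub> free_gen \<kappa> s \<oplus>\<^bsub>?F\<^esub> v)"
        using insert.IH step by blast
      moreover have "u s \<odot>\<^bsub>?F\<^esub> free_gen \<kappa> s \<oplus>\<^bsub>?F\<^esub> v = u"
        using insert.prems(1)
        by (auto simp: free_module_simps free_gen_def v_def image_subset_iff)
      ultimately show ?thesis by simp
    qed
  qed
  ultimately show ?thesis using t by blast
qed

lemma free_module_linear_eq:
  assumes "module \<kappa> V" and f: "linear_map \<kappa> (free_module \<kappa> S) V f"
    and g: "linear_map \<kappa> (free_module \<kappa> S) V g"
    and eq: "\<And>s. s \<in> S \<Longrightarrow> f (free_gen \<kappa> s) = g (free_gen \<kappa> s)"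
    and t: "t \<in> carrier (free_module \<kappa> S)"
  shows "f t = g t"
proof -
  interpret V: module \<kappa> V by fact
  interpret F: module \<kappa> "free_module \<kappa> S" by (rule module_free_module) (rule V.R.cring_axioms)
  show ?thesis using V.R.cring_axioms t
  proof (induction rule: free_module_induct)
    case zero
    show ?case
      using linear_map_zero[OF F.module_axioms assms(1) f] linear_map_zero[OF F.module_axioms assms(1) g]
      by simp
  next
    case (add r s u)
    then show ?case
      by (simp add: linear_mapD[OF f] linear_mapD[OF g] eq free_gen_closed[OF V.R.cring_axioms])
  qed
qed

text \<open>The linear extension of a map on generators; \<open>tensor_lift\<close> is this sum at a representative of a coset.\<close>

definition free_eval ::
  "'k ring \<Rightarrow> ('k, 'c, 'z) module_scheme \<Rightarrow> ('s \<Rightarrow> 'c) \<Rightarrow> ('s \<Rightarrow> 'k) \<Rightarrow> 'c" where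
  "free_eval \<kappa> V f t = (\<Oplus>\<^bsub>V\<^esub>p\<in>{p. t p \<noteq> \<zero>\<^bsub>\<kappa>\<^esub>}. t p \<odot>\<^bsub>V\<^esub> f p)"

lemma free_eval_superset:
  assumes "module \<kappa> V" "f \<in> S \<rightarrow> carrier V" "t \<in> carrier (free_module \<kappa> S)"
    and "finite T" "{p. t p \<noteq> \<zero>\<^bsub>\<kappa>\<^esub>} \<subseteq> T" "T \<subseteq> S"
  shows "free_eval \<kappa> V f t = (\<Oplus>\<^bsub>V\<^esub>p\<in>T. t p \<odot>\<^bsub>V\<^esub> f p)"
proof -
  interpret V: module \<kappa> V by fact
  have "t p \<in> carrier \<kappa>" for p using assms(3) by (auto simp: free_module_simps)
  then show ?thesis unfolding free_eval_def using assms
    by (intro V.M.add.finprod_mono_neutral_cong_left) (auto simp: Pi_iff subset_iff)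
qed

lemma free_eval_linear:
  assumes "module \<kappa> V" "f \<in> S \<rightarrow> carrier V"
  shows "linear_map \<kappa> (free_module \<kappa> S) V (free_eval \<kappa> V f)"
proof -
  let ?F = "free_module \<kappa> S"
  interpret V: module \<kappa> V by fact
  interpret F: module \<kappa> ?F by (rule module_free_module) (rule V.R.cring_axioms)
  have supp: "finite {p. t p \<noteq> \<zero>\<^bsub>\<kappa>\<^esub>}" "{p. t p \<noteq> \<zero>\<^bsub>\<kappa>\<^esub>} \<subseteq> S" "t p \<in> carrier \<kappa>"
    if "t \<in> carrier (?F)" for t p
    using that by (auto simp: free_module_simps)
  show ?thesis
  proof (rule linear_mapI)
    fix t assume t: "t \<in> carrier (?F)"
    show "free_eval \<kappa> V f t \<in> carrier V"
      unfolding free_eval_def using supp[OF t] assms(2)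
      by (intro V.M.finsum_closed) (auto simp: Pi_iff)
  next
    fix t u assume t: "t \<in> carrier (?F)" and u: "u \<in> carrier (?F)"
    let ?T = "{p. t p \<noteq> \<zero>\<^bsub>\<kappa>\<^esub>} \<union> {p. u p \<noteq> \<zero>\<^bsub>\<kappa>\<^esub>}"
    note T = free_eval_superset[OF assms, of _ ?T]
    have fin: "finite ?T" and TS: "?T \<subseteq> S" using supp[OF t] supp[OF u] by auto
    have "free_eval \<kappa> V f (t \<oplus>\<^bsub>?F\<^esub> u)
        = (\<Oplus>\<^bsub>V\<^esub>p\<in>?T. (t p \<oplus>\<^bsub>\<kappa>\<^esub> u p) \<odot>\<^bsub>V\<^esub> f p)"
    proof -
      have "{p. (t \<oplus>\<^bsub>?F\<^esub> u) p \<noteq> \<zero>\<^bsub>\<kappa>\<^esub>} \<subseteq> ?T" by (auto simp: free_module_simps)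
      from T[OF F.M.a_closed[OF t u] fin this TS] show ?thesis by (simp add: free_module_simps)
    qed
    also have "\<dots> = (\<Oplus>\<^bsub>V\<^esub>p\<in>?T. t p \<odot>\<^bsub>V\<^esub> f p \<oplus>\<^bsub>V\<^esub> u p \<odot>\<^bsub>V\<^esub> f p)"
      using TS assms(2) supp(3)[OF t] supp(3)[OF u]
      by (intro V.M.finsum_cong') (auto simp: V.smult_l_distr Pi_iff subset_iff)
    also have "\<dots> = free_eval \<kappa> V f t \<oplus>\<^bsub>V\<^esub> free_eval \<kappa> V f u"
      using T[OF t fin _ TS] T[OF u fin _ TS] TS assms(2) supp(3)[OF t] supp(3)[OF u]
      by (subst V.M.finsum_addf) (auto simp: Pi_iff subset_iff)
    finally show "free_eval \<kappa> V f (t \<oplus>\<^bsub>?F\<^esub> u)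
        = free_eval \<kappa> V f t \<oplus>\<^bsub>V\<^esub> free_eval \<kappa> V f u" .
  next
    fix r t assume r: "r \<in> carrier \<kappa>" and t: "t \<in> carrier (?F)"
    let ?T = "{p. t p \<noteq> \<zero>\<^bsub>\<kappa>\<^esub>}"
    have "free_eval \<kappa> V f (r \<odot>\<^bsub>?F\<^esub> t) = (\<Oplus>\<^bsub>V\<^esub>p\<in>?T. (r \<otimes>\<^bsub>\<kappa>\<^esub> t p) \<odot>\<^bsub>V\<^esub> f p)"
    proof -
      have "{p. (r \<odot>\<^bsub>?F\<^esub> t) p \<noteq> \<zero>\<^bsub>\<kappa>\<^esub>} \<subseteq> ?T" using r by (auto simp: free_module_simps)
      from free_eval_superset[OF assms F.smult_closed[OF r t] supp(1)[OF t] this supp(2)[OF t]]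
      show ?thesis by (simp add: free_module_simps)
    qed
    also have "\<dots> = (\<Oplus>\<^bsub>V\<^esub>p\<in>?T. r \<odot>\<^bsub>V\<^esub> (t p \<odot>\<^bsub>V\<^esub> f p))"
      using supp(2,3)[OF t] assms(2) r
      by (intro V.M.finsum_cong') (auto simp: V.smult_assoc1 Pi_iff subset_iff)
    also have "\<dots> = r \<odot>\<^bsub>V\<^esub> free_eval \<kappa> V f t"
      unfolding free_eval_def using supp[OF t] assms(2) r
      by (intro V.finsum_smult_ldistr[symmetric]) (auto simp: Pi_iff subset_iff)
    finally show "free_eval \<kappa> V f (r \<odot>\<^bsub>?F\<^esub> t) = r \<odot>\<^bsub>V\<^esub> free_eval \<kappa> V f t" .
  qed
qed

lemma free_eval_gen:
  assumes "module \<kappa> V" "f \<in> S \<rightarrow> carrier V" "s \<in> S"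
  shows "free_eval \<kappa> V f (free_gen \<kappa> s) = f s"
proof -
  interpret V: module \<kappa> V by fact
  have "free_eval \<kappa> V f (free_gen \<kappa> s) = (\<Oplus>\<^bsub>V\<^esub>p\<in>{s}. free_gen \<kappa> s p \<odot>\<^bsub>V\<^esub> f p)"
    using assms by (intro free_eval_superset[OF assms(1,2)] free_gen_closed V.R.cring_axioms)
      (auto simp: free_gen_def)
  also have "\<dots> = f s" using assms(2,3) by (auto simp: Pi_iff free_gen_def)
  finally show ?thesis .
qed


subsection \<open>The quotient\<close>

lemma submodule_linear_kernel:
  assumes "module \<kappa> A" "module \<kappa> B" "linear_map \<kappa> A B f"
  shows "submodule {x \<in> carrier A. f x = \<zero>\<^bsub>B\<^esub>} \<kappa> A"
proof -
  interpret A: module \<kappa> A by fact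
  interpret B: module \<kappa> B by fact
  show ?thesis
    by (rule A.submoduleI)
      (auto simp: linear_mapD[OF assms(3)] linear_map_zero[OF assms] linear_map_neg[OF assms])
qed

context
  fixes \<kappa> :: "'k ring" and A :: "('k, 'a, 'x) module_scheme" and B :: "('k, 'b, 'y) module_scheme"
  assumes module_A: "module \<kappa> A" and module_B: "module \<kappa> B"
begin

interpretation A: module \<kappa> A by (rule module_A)
interpretation B: module \<kappa> B by (rule module_B)

private abbreviation (input) "F \<equiv> free_module \<kappa> (carrier A \<times> carrier B)"
private abbreviation (input) "N \<equiv> tensor_kernel \<kappa> A B"

interpretation F: module \<kappa> F by (rule module_free_module) (rule A.R.cring_axioms)

lemma pair_gen_closed:
  "\<lbrakk>x \<in> carrier A; y \<in> carrier B\<rbrakk> \<Longrightarrow> free_gen \<kappa> (x, y) \<in> carrier F"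
  by (simp add: free_gen_closed[OF A.R.cring_axioms])

lemma tensor_relations_closed: "tensor_relations \<kappa> A B \<subseteq> carrier F"
  unfolding tensor_relations_def Let_def
  by (auto intro!: F.M.minus_closed F.M.a_closed F.smult_closed pair_gen_closed)

lemma submodule_tensor_kernel: "submodule N \<kappa> F"
proof -
  let ?N = "\<Inter>{M. submodule M \<kappa> F \<and> tensor_relations \<kappa> A B \<subseteq> M}"
  have "submodule ?N \<kappa> F"
  proof (rule F.submoduleI)
    show "?N \<subseteq> carrier F"
      using F.carrier_is_submodule tensor_relations_closed by blast
    show "\<zero>\<^bsub>F\<^esub> \<in> ?N"
      using subgroup.one_closed[OF submodule.axioms(1)] by fastforce
  next
    fix a assume "a \<in> ?N"
    then show "\<ominus>\<^bsub>F\<^esub> a \<in> ?N"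
      by (auto intro: F.submoduleE(3))
  next
    fix a b assume "a \<in> ?N"
      and "b \<in> ?N"
    then show "a \<oplus>\<^bsub>F\<^esub> b \<in> ?N"
      by (auto intro: F.submoduleE(5))
  next
    fix r a assume "r \<in> carrier \<kappa>" and "a \<in> ?N"
    then show "r \<odot>\<^bsub>F\<^esub> a \<in> ?N"
      by (auto intro: F.submoduleE(4))
  qed
  then show ?thesis by (simp only: tensor_kernel_def)
qed

lemma tensor_relations_in_kernel: "tensor_relations \<kappa> A B \<subseteq> N"
  unfolding tensor_kernel_def by blast

lemma abelian_subgroup_tensor_kernel: "abelian_subgroup N F"
  by (intro abelian_subgroupI3 additive_subgroupI F.M.abelian_group_axioms
      submodule.axioms(1)[OF submodule_tensor_kernel])

interpretation N: abelian_subgroup N F by (rule abelian_subgroup_tensor_kernel)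

lemma coset_eq_iff:
  assumes "t \<in> carrier F" "u \<in> carrier F"
  shows "N +>\<^bsub>F\<^esub> t = N +>\<^bsub>F\<^esub> u \<longleftrightarrow> t \<ominus>\<^bsub>F\<^esub> u \<in> N"
proof -
  have "t \<in> N +>\<^bsub>F\<^esub> u \<longleftrightarrow> t \<ominus>\<^bsub>F\<^esub> u \<in> N"
    unfolding a_minus_def using assms by (intro N.a_rcos_module)
  then show ?thesis
    using N.a_rcos_self[OF assms(1)] N.a_repr_independence'[OF _ assms(2), of t] by metis
qed

lemma tensor_coset_simps:
  "carrier (tensor \<kappa> A B) = (\<lambda>t. N +>\<^bsub>F\<^esub> t) ` carrier F"
  "\<zero>\<^bsub>tensor \<kappa> A B\<^esub> = N +>\<^bsub>F\<^esub> \<zero>\<^bsub>F\<^esub>"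
  "\<lbrakk>t \<in> carrier F; u \<in> carrier F\<rbrakk> \<Longrightarrow>
     (N +>\<^bsub>F\<^esub> t) \<oplus>\<^bsub>tensor \<kappa> A B\<^esub> (N +>\<^bsub>F\<^esub> u) = N +>\<^bsub>F\<^esub> (t \<oplus>\<^bsub>F\<^esub> u)"
  "\<lbrakk>r \<in> carrier \<kappa>; t \<in> carrier F\<rbrakk> \<Longrightarrow>
     r \<odot>\<^bsub>tensor \<kappa> A B\<^esub> (N +>\<^bsub>F\<^esub> t) = N +>\<^bsub>F\<^esub> (r \<odot>\<^bsub>F\<^esub> t)"
proof -
  show "carrier (tensor \<kappa> A B) = (\<lambda>t. N +>\<^bsub>F\<^esub> t) ` carrier F"
    unfolding tensor_def Let_def A_RCOSETS_def' by (simp add: UNION_singleton_eq_range)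
  show "\<zero>\<^bsub>tensor \<kappa> A B\<^esub> = N +>\<^bsub>F\<^esub> \<zero>\<^bsub>F\<^esub>"
    unfolding tensor_def Let_def using F.M.a_coset_add_zero[OF N.a_subset] by simp
  show "(N +>\<^bsub>F\<^esub> t) \<oplus>\<^bsub>tensor \<kappa> A B\<^esub> (N +>\<^bsub>F\<^esub> u) = N +>\<^bsub>F\<^esub> (t \<oplus>\<^bsub>F\<^esub> u)"
    if "t \<in> carrier F" "u \<in> carrier F"
    unfolding tensor_def Let_def using N.a_rcos_sum[OF that] by simp
  show "r \<odot>\<^bsub>tensor \<kappa> A B\<^esub> (N +>\<^bsub>F\<^esub> t) = N +>\<^bsub>F\<^esub> (r \<odot>\<^bsub>F\<^esub> t)"
    if r: "r \<in> carrier \<kappa>" and t: "t \<in> carrier F"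
  proof -
    have "N +>\<^bsub>F\<^esub> (r \<odot>\<^bsub>F\<^esub> u) = N +>\<^bsub>F\<^esub> (r \<odot>\<^bsub>F\<^esub> t)" if "u \<in> N +>\<^bsub>F\<^esub> t" for u
    proof -
      have u: "u \<in> carrier F" using N.a_elemrcos_carrier[OF t that] .
      have "u \<ominus>\<^bsub>F\<^esub> t \<in> N" using N.a_rcos_module[OF t u] that by (simp add: a_minus_def)
      then have "r \<odot>\<^bsub>F\<^esub> (u \<ominus>\<^bsub>F\<^esub> t) \<in> N" using submodule.smult_closed[OF submodule_tensor_kernel r] by blast
      moreover have "r \<odot>\<^bsub>F\<^esub> (u \<ominus>\<^bsub>F\<^esub> t) = r \<odot>\<^bsub>F\<^esub> u \<ominus>\<^bsub>F\<^esub> r \<odot>\<^bsub>F\<^esub> t"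
        using r t u by (simp add: a_minus_def F.smult_r_distr F.smult_r_minus)
      ultimately show ?thesis using r t u by (simp add: coset_eq_iff)
    qed
    moreover have "t \<in> N +>\<^bsub>F\<^esub> t" by (rule N.a_rcos_self[OF t])
    ultimately have "(\<Union>u\<in>N +>\<^bsub>F\<^esub> t. N +>\<^bsub>F\<^esub> (r \<odot>\<^bsub>F\<^esub> u)) = N +>\<^bsub>F\<^esub> (r \<odot>\<^bsub>F\<^esub> t)"
      by blast
    then show ?thesis unfolding tensor_def Let_def by simp
  qed
qed

lemma module_tensor: "module \<kappa> (tensor \<kappa> A B)"
proof -
  have "abelian_group (tensor \<kappa> A B)"
  proof (rule abelian_groupI)
    fix T assume "T \<in> carrier (tensor \<kappa> A B)"
    then obtain t where t: "t \<in> carrier F" "T = N +>\<^bsub>F\<^esub> t" by (auto simp: tensor_coset_simps)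
    show "\<exists>U\<in>carrier (tensor \<kappa> A B). U \<oplus>\<^bsub>tensor \<kappa> A B\<^esub> T = \<zero>\<^bsub>tensor \<kappa> A B\<^esub>"
      using t by (intro bexI[of _ "N +>\<^bsub>F\<^esub> (\<ominus>\<^bsub>F\<^esub> t)"]) (auto simp: tensor_coset_simps F.M.l_neg)
  qed (auto simp: tensor_coset_simps F.M.a_ac)
  then show ?thesis
    by (intro moduleI A.R.cring_axioms)
      (auto simp: tensor_coset_simps F.smult_l_distr F.smult_r_distr F.smult_assoc1)
qed

lemma coset_linear: "linear_map \<kappa> F (tensor \<kappa> A B) (\<lambda>t. N +>\<^bsub>F\<^esub> t)"
  by (rule linear_mapI) (auto simp: tensor_coset_simps)

lemma tens_bilinear: "bilinear_map \<kappa> A B (tensor \<kappa> A B) (tens \<kappa> A B)"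
proof -
  note rel = subsetD[OF tensor_relations_in_kernel, unfolded tensor_relations_def Let_def]
  show ?thesis
    unfolding tens_def
  proof (intro bilinear_mapI linear_mapI, goal_cases)
    case (2 x y y')
    then show ?case
      by (subst tensor_coset_simps(3)) (auto simp: coset_eq_iff pair_gen_closed intro!: rel)
  next
    case (3 x r y)
    then show ?case
      by (subst tensor_coset_simps(4)) (auto simp: coset_eq_iff pair_gen_closed intro!: rel)
  next
    case (5 y x x')
    then show ?case
      by (subst tensor_coset_simps(3)) (auto simp: coset_eq_iff pair_gen_closed intro!: rel)
  next
    case (6 y r x)
    then show ?case
      by (subst tensor_coset_simps(4)) (auto simp: coset_eq_iff pair_gen_closed intro!: rel)
  qed (auto simp: tensor_coset_simps pair_gen_closed)
qed

text \<open>Linear maps out of \<open>A \<otimes> B\<close> are determined by pure tensors, since the cosets of the generators of the free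
  module are pure tensors. With \<open>tensor_lift_tens\<close> and \<open>tensor_lift_linear\<close> this is the universal property.\<close>

lemma tensor_linear_eq:
  assumes "module \<kappa> V" "linear_map \<kappa> (tensor \<kappa> A B) V f" "linear_map \<kappa> (tensor \<kappa> A B) V g"
    and "\<And>x y. \<lbrakk>x \<in> carrier A; y \<in> carrier B\<rbrakk> \<Longrightarrow> f (tens \<kappa> A B x y) = g (tens \<kappa> A B x y)"
    and "T \<in> carrier (tensor \<kappa> A B)"
  shows "f T = g T"
proof -
  obtain t where t: "t \<in> carrier F" "T = N +>\<^bsub>F\<^esub> t" using assms(5) by (auto simp: tensor_coset_simps)
  have "(\<lambda>t. f (N +>\<^bsub>F\<^esub> t)) t = (\<lambda>t. g (N +>\<^bsub>F\<^esub> t)) t"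
    using assms(4)
    by (intro free_module_linear_eq[OF assms(1) linear_map_comp[OF assms(2) coset_linear]
          linear_map_comp[OF assms(3) coset_linear] _ t(1)]) (auto simp: tens_def)
  then show ?thesis by (simp add: t)
qed

text \<open>A bilinear map sends each tensor relation to zero, so the kernel of its linear extension is a submodule
  containing the relations, hence contains the submodule that they span. This makes the value
  independent of the representative, in particular of the one that \<open>tensor_lift\<close> chooses.\<close>

lemma tensor_lift_coset:
  assumes V: "module \<kappa> V" and f: "bilinear_map \<kappa> A B V f" and t: "t \<in> carrier F"
  shows "tensor_lift \<kappa> V f (N +>\<^bsub>F\<^esub> t) = free_eval \<kappa> V (\<lambda>p. f (fst p) (snd p)) t"
proof -
  interpret V: module \<kappa> V by fact
  let ?f = "\<lambda>p. f (fst p) (snd p)"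
  have Pi: "?f \<in> carrier A \<times> carrier B \<rightarrow> carrier V" by (auto simp: bilinear_map_simps(1)[OF f])
  note lin = free_eval_linear[OF V Pi]
  note ker = submodule_linear_kernel[OF F.module_axioms V lin]
  have gen: "free_eval \<kappa> V ?f (free_gen \<kappa> (x, y)) = f x y" if "x \<in> carrier A" "y \<in> carrier B" for x y
    using free_eval_gen[OF V Pi] that by auto
  have "tensor_relations \<kappa> A B \<subseteq> {t \<in> carrier F. free_eval \<kappa> V ?f t = \<zero>\<^bsub>V\<^esub>}"
    using tensor_relations_closed
    unfolding tensor_relations_def Let_def
    by (auto simp: linear_map_minus[OF F.module_axioms V lin] linear_mapD(2-3)[OF lin] pair_gen_closed
        gen bilinear_map_simps[OF f] module_minus_self[OF V])
  then have N: "N \<subseteq> {t \<in> carrier F. free_eval \<kappa> V ?f t = \<zero>\<^bsub>V\<^esub>}"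
    using ker unfolding tensor_kernel_def by blast
  define u where "u = (SOME u. u \<in> N +>\<^bsub>F\<^esub> t)"
  have u: "u \<in> N +>\<^bsub>F\<^esub> t" unfolding u_def using N.a_rcos_self[OF t] by (rule someI[of "\<lambda>u. u \<in> _"])
  then have uc: "u \<in> carrier F" by (rule N.a_elemrcos_carrier[OF t])
  have "u \<ominus>\<^bsub>F\<^esub> t \<in> N" using u N.a_rcos_module[OF t uc] by (simp add: a_minus_def)
  then have "free_eval \<kappa> V ?f u \<ominus>\<^bsub>V\<^esub> free_eval \<kappa> V ?f t = \<zero>\<^bsub>V\<^esub>"
    using N by (auto simp: linear_map_minus[OF F.module_axioms V lin uc t])
  then have "free_eval \<kappa> V ?f u = free_eval \<kappa> V ?f t"
    by (rule module_minus_eq_zero[OF V linear_mapD(1)[OF lin uc] linear_mapD(1)[OF lin t]])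
  then show ?thesis unfolding tensor_lift_def Let_def u_def[symmetric] by (simp add: free_eval_def)
qed

lemma tensor_lift_linear:
  assumes V: "module \<kappa> V" and f: "bilinear_map \<kappa> A B V f"
  shows "linear_map \<kappa> (tensor \<kappa> A B) V (tensor_lift \<kappa> V f)"
proof -
  have "(\<lambda>p. f (fst p) (snd p)) \<in> carrier A \<times> carrier B \<rightarrow> carrier V"
    by (auto simp: bilinear_map_simps(1)[OF f])
  note lin = free_eval_linear[OF V this]
  show ?thesis
    by (rule linear_mapI)
      (auto simp: tensor_coset_simps tensor_lift_coset[OF assms] linear_mapD[OF lin]
        F.M.a_closed F.smult_closed)
qed

lemma tensor_lift_tens:
  assumes V: "module \<kappa> V" and f: "bilinear_map \<kappa> A B V f" and "x \<in> carrier A" "y \<in> carrier B"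
  shows "tensor_lift \<kappa> V f (tens \<kappa> A B x y) = f x y"
proof -
  have "(\<lambda>p. f (fst p) (snd p)) \<in> carrier A \<times> carrier B \<rightarrow> carrier V"
    by (auto simp: bilinear_map_simps(1)[OF f])
  from free_eval_gen[OF V this, of "(x, y)"] show ?thesis
    using assms by (simp add: tens_def tensor_lift_coset pair_gen_closed)
qed

lemma tensor_lift_eq:
  assumes V: "module \<kappa> V" and f: "bilinear_map \<kappa> A B V f"
    and g: "linear_map \<kappa> (tensor \<kappa> A B) V g"
    and eq: "\<And>x y. \<lbrakk>x \<in> carrier A; y \<in> carrier B\<rbrakk> \<Longrightarrow> g (tens \<kappa> A B x y) = f x y"
    and T: "T \<in> carrier (tensor \<kappa> A B)"
  shows "tensor_lift \<kappa> V f T = g T"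
  by (rule tensor_linear_eq[OF V tensor_lift_linear[OF V f] g _ T])
    (simp add: eq tensor_lift_tens[OF V f])

end


section \<open>Sweedler calculus\<close>

lemma tens_simps:
  assumes "module \<kappa> A" "module \<kappa> B"
  shows "\<lbrakk>x \<in> carrier A; y \<in> carrier B\<rbrakk> \<Longrightarrow> tens \<kappa> A B x y \<in> carrier (tensor \<kappa> A B)"
    and "\<lbrakk>linear_map \<kappa> C A f; y \<in> carrier B\<rbrakk> \<Longrightarrow> linear_map \<kappa> C (tensor \<kappa> A B) (\<lambda>c. tens \<kappa> A B (f c) y)"
    and "\<lbrakk>linear_map \<kappa> C B g; x \<in> carrier A\<rbrakk> \<Longrightarrow> linear_map \<kappa> C (tensor \<kappa> A B) (\<lambda>c. tens \<kappa> A B x (g c))"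
  using tens_bilinear[OF assms] bilinear_mapD[OF tens_bilinear[OF assms]]
  by (auto simp: bilinear_map_simps intro: linear_map_comp[of _ A _ "\<lambda>x. tens \<kappa> A B x y"]
      linear_map_comp[of _ B _ "\<lambda>y. tens \<kappa> A B x y"])

lemma bilinear_map_slice:
  assumes "bilinear_map \<kappa> A B V b"
  shows "\<lbrakk>linear_map \<kappa> C A f; y \<in> carrier B\<rbrakk> \<Longrightarrow> linear_map \<kappa> C V (\<lambda>c. b (f c) y)"
    and "\<lbrakk>linear_map \<kappa> C B g; x \<in> carrier A\<rbrakk> \<Longrightarrow> linear_map \<kappa> C V (\<lambda>c. b x (g c))"
  using linear_map_comp[OF bilinear_mapD(1)[OF assms]] linear_map_comp[OF bilinear_mapD(2)[OF assms]]
  by auto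

text \<open>Linearity of the lift in a parameter of the bilinear map. Both sides of each linearity equation are
  linear in \<open>T\<close>, so it suffices to compare them on pure tensors. For nested Sweedler sums this supplies
  the bilinearity of the outer summand.\<close>

lemma tensor_lift_param_linear:
  assumes A: "module \<kappa> A" and B: "module \<kappa> B" and V: "module \<kappa> V" and P: "module \<kappa> P"
    and T: "T \<in> carrier (tensor \<kappa> A B)"
    and lin: "\<And>x y. \<lbrakk>x \<in> carrier A; y \<in> carrier B\<rbrakk> \<Longrightarrow> linear_map \<kappa> P V (\<lambda>p. f p x y)"
    and bil: "\<And>p. p \<in> carrier P \<Longrightarrow> bilinear_map \<kappa> A B V (f p)"
  shows "linear_map \<kappa> P V (\<lambda>p. tensor_lift \<kappa> V (f p) T)"
proof -
  interpret P: module \<kappa> P by fact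
  have lift: "linear_map \<kappa> (tensor \<kappa> A B) V (tensor_lift \<kappa> V (f p))" if "p \<in> carrier P" for p
    using that by (intro tensor_lift_linear A B V bil)
  have tens: "tensor_lift \<kappa> V (f p) (tens \<kappa> A B x y) = f p x y"
    if "p \<in> carrier P" "x \<in> carrier A" "y \<in> carrier B" for p x y
    using that by (intro tensor_lift_tens A B V bil)
  show ?thesis
  proof (rule linear_mapI)
    fix p q assume pq: "p \<in> carrier P" "q \<in> carrier P"
    show "tensor_lift \<kappa> V (f (p \<oplus>\<^bsub>P\<^esub> q)) T = tensor_lift \<kappa> V (f p) T \<oplus>\<^bsub>V\<^esub> tensor_lift \<kappa> V (f q) T"
      using pq by (intro tensor_lift_eq[OF A B V _ _ _ T] bil V linear_map_add lift)
        (auto simp: tens linear_mapD[OF lin])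
  next
    fix r p assume rp: "r \<in> carrier \<kappa>" "p \<in> carrier P"
    show "tensor_lift \<kappa> V (f (r \<odot>\<^bsub>P\<^esub> p)) T = r \<odot>\<^bsub>V\<^esub> tensor_lift \<kappa> V (f p) T"
      using rp by (intro tensor_lift_eq[OF A B V _ _ _ T] bil V linear_map_smult lift)
        (auto simp: tens linear_mapD[OF lin])
  qed (use T linear_mapD(1)[OF lift] in simp)
qed

context cocomm_hopf_algebra
begin

lemma module_self [simp]: "module \<kappa> H" ..

lemma module_tensor_self [simp]: "module \<kappa> (tensor \<kappa> H H)"
  by (intro module_tensor module_self)

text \<open>Most rules for Sweedler sums presuppose that the summand is bilinear. The following linearity rules,
  for one varying argument at a time, let the simplifier discharge these conditions.\<close>

lemmas tens_self_simps [simp] = tens_simps[OF module_self module_self]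

lemma mult_linear [simp]:
  "\<lbrakk>linear_map \<kappa> A H f; c \<in> carrier H\<rbrakk> \<Longrightarrow> linear_map \<kappa> A H (\<lambda>x. f x \<otimes>\<^bsub>H\<^esub> c)"
  "\<lbrakk>linear_map \<kappa> A H f; c \<in> carrier H\<rbrakk> \<Longrightarrow> linear_map \<kappa> A H (\<lambda>x. c \<otimes>\<^bsub>H\<^esub> f x)"
  by (rule linear_mapI; simp add: linear_mapD l_distr r_distr smult_mult_left smult_mult_right)+

lemma antipode_closed [simp]: "x \<in> carrier H \<Longrightarrow> antipode H x \<in> carrier H"
  using antipode_linear by (rule linear_mapD)

lemma comult_closed [simp]: "x \<in> carrier H \<Longrightarrow> comult H x \<in> carrier (tensor \<kappa> H H)"
  using comult_linear by (rule linear_mapD)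

lemma counit_carrier [simp]: "x \<in> carrier H \<Longrightarrow> counit H x \<in> carrier \<kappa>"
  using counit_closed by blast

lemma antipode_comp_linear [simp]:
  "linear_map \<kappa> A H f \<Longrightarrow> linear_map \<kappa> A H (\<lambda>x. antipode H (f x))"
  by (rule linear_map_comp[OF antipode_linear])

lemma counit_comp_linear [simp]:
  "\<lbrakk>module \<kappa> V; linear_map \<kappa> A H f; v \<in> carrier V\<rbrakk> \<Longrightarrow> linear_map \<kappa> A V (\<lambda>x. counit H (f x) \<odot>\<^bsub>V\<^esub> v)"
  by (rule linear_mapI)
    (simp_all add: linear_mapD counit_add counit_smult module.smult_closed module.smult_l_distr module.smult_assoc1)

lemma counit_zero [simp]: "counit H \<zero>\<^bsub>H\<^esub> = \<zero>\<^bsub>\<kappa>\<^esub>"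
  using counit_smult[of "\<zero>\<^bsub>\<kappa>\<^esub>" "\<zero>\<^bsub>H\<^esub>"] by simp

lemma sweedler_linear:
  assumes "module \<kappa> V" "bilinear_map \<kappa> H H V f"
  shows "linear_map \<kappa> H V (\<lambda>x. sweedler \<kappa> H V x f)"
  unfolding sweedler_def
  by (rule linear_map_comp[OF tensor_lift_linear[OF module_self module_self assms] comult_linear])

lemma sweedler_comp_linear [simp]:
  assumes "module \<kappa> V" "linear_map \<kappa> A H g" "bilinear_map \<kappa> H H V f"
  shows "linear_map \<kappa> A V (\<lambda>a. sweedler \<kappa> H V (g a) f)"
  by (rule linear_map_comp[OF sweedler_linear[OF assms(1,3)] assms(2)])

lemma sweedler_closed [simp]:
  assumes "module \<kappa> V" "bilinear_map \<kappa> H H V f" "x \<in> carrier H"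
  shows "sweedler \<kappa> H V x f \<in> carrier V"
  using linear_mapD(1)[OF sweedler_linear[OF assms(1,2)] assms(3)] .

lemma sweedler_eqI:
  assumes "module \<kappa> V" "bilinear_map \<kappa> H H V f" "linear_map \<kappa> (tensor \<kappa> H H) V g" "x \<in> carrier H"
    and "\<And>x1 x2. \<lbrakk>x1 \<in> carrier H; x2 \<in> carrier H\<rbrakk> \<Longrightarrow> g (tens \<kappa> H H x1 x2) = f x1 x2"
  shows "sweedler \<kappa> H V x f = g (comult H x)"
  unfolding sweedler_def using assms by (intro tensor_lift_eq) auto

lemma sweedler_cong:
  assumes "module \<kappa> V" "bilinear_map \<kappa> H H V f" "x \<in> carrier H"
    and "\<And>x1 x2. \<lbrakk>x1 \<in> carrier H; x2 \<in> carrier H\<rbrakk> \<Longrightarrow> f x1 x2 = g x1 x2"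
  shows "sweedler \<kappa> H V x f = sweedler \<kappa> H V x g"
proof -
  have "bilinear_map \<kappa> H H V g"
    using assms(2) bilinear_map_cong[OF module_self module_self, of f g V] assms(4) by simp
  then show ?thesis
    using assms(4) tensor_lift_tens[OF module_self module_self assms(1), of g] assms
    unfolding sweedler_def[of _ _ _ _ g]
    by (intro sweedler_eqI tensor_lift_linear) auto
qed

lemma sweedler_tens: "x \<in> carrier H \<Longrightarrow> sweedler \<kappa> H (tensor \<kappa> H H) x (\<lambda>x1 x2. tens \<kappa> H H x1 x2) = comult H x"
  by (rule sweedler_eqI[of _ _ "\<lambda>T. T"]) (simp_all add: tens_bilinear linear_map_id)

lemma sweedler_apply:
  assumes "module \<kappa> V" "module \<kappa> W" "bilinear_map \<kappa> H H V f" "linear_map \<kappa> V W g" "x \<in> carrier H"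
  shows "g (sweedler \<kappa> H V x f) = sweedler \<kappa> H W x (\<lambda>x1 x2. g (f x1 x2))"
proof -
  have "bilinear_map \<kappa> H H W (\<lambda>x1 x2. g (f x1 x2))"
    using bilinear_mapD[OF assms(3)] by (intro bilinear_mapI) (auto intro: linear_map_comp[OF assms(4)])
  from sweedler_eqI[OF assms(2) this, of "\<lambda>T. g (tensor_lift \<kappa> V f T)" x] show ?thesis
    using assms tensor_lift_tens[OF module_self module_self assms(1,3)]
    by (simp add: sweedler_def linear_map_comp[OF assms(4)] tensor_lift_linear)
qed

lemma sweedler_param_linear [simp]:
  assumes V: "module \<kappa> V" and A: "module \<kappa> A" and x: "x \<in> carrier H"
    and lin: "\<And>x1 x2. \<lbrakk>x1 \<in> carrier H; x2 \<in> carrier H\<rbrakk> \<Longrightarrow> linear_map \<kappa> A V (\<lambda>a. f a x1 x2)"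
    and bil: "\<And>a. a \<in> carrier A \<Longrightarrow> bilinear_map \<kappa> H H V (f a)"
  shows "linear_map \<kappa> A V (\<lambda>a. sweedler \<kappa> H V x (f a))"
  unfolding sweedler_def
  by (rule tensor_lift_param_linear[OF module_self module_self V A comult_closed[OF x] lin bil])

lemma sweedler_counit_left:
  assumes "module \<kappa> V" "linear_map \<kappa> H V f" "x \<in> carrier H"
  shows "sweedler \<kappa> H V x (\<lambda>x1 x2. counit H x1 \<odot>\<^bsub>V\<^esub> f x2) = f x"
proof -
  have bil: "bilinear_map \<kappa> H H H (\<lambda>x1 x2. counit H x1 \<odot>\<^bsub>H\<^esub> x2)"
    by (rule bilinear_mapI) (simp_all add: linear_map_id linear_map_smult)
  have bil': "bilinear_map \<kappa> H H V (\<lambda>x1 x2. counit H x1 \<odot>\<^bsub>V\<^esub> f x2)"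
    using assms(1,2)
    by (intro bilinear_mapI) (simp_all add: linear_map_id linear_map_smult linear_mapD)
  have "f x = f (sweedler \<kappa> H H x (\<lambda>x1 x2. counit H x1 \<odot>\<^bsub>H\<^esub> x2))"
    using assms by (simp add: counit_left)
  also have "\<dots> = sweedler \<kappa> H V x (\<lambda>x1 x2. f (counit H x1 \<odot>\<^bsub>H\<^esub> x2))"
    by (rule sweedler_apply[OF module_self assms(1) bil assms(2,3)])
  also have "\<dots> = sweedler \<kappa> H V x (\<lambda>x1 x2. counit H x1 \<odot>\<^bsub>V\<^esub> f x2)"
    by (rule sweedler_cong[symmetric, OF assms(1) bil' assms(3)]) (simp add: linear_mapD[OF assms(2)])
  finally show ?thesis by simp
qed

lemma sweedler_one:
  assumes "module \<kappa> V" "bilinear_map \<kappa> H H V f"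
  shows "sweedler \<kappa> H V \<one>\<^bsub>H\<^esub> f = f \<one>\<^bsub>H\<^esub> \<one>\<^bsub>H\<^esub>"
  using assms by (simp add: sweedler_def comult_one tensor_lift_tens)

lemma antipode_one [simp]: "antipode H \<one>\<^bsub>H\<^esub> = \<one>\<^bsub>H\<^esub>"
proof -
  have "bilinear_map \<kappa> H H H (\<lambda>x1 x2. antipode H x1 \<otimes>\<^bsub>H\<^esub> x2)"
    by (rule bilinear_mapI) (simp_all add: linear_map_id)
  then show ?thesis using antipode_left[of "\<one>\<^bsub>H\<^esub>"] by (simp add: sweedler_one counit_one)
qed

end

text \<open>Both sides are lifts to \<open>H \<otimes> H\<close> and \<open>I \<otimes> I\<close> of a map that is linear in each of the four arguments, so
  the order of evaluation is immaterial, as for finite double sums.\<close>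

lemma sweedler_swap:
  assumes "cocomm_hopf_algebra \<kappa> H" "cocomm_hopf_algebra \<kappa> I" "module \<kappa> V"
    and x: "x \<in> carrier H" and y: "y \<in> carrier I"
    and f1: "\<And>x1 x2. \<lbrakk>x1 \<in> carrier H; x2 \<in> carrier H\<rbrakk> \<Longrightarrow> bilinear_map \<kappa> I I V (\<lambda>y1 y2. f x1 x2 y1 y2)"
    and f2: "\<And>y1 y2. \<lbrakk>y1 \<in> carrier I; y2 \<in> carrier I\<rbrakk> \<Longrightarrow> bilinear_map \<kappa> H H V (\<lambda>x1 x2. f x1 x2 y1 y2)"
  shows "sweedler \<kappa> H V x (\<lambda>x1 x2. sweedler \<kappa> I V y (\<lambda>y1 y2. f x1 x2 y1 y2))
    = sweedler \<kappa> I V y (\<lambda>y1 y2. sweedler \<kappa> H V x (\<lambda>x1 x2. f x1 x2 y1 y2))"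
proof -
  interpret H: cocomm_hopf_algebra \<kappa> H by fact
  interpret I: cocomm_hopf_algebra \<kappa> I by fact
  have lin1: "\<lbrakk>x1 \<in> carrier H; y1 \<in> carrier I; y2 \<in> carrier I\<rbrakk> \<Longrightarrow> linear_map \<kappa> H V (\<lambda>x2. f x1 x2 y1 y2)"
    "\<lbrakk>x2 \<in> carrier H; y1 \<in> carrier I; y2 \<in> carrier I\<rbrakk> \<Longrightarrow> linear_map \<kappa> H V (\<lambda>x1. f x1 x2 y1 y2)"
    for x1 x2 y1 y2 using bilinear_mapD[OF f2] by simp_all
  have lin2: "\<lbrakk>x1 \<in> carrier H; x2 \<in> carrier H; y1 \<in> carrier I\<rbrakk> \<Longrightarrow> linear_map \<kappa> I V (\<lambda>y2. f x1 x2 y1 y2)"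
    "\<lbrakk>x1 \<in> carrier H; x2 \<in> carrier H; y2 \<in> carrier I\<rbrakk> \<Longrightarrow> linear_map \<kappa> I V (\<lambda>y1. f x1 x2 y1 y2)"
    for x1 x2 y1 y2 using bilinear_mapD[OF f1] by simp_all
  have bil: "bilinear_map \<kappa> I I V (\<lambda>y1 y2. tensor_lift \<kappa> V (\<lambda>x1 x2. f x1 x2 y1 y2) T)"
    if "T \<in> carrier (tensor \<kappa> H H)" for T
    using that assms(3)
    by (intro bilinear_mapI tensor_lift_param_linear) (simp_all, simp_all add: lin1 lin2)
  have "sweedler \<kappa> H V x (\<lambda>x1 x2. sweedler \<kappa> I V y (\<lambda>y1 y2. f x1 x2 y1 y2))
    = (\<lambda>T. sweedler \<kappa> I V y (\<lambda>y1 y2. tensor_lift \<kappa> V (\<lambda>x1 x2. f x1 x2 y1 y2) T)) (comult H x)"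
  proof (rule H.sweedler_eqI[OF assms(3) _ _ x])
    show "bilinear_map \<kappa> H H V (\<lambda>x1 x2. sweedler \<kappa> I V y (\<lambda>y1 y2. f x1 x2 y1 y2))"
      using y assms(3) by (intro bilinear_mapI I.sweedler_param_linear) (simp_all, simp_all add: lin1 lin2)
    show "linear_map \<kappa> (tensor \<kappa> H H) V
        (\<lambda>T. sweedler \<kappa> I V y (\<lambda>y1 y2. tensor_lift \<kappa> V (\<lambda>x1 x2. f x1 x2 y1 y2) T))"
      using y assms(3) by (intro I.sweedler_param_linear bil tensor_lift_linear f2) simp_all
    fix x1 x2 assume "x1 \<in> carrier H" "x2 \<in> carrier H"
    then show "sweedler \<kappa> I V y (\<lambda>y1 y2. tensor_lift \<kappa> V (\<lambda>x1 x2. f x1 x2 y1 y2) (tens \<kappa> H H x1 x2))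
        = sweedler \<kappa> I V y (\<lambda>y1 y2. f x1 x2 y1 y2)"
      by (intro I.sweedler_cong assms(3) bil y)
        (simp_all add: tensor_lift_tens[OF H.module_self H.module_self assms(3) f2])
  qed
  then show ?thesis by (simp add: sweedler_def)
qed


section \<open>Group-like and primitive elements\<close>

lemma GlI: "\<lbrakk>x \<in> carrier H; comult H x = tens \<kappa> H H x x; counit H x = \<one>\<^bsub>\<kappa>\<^esub>\<rbrakk> \<Longrightarrow> x \<in> Gl \<kappa> H"
  by (simp add: Gl_def)

lemma PrimI: "\<lbrakk>x \<in> carrier H; comult H x
    = tens \<kappa> H H x \<one>\<^bsub>H\<^esub> \<oplus>\<^bsub>tensor \<kappa> H H\<^esub> tens \<kappa> H H \<one>\<^bsub>H\<^esub> x\<rbrakk> \<Longrightarrow> x \<in> Prim \<kappa> H"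
  by (simp add: Prim_def)

context cocomm_hopf_algebra
begin

lemma GlD [simp]:
  assumes "x \<in> Gl \<kappa> H"
  shows "x \<in> carrier H" "comult H x = tens \<kappa> H H x x" "counit H x = \<one>\<^bsub>\<kappa>\<^esub>"
  using assms by (simp_all add: Gl_def)

lemma PrimD [simp]:
  assumes "x \<in> Prim \<kappa> H"
  shows "x \<in> carrier H"
    and "comult H x = tens \<kappa> H H x \<one>\<^bsub>H\<^esub> \<oplus>\<^bsub>tensor \<kappa> H H\<^esub> tens \<kappa> H H \<one>\<^bsub>H\<^esub> x"
  using assms by (simp_all add: Prim_def)

lemma one_Gl [simp]: "\<one>\<^bsub>H\<^esub> \<in> Gl \<kappa> H"
  by (rule GlI) (simp_all add: comult_one counit_one)

lemma sweedler_Gl: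
  assumes "module \<kappa> V" "bilinear_map \<kappa> H H V f" "x \<in> Gl \<kappa> H"
  shows "sweedler \<kappa> H V x f = f x x"
  using assms by (simp add: sweedler_def tensor_lift_tens)

lemma mult_Gl [simp]: "\<lbrakk>x \<in> Gl \<kappa> H; y \<in> Gl \<kappa> H\<rbrakk> \<Longrightarrow> x \<otimes>\<^bsub>H\<^esub> y \<in> Gl \<kappa> H"
  by (rule GlI) (simp_all add: comult_mult counit_mult sweedler_Gl bilinear_mapI linear_map_id)

lemma antipode_inverse_Gl:
  assumes "x \<in> Gl \<kappa> H"
  shows "antipode H x \<otimes>\<^bsub>H\<^esub> x = \<one>\<^bsub>H\<^esub>" "x \<otimes>\<^bsub>H\<^esub> antipode H x = \<one>\<^bsub>H\<^esub>"
  using antipode_left[of x] antipode_right[of x] assms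
  by (simp_all add: sweedler_Gl bilinear_mapI linear_map_id)

text \<open>Let \<open>s = S(x)\<close>. Since \<open>\<delta>(x s) = \<delta>(1) = 1 \<otimes> 1\<close> and \<open>\<delta>(x s) = (x \<otimes> x) \<delta>(s)\<close>, multiplying by \<open>s \<otimes> s\<close>
  from the left gives \<open>\<delta>(s) = s \<otimes> s\<close>. This avoids the general fact that the antipode
  is a coalgebra map.\<close>

lemma antipode_Gl [simp]:
  assumes g: "x \<in> Gl \<kappa> H"
  shows "antipode H x \<in> Gl \<kappa> H"
proof -
  let ?s = "antipode H x"
  have x: "x \<in> carrier H" using g by simp
  have bil: "bilinear_map \<kappa> H H (tensor \<kappa> H H) (\<lambda>a b. tens \<kappa> H H (c \<otimes>\<^bsub>H\<^esub> a) (c \<otimes>\<^bsub>H\<^esub> b))"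
    if "c \<in> carrier H" for c
    using that by (simp add: bilinear_mapI linear_map_id)
  \<comment> \<open>left multiplication by \<open>s \<otimes> s\<close>\<close>
  let ?L = "tensor_lift \<kappa> (tensor \<kappa> H H) (\<lambda>a b. tens \<kappa> H H (?s \<otimes>\<^bsub>H\<^esub> a) (?s \<otimes>\<^bsub>H\<^esub> b))"
  have "comult H (x \<otimes>\<^bsub>H\<^esub> ?s) = sweedler \<kappa> H (tensor \<kappa> H H) ?s
      (\<lambda>y1 y2. tens \<kappa> H H (x \<otimes>\<^bsub>H\<^esub> y1) (x \<otimes>\<^bsub>H\<^esub> y2))"
    using g x by (simp add: comult_mult sweedler_Gl bilinear_mapI linear_map_id)
  then have "tens \<kappa> H H \<one>\<^bsub>H\<^esub> \<one>\<^bsub>H\<^esub> = sweedler \<kappa> H (tensor \<kappa> H H) ?s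
      (\<lambda>y1 y2. tens \<kappa> H H (x \<otimes>\<^bsub>H\<^esub> y1) (x \<otimes>\<^bsub>H\<^esub> y2))"
    by (simp add: antipode_inverse_Gl[OF g] comult_one)
  then have "?L (tens \<kappa> H H \<one>\<^bsub>H\<^esub> \<one>\<^bsub>H\<^esub>) = ?L (sweedler \<kappa> H (tensor \<kappa> H H) ?s
      (\<lambda>y1 y2. tens \<kappa> H H (x \<otimes>\<^bsub>H\<^esub> y1) (x \<otimes>\<^bsub>H\<^esub> y2)))"
    by simp
  also have "\<dots> = sweedler \<kappa> H (tensor \<kappa> H H) ?s
      (\<lambda>y1 y2. ?L (tens \<kappa> H H (x \<otimes>\<^bsub>H\<^esub> y1) (x \<otimes>\<^bsub>H\<^esub> y2)))"
    using x by (intro sweedler_apply bil tensor_lift_linear) simp_all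
  also have "\<dots> = sweedler \<kappa> H (tensor \<kappa> H H) ?s (\<lambda>y1 y2. tens \<kappa> H H y1 y2)"
  proof (rule sweedler_cong[symmetric])
    fix y1 y2 assume y: "y1 \<in> carrier H" "y2 \<in> carrier H"
    have "?s \<otimes>\<^bsub>H\<^esub> (x \<otimes>\<^bsub>H\<^esub> y) = y" if "y \<in> carrier H" for y
      using that x by (simp add: m_assoc[symmetric] antipode_inverse_Gl[OF g])
    then show "tens \<kappa> H H y1 y2 = ?L (tens \<kappa> H H (x \<otimes>\<^bsub>H\<^esub> y1) (x \<otimes>\<^bsub>H\<^esub> y2))"
      using x y by (simp add: tensor_lift_tens bil)
  qed (use x in \<open>simp_all add: tens_bilinear\<close>)
  also have "\<dots> = comult H ?s" using x by (simp add: sweedler_tens)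
  finally have "comult H ?s = tens \<kappa> H H ?s ?s"
    using x by (simp add: tensor_lift_tens bil)
  moreover have "counit H ?s = \<one>\<^bsub>\<kappa>\<^esub>"
    using counit_mult[OF x antipode_closed[OF x]] x
    by (simp add: antipode_inverse_Gl[OF g] counit_one g)
  ultimately show ?thesis using x by (intro GlI) simp_all
qed

lemma sweedler_Prim:
  assumes "module \<kappa> V" "bilinear_map \<kappa> H H V f" "x \<in> Prim \<kappa> H"
  shows "sweedler \<kappa> H V x f = f x \<one>\<^bsub>H\<^esub> \<oplus>\<^bsub>V\<^esub> f \<one>\<^bsub>H\<^esub> x"
  using assms by (simp add: sweedler_def linear_mapD[OF tensor_lift_linear] tensor_lift_tens)

text \<open>The counit axiom at a primitive \<open>x\<close> reads \<open>x = \<epsilon>(x) 1 + x\<close>; apply \<open>\<epsilon>\<close> to \<open>\<epsilon>(x) 1 = 0\<close>.\<close>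

lemma counit_Prim:
  assumes "x \<in> Prim \<kappa> H"
  shows "counit H x = \<zero>\<^bsub>\<kappa>\<^esub>"
proof -
  have x: "x \<in> carrier H" using assms by simp
  have "x = sweedler \<kappa> H H x (\<lambda>x1 x2. counit H x1 \<odot>\<^bsub>H\<^esub> x2)"
    using counit_left[OF x] by simp
  also have "\<dots> = counit H x \<odot>\<^bsub>H\<^esub> \<one>\<^bsub>H\<^esub> \<oplus>\<^bsub>H\<^esub> x"
    using assms x
    by (subst sweedler_Prim) (simp_all add: counit_one bilinear_mapI linear_map_id linear_map_smult)
  finally have "counit H x \<odot>\<^bsub>H\<^esub> \<one>\<^bsub>H\<^esub> = \<zero>\<^bsub>H\<^esub>" using x by simp
  then have "counit H (counit H x \<odot>\<^bsub>H\<^esub> \<one>\<^bsub>H\<^esub>) = \<zero>\<^bsub>\<kappa>\<^esub>" by simp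
  then show ?thesis using x by (simp add: counit_smult counit_one)
qed

lemma antipode_Prim:
  assumes "x \<in> Prim \<kappa> H"
  shows "antipode H x = \<ominus>\<^bsub>H\<^esub> x"
proof -
  have x: "x \<in> carrier H" using assms by simp
  have "antipode H x \<oplus>\<^bsub>H\<^esub> x = \<zero>\<^bsub>H\<^esub>"
    using antipode_left[OF x] assms x
    by (simp add: sweedler_Prim bilinear_mapI linear_map_id counit_Prim)
  then show ?thesis using x by (simp add: minus_equality)
qed

lemma submodule_Prim: "submodule (Prim \<kappa> H) \<kappa> H"
proof -
  have "Prim \<kappa> H = {x \<in> carrier H. comult H x \<ominus>\<^bsub>tensor \<kappa> H H\<^esub>
      (tens \<kappa> H H x \<one>\<^bsub>H\<^esub> \<oplus>\<^bsub>tensor \<kappa> H H\<^esub> tens \<kappa> H H \<one>\<^bsub>H\<^esub> x) = \<zero>\<^bsub>tensor \<kappa> H H\<^esub>}"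
    (is "_ = {x \<in> _. comult H x \<ominus>\<^bsub>_\<^esub> ?t x = _}")
  proof -
    interpret T: module \<kappa> "tensor \<kappa> H H" by simp
    have "comult H x = ?t x \<longleftrightarrow> comult H x \<ominus>\<^bsub>tensor \<kappa> H H\<^esub> ?t x = \<zero>\<^bsub>tensor \<kappa> H H\<^esub>"
      if "x \<in> carrier H" for x
      using that module_minus_self[OF module_tensor_self, of "?t x"]
        module_minus_eq_zero[OF module_tensor_self, of "comult H x" "?t x"] by auto
    then show ?thesis unfolding Prim_def by blast
  qed
  also have "submodule \<dots> \<kappa> H"
    by (intro submodule_linear_kernel linear_map_diff linear_map_add) (simp_all add: linear_map_id comult_linear)
  finally show ?thesis .
qed

lemma Prim_closed [simp]:
  shows "\<zero>\<^bsub>H\<^esub> \<in> Prim \<kappa> H"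
    and "\<lbrakk>x \<in> Prim \<kappa> H; y \<in> Prim \<kappa> H\<rbrakk> \<Longrightarrow> x \<oplus>\<^bsub>H\<^esub> y \<in> Prim \<kappa> H"
    and "\<lbrakk>r \<in> carrier \<kappa>; x \<in> Prim \<kappa> H\<rbrakk> \<Longrightarrow> r \<odot>\<^bsub>H\<^esub> x \<in> Prim \<kappa> H"
    and "x \<in> Prim \<kappa> H \<Longrightarrow> \<ominus>\<^bsub>H\<^esub> x \<in> Prim \<kappa> H"
    and "\<lbrakk>x \<in> Prim \<kappa> H; y \<in> Prim \<kappa> H\<rbrakk> \<Longrightarrow> x \<ominus>\<^bsub>H\<^esub> y \<in> Prim \<kappa> H"
  using submoduleE[OF submodule_Prim] subgroup.one_closed[OF submodule.axioms(1)[OF submodule_Prim]]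
  by (simp_all add: a_minus_def)

lemma comult_mult_Prim:
  assumes "x \<in> Prim \<kappa> H" "y \<in> Prim \<kappa> H"
  shows "comult H (x \<otimes>\<^bsub>H\<^esub> y) = (tens \<kappa> H H (x \<otimes>\<^bsub>H\<^esub> y) \<one>\<^bsub>H\<^esub> \<oplus>\<^bsub>tensor \<kappa> H H\<^esub> tens \<kappa> H H x y)
    \<oplus>\<^bsub>tensor \<kappa> H H\<^esub> (tens \<kappa> H H y x \<oplus>\<^bsub>tensor \<kappa> H H\<^esub> tens \<kappa> H H \<one>\<^bsub>H\<^esub> (x \<otimes>\<^bsub>H\<^esub> y))"
  using assms by (simp add: comult_mult sweedler_Prim bilinear_mapI linear_map_id)

text \<open>The mixed terms \<open>x \<otimes> y\<close> and \<open>y \<otimes> x\<close> occur in both \<open>\<delta>(x y)\<close> and \<open>\<delta>(y x)\<close>.\<close>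

lemma commutator_Prim [simp]:
  assumes "x \<in> Prim \<kappa> H" "y \<in> Prim \<kappa> H"
  shows "x \<otimes>\<^bsub>H\<^esub> y \<ominus>\<^bsub>H\<^esub> y \<otimes>\<^bsub>H\<^esub> x \<in> Prim \<kappa> H"
proof (rule PrimI)
  let ?t = "tens \<kappa> H H" and ?T = "tensor \<kappa> H H"
  interpret T: module \<kappa> ?T by simp
  have xy: "x \<in> carrier H" "y \<in> carrier H" using assms by simp_all
  then show "x \<otimes>\<^bsub>H\<^esub> y \<ominus>\<^bsub>H\<^esub> y \<otimes>\<^bsub>H\<^esub> x \<in> carrier H" by simp
  note minus = bilinear_map_minus[OF module_self module_self module_tensor_self tens_bilinear[OF module_self module_self]]
    linear_map_minus[OF module_self module_tensor_self comult_linear]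
  have cancel: "(a \<oplus>\<^bsub>?T\<^esub> b \<oplus>\<^bsub>?T\<^esub> (c \<oplus>\<^bsub>?T\<^esub> d)) \<ominus>\<^bsub>?T\<^esub> (a' \<oplus>\<^bsub>?T\<^esub> c \<oplus>\<^bsub>?T\<^esub> (b \<oplus>\<^bsub>?T\<^esub> d'))
      = (a \<ominus>\<^bsub>?T\<^esub> a') \<oplus>\<^bsub>?T\<^esub> (d \<ominus>\<^bsub>?T\<^esub> d')"
    if "a \<in> carrier ?T" "b \<in> carrier ?T" "c \<in> carrier ?T" "d \<in> carrier ?T" "a' \<in> carrier ?T" "d' \<in> carrier ?T"
    for a b c d a' d'
    using that by algebra
  have "comult H (x \<otimes>\<^bsub>H\<^esub> y \<ominus>\<^bsub>H\<^esub> y \<otimes>\<^bsub>H\<^esub> x)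
      = (?t (x \<otimes>\<^bsub>H\<^esub> y) \<one>\<^bsub>H\<^esub> \<oplus>\<^bsub>?T\<^esub> ?t x y \<oplus>\<^bsub>?T\<^esub> (?t y x \<oplus>\<^bsub>?T\<^esub> ?t \<one>\<^bsub>H\<^esub> (x \<otimes>\<^bsub>H\<^esub> y)))
       \<ominus>\<^bsub>?T\<^esub> (?t (y \<otimes>\<^bsub>H\<^esub> x) \<one>\<^bsub>H\<^esub> \<oplus>\<^bsub>?T\<^esub> ?t y x \<oplus>\<^bsub>?T\<^esub> (?t x y \<oplus>\<^bsub>?T\<^esub> ?t \<one>\<^bsub>H\<^esub> (y \<otimes>\<^bsub>H\<^esub> x)))"
    using xy by (simp only: minus comult_mult_Prim assms m_closed)
  also have "\<dots> = (?t (x \<otimes>\<^bsub>H\<^esub> y) \<one>\<^bsub>H\<^esub> \<ominus>\<^bsub>?T\<^esub> ?t (y \<otimes>\<^bsub>H\<^esub> x) \<one>\<^bsub>H\<^esub>)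
       \<oplus>\<^bsub>?T\<^esub> (?t \<one>\<^bsub>H\<^esub> (x \<otimes>\<^bsub>H\<^esub> y) \<ominus>\<^bsub>?T\<^esub> ?t \<one>\<^bsub>H\<^esub> (y \<otimes>\<^bsub>H\<^esub> x))"
    by (rule cancel) (simp_all add: xy)
  also have "\<dots> = ?t (x \<otimes>\<^bsub>H\<^esub> y \<ominus>\<^bsub>H\<^esub> y \<otimes>\<^bsub>H\<^esub> x) \<one>\<^bsub>H\<^esub> \<oplus>\<^bsub>?T\<^esub> ?t \<one>\<^bsub>H\<^esub> (x \<otimes>\<^bsub>H\<^esub> y \<ominus>\<^bsub>H\<^esub> y \<otimes>\<^bsub>H\<^esub> x)"
    using xy by (simp only: minus m_closed one_closed)
  finally show "comult H (x \<otimes>\<^bsub>H\<^esub> y \<ominus>\<^bsub>H\<^esub> y \<otimes>\<^bsub>H\<^esub> x) = \<dots>" .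
qed

end

text \<open>Compatibility of a Hopf algebra map with coproducts, transferred from the tensor product to arbitrary
  Sweedler sums.\<close>

lemma sweedler_hopf_hom:
  assumes A: "cocomm_hopf_algebra \<kappa> A" and B: "cocomm_hopf_algebra \<kappa> B" and V: "module \<kappa> V"
    and f: "hopf_hom \<kappa> A B f" and g: "bilinear_map \<kappa> B B V g" and x: "x \<in> carrier A"
  shows "sweedler \<kappa> B V (f x) g = sweedler \<kappa> A V x (\<lambda>x1 x2. g (f x1) (f x2))"
proof -
  interpret A: cocomm_hopf_algebra \<kappa> A by fact
  interpret B: cocomm_hopf_algebra \<kappa> B by fact
  have lin: "linear_map \<kappa> A B f" using f by (simp add: hopf_hom_def)
  have bilt: "bilinear_map \<kappa> A A (tensor \<kappa> B B) (\<lambda>x1 x2. tens \<kappa> B B (f x1) (f x2))"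
    by (simp add: bilinear_mapI lin linear_mapD[OF lin])
  have bilg: "bilinear_map \<kappa> A A V (\<lambda>x1 x2. g (f x1) (f x2))"
    by (simp add: bilinear_mapI lin linear_mapD[OF lin] bilinear_map_slice[OF g])
  have "sweedler \<kappa> B V (f x) g
      = tensor_lift \<kappa> V g (sweedler \<kappa> A (tensor \<kappa> B B) x (\<lambda>x1 x2. tens \<kappa> B B (f x1) (f x2)))"
    using f x by (simp add: sweedler_def[of _ B] hopf_hom_def)
  also have "\<dots> = sweedler \<kappa> A V x (\<lambda>x1 x2. tensor_lift \<kappa> V g (tens \<kappa> B B (f x1) (f x2)))"
    by (intro A.sweedler_apply bilt tensor_lift_linear V g x) simp_all
  also have "\<dots> = sweedler \<kappa> A V x (\<lambda>x1 x2. g (f x1) (f x2))"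
    by (intro A.sweedler_cong[symmetric] V bilg x) (simp add: tensor_lift_tens V g linear_mapD[OF lin])
  finally show ?thesis .
qed

lemma hopf_homD:
  assumes "hopf_hom \<kappa> A B f"
  shows "linear_map \<kappa> A B f"
    and "\<lbrakk>x \<in> carrier A; y \<in> carrier A\<rbrakk> \<Longrightarrow> f (x \<otimes>\<^bsub>A\<^esub> y) = f x \<otimes>\<^bsub>B\<^esub> f y"
    and "f \<one>\<^bsub>A\<^esub> = \<one>\<^bsub>B\<^esub>"
    and "x \<in> carrier A \<Longrightarrow> counit B (f x) = counit A x"
  using assms by (simp_all add: hopf_hom_def)

lemma hopf_hom_Gl:
  assumes A: "cocomm_hopf_algebra \<kappa> A" and B: "cocomm_hopf_algebra \<kappa> B"
    and f: "hopf_hom \<kappa> A B f" and x: "x \<in> Gl \<kappa> A"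
  shows "f x \<in> Gl \<kappa> B"
proof -
  interpret A: cocomm_hopf_algebra \<kappa> A by fact
  interpret B: cocomm_hopf_algebra \<kappa> B by fact
  note lin = hopf_homD(1)[OF f]
  have "comult B (f x) = tens \<kappa> B B (f x) (f x)"
    using f x
    by (simp add: hopf_hom_def A.sweedler_Gl bilinear_mapI lin linear_mapD[OF lin])
  then show ?thesis
    using x by (intro GlI) (simp_all add: linear_mapD[OF lin] hopf_homD(4)[OF f])
qed

lemma hopf_hom_Prim:
  assumes A: "cocomm_hopf_algebra \<kappa> A" and B: "cocomm_hopf_algebra \<kappa> B"
    and f: "hopf_hom \<kappa> A B f" and x: "x \<in> Prim \<kappa> A"
  shows "f x \<in> Prim \<kappa> B"
proof -
  interpret A: cocomm_hopf_algebra \<kappa> A by fact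
  interpret B: cocomm_hopf_algebra \<kappa> B by fact
  note lin = hopf_homD(1)[OF f]
  have "comult B (f x) = tens \<kappa> B B (f x) \<one>\<^bsub>B\<^esub> \<oplus>\<^bsub>tensor \<kappa> B B\<^esub> tens \<kappa> B B \<one>\<^bsub>B\<^esub> (f x)"
    using f x
    by (simp add: hopf_hom_def A.sweedler_Prim bilinear_mapI lin linear_mapD[OF lin])
  then show ?thesis
    using x by (intro PrimI) (simp_all add: linear_mapD[OF lin])
qed


section \<open>The group of group-like elements and the Lie algebra of primitive elements\<close>

lemma gl_grp_simps [simp]:
  "carrier (gl_grp \<kappa> H) = Gl \<kappa> H"
  "\<one>\<^bsub>gl_grp \<kappa> H\<^esub> = \<one>\<^bsub>H\<^esub>"
  "\<lbrakk>x \<in> Gl \<kappa> H; y \<in> Gl \<kappa> H\<rbrakk> \<Longrightarrow> x \<otimes>\<^bsub>gl_grp \<kappa> H\<^esub> y = x \<otimes>\<^bsub>H\<^esub> y"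
  by (simp_all add: gl_grp_def)

lemma prim_lie_simps [simp]:
  "carrier (prim_lie \<kappa> H) = Prim \<kappa> H"
  "\<zero>\<^bsub>prim_lie \<kappa> H\<^esub> = \<zero>\<^bsub>H\<^esub>"
  "\<lbrakk>x \<in> Prim \<kappa> H; y \<in> Prim \<kappa> H\<rbrakk> \<Longrightarrow> x \<oplus>\<^bsub>prim_lie \<kappa> H\<^esub> y = x \<oplus>\<^bsub>H\<^esub> y"
  "\<lbrakk>r \<in> carrier \<kappa>; x \<in> Prim \<kappa> H\<rbrakk> \<Longrightarrow> r \<odot>\<^bsub>prim_lie \<kappa> H\<^esub> x = r \<odot>\<^bsub>H\<^esub> x"
  "\<lbrakk>x \<in> Prim \<kappa> H; y \<in> Prim \<kappa> H\<rbrakk> \<Longrightarrow>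
     bracket (prim_lie \<kappa> H) x y = x \<otimes>\<^bsub>H\<^esub> y \<ominus>\<^bsub>H\<^esub> y \<otimes>\<^bsub>H\<^esub> x"
  by (simp_all add: prim_lie_def)

context cocomm_hopf_algebra
begin

lemma tens_zero:
  assumes "x \<in> carrier H"
  shows "tens \<kappa> H H \<zero>\<^bsub>H\<^esub> x = \<zero>\<^bsub>tensor \<kappa> H H\<^esub>" "tens \<kappa> H H x \<zero>\<^bsub>H\<^esub> = \<zero>\<^bsub>tensor \<kappa> H H\<^esub>"
  using bilinear_map_zero[OF module_self module_self module_tensor_self tens_bilinear[OF module_self module_self]] assms
  by simp_all

lemma group_gl_grp: "group (gl_grp \<kappa> H)"
  by (rule groupI) (auto simp: m_assoc intro!: bexI[of _ "antipode H _"] antipode_inverse_Gl)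

lemma inv_gl_grp [simp]:
  assumes "x \<in> Gl \<kappa> H"
  shows "inv\<^bsub>gl_grp \<kappa> H\<^esub> x = antipode H x"
  using assms by (intro monoid.inv_char group.is_monoid group_gl_grp) (simp_all add: antipode_inverse_Gl)

lemma module_prim_lie: "module \<kappa> (prim_lie \<kappa> H)"
proof -
  have "abelian_group (prim_lie \<kappa> H)"
  proof (rule abelian_groupI)
    fix x assume "x \<in> carrier (prim_lie \<kappa> H)"
    then show "\<exists>y\<in>carrier (prim_lie \<kappa> H). y \<oplus>\<^bsub>prim_lie \<kappa> H\<^esub> x = \<zero>\<^bsub>prim_lie \<kappa> H\<^esub>"
      by (intro bexI[of _ "\<ominus>\<^bsub>H\<^esub> x"]) (simp_all add: l_neg)
  qed (simp_all add: a_ac)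
  then show ?thesis
    by (intro moduleI R.cring_axioms)
      (simp_all add: smult_l_distr smult_r_distr smult_assoc1)
qed

lemma a_inv_prim_lie [simp]:
  assumes "x \<in> Prim \<kappa> H"
  shows "\<ominus>\<^bsub>prim_lie \<kappa> H\<^esub> x = \<ominus>\<^bsub>H\<^esub> x"
proof -
  interpret P: module \<kappa> "prim_lie \<kappa> H" by (rule module_prim_lie)
  show ?thesis using assms by (intro P.M.minus_equality) (simp_all add: l_neg)
qed

lemma a_minus_prim_lie [simp]:
  "\<lbrakk>x \<in> Prim \<kappa> H; y \<in> Prim \<kappa> H\<rbrakk> \<Longrightarrow> x \<ominus>\<^bsub>prim_lie \<kappa> H\<^esub> y = x \<ominus>\<^bsub>H\<^esub> y"
  by (simp add: a_minus_def)

lemma lie_algebra_prim_lie: "lie_algebra \<kappa> (prim_lie \<kappa> H)"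
proof -
  have jac: "(x \<otimes>\<^bsub>H\<^esub> (y \<otimes>\<^bsub>H\<^esub> z \<ominus>\<^bsub>H\<^esub> z \<otimes>\<^bsub>H\<^esub> y) \<ominus>\<^bsub>H\<^esub> (y \<otimes>\<^bsub>H\<^esub> z \<ominus>\<^bsub>H\<^esub> z \<otimes>\<^bsub>H\<^esub> y) \<otimes>\<^bsub>H\<^esub> x)
      \<oplus>\<^bsub>H\<^esub> (y \<otimes>\<^bsub>H\<^esub> (z \<otimes>\<^bsub>H\<^esub> x \<ominus>\<^bsub>H\<^esub> x \<otimes>\<^bsub>H\<^esub> z) \<ominus>\<^bsub>H\<^esub> (z \<otimes>\<^bsub>H\<^esub> x \<ominus>\<^bsub>H\<^esub> x \<otimes>\<^bsub>H\<^esub> z) \<otimes>\<^bsub>H\<^esub> y)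
      \<oplus>\<^bsub>H\<^esub> (z \<otimes>\<^bsub>H\<^esub> (x \<otimes>\<^bsub>H\<^esub> y \<ominus>\<^bsub>H\<^esub> y \<otimes>\<^bsub>H\<^esub> x) \<ominus>\<^bsub>H\<^esub> (x \<otimes>\<^bsub>H\<^esub> y \<ominus>\<^bsub>H\<^esub> y \<otimes>\<^bsub>H\<^esub> x) \<otimes>\<^bsub>H\<^esub> z) = \<zero>\<^bsub>H\<^esub>"
    if "x \<in> carrier H" "y \<in> carrier H" "z \<in> carrier H" for x y z
    using that by algebra
  have lin: "bilinear_map \<kappa> H H H (\<lambda>x y. x \<otimes>\<^bsub>H\<^esub> y \<ominus>\<^bsub>H\<^esub> y \<otimes>\<^bsub>H\<^esub> x)"
    by (intro bilinear_mapI linear_map_diff) (simp_all add: linear_map_id)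
  show ?thesis
  proof (intro lie_algebra.intro module_prim_lie lie_algebra_axioms.intro)
    show "bilinear_map \<kappa> (prim_lie \<kappa> H) (prim_lie \<kappa> H) (prim_lie \<kappa> H) (bracket (prim_lie \<kappa> H))"
      by (intro bilinear_mapI linear_mapI) (simp_all add: bilinear_map_simps[OF lin])
  qed (simp_all add: jac module_minus_self[OF module_self])
qed

lemma hopf_ad_bilinear: "bilinear_map \<kappa> H H H (hopf_ad \<kappa> H)"
  unfolding hopf_ad_def
  by (intro bilinear_mapI sweedler_param_linear sweedler_comp_linear) (simp_all add: linear_map_id)

lemma hopf_ad_closed [simp]: "\<lbrakk>x \<in> carrier H; y \<in> carrier H\<rbrakk> \<Longrightarrow> hopf_ad \<kappa> H x y \<in> carrier H"
  by (rule bilinear_map_simps[OF hopf_ad_bilinear])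

lemma hopf_ad_linear [simp]:
  "\<lbrakk>linear_map \<kappa> A H f; y \<in> carrier H\<rbrakk> \<Longrightarrow> linear_map \<kappa> A H (\<lambda>a. hopf_ad \<kappa> H (f a) y)"
  "\<lbrakk>linear_map \<kappa> A H f; y \<in> carrier H\<rbrakk> \<Longrightarrow> linear_map \<kappa> A H (\<lambda>a. hopf_ad \<kappa> H y (f a))"
  by (rule bilinear_map_slice[OF hopf_ad_bilinear]; assumption)+

lemma hopf_ad_Gl: "\<lbrakk>x \<in> Gl \<kappa> H; y \<in> carrier H\<rbrakk> \<Longrightarrow> hopf_ad \<kappa> H x y = x \<otimes>\<^bsub>H\<^esub> y \<otimes>\<^bsub>H\<^esub> antipode H x"
  unfolding hopf_ad_def by (simp add: sweedler_Gl bilinear_mapI linear_map_id)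

lemma hopf_ad_one_left: "y \<in> carrier H \<Longrightarrow> hopf_ad \<kappa> H \<one>\<^bsub>H\<^esub> y = y"
  by (simp add: hopf_ad_Gl)

lemma hopf_ad_Prim: "\<lbrakk>x \<in> Prim \<kappa> H; y \<in> carrier H\<rbrakk> \<Longrightarrow> hopf_ad \<kappa> H x y = x \<otimes>\<^bsub>H\<^esub> y \<ominus>\<^bsub>H\<^esub> y \<otimes>\<^bsub>H\<^esub> x"
  unfolding hopf_ad_def
  by (simp add: sweedler_Prim bilinear_mapI linear_map_id antipode_Prim a_minus_def r_minus)

lemma hopf_ad_one_right: "x \<in> carrier H \<Longrightarrow> hopf_ad \<kappa> H x \<one>\<^bsub>H\<^esub> = counit H x \<odot>\<^bsub>H\<^esub> \<one>\<^bsub>H\<^esub>"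
  unfolding hopf_ad_def antipode_right[symmetric]
  by (rule sweedler_cong) (simp_all add: bilinear_mapI linear_map_id)

end

lemma lie_hom_restrict_Prim:
  assumes A: "cocomm_hopf_algebra \<kappa> A" and B: "cocomm_hopf_algebra \<kappa> B" and f: "hopf_hom \<kappa> A B f"
  shows "lie_hom \<kappa> (prim_lie \<kappa> A) (prim_lie \<kappa> B) (restrict f (Prim \<kappa> A))"
proof -
  interpret A: cocomm_hopf_algebra \<kappa> A by fact
  interpret B: cocomm_hopf_algebra \<kappa> B by fact
  note lin = hopf_homD(1)[OF f]
  note cl = hopf_hom_Prim[OF A B f]
  show ?thesis
    unfolding lie_hom_def linear_map_def
    by (auto simp: cl linear_mapD[OF lin] linear_map_minus[OF A.module_self B.module_self lin] hopf_homD(2)[OF f])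
qed

lemma hom_restrict_Gl:
  assumes A: "cocomm_hopf_algebra \<kappa> A" and B: "cocomm_hopf_algebra \<kappa> B" and f: "hopf_hom \<kappa> A B f"
  shows "restrict f (Gl \<kappa> A) \<in> hom (gl_grp \<kappa> A) (gl_grp \<kappa> B)"
proof -
  interpret A: cocomm_hopf_algebra \<kappa> A by fact
  interpret B: cocomm_hopf_algebra \<kappa> B by fact
  show ?thesis
    by (rule homI) (auto simp: hopf_hom_Gl[OF A B f] hopf_homD(2)[OF f])
qed

lemma bilinear_map_restrict_Prim:
  assumes A: "cocomm_hopf_algebra \<kappa> A" and B: "cocomm_hopf_algebra \<kappa> B" and C: "cocomm_hopf_algebra \<kappa> C"
    and f: "bilinear_map \<kappa> A B C f"
    and cl: "\<And>x y. \<lbrakk>x \<in> Prim \<kappa> A; y \<in> Prim \<kappa> B\<rbrakk> \<Longrightarrow> f x y \<in> Prim \<kappa> C"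
  shows "bilinear_map \<kappa> (prim_lie \<kappa> A) (prim_lie \<kappa> B) (prim_lie \<kappa> C)
    (\<lambda>x\<in>Prim \<kappa> A. \<lambda>y\<in>Prim \<kappa> B. f x y)"
proof -
  interpret A: cocomm_hopf_algebra \<kappa> A by fact
  interpret B: cocomm_hopf_algebra \<kappa> B by fact
  interpret C: cocomm_hopf_algebra \<kappa> C by fact
  show ?thesis
    by (intro bilinear_mapI linear_mapI) (simp_all add: bilinear_map_simps[OF f] cl)
qed


section \<open>Actions and crossed modules\<close>

text \<open>The conditions that are convenient to check; that each \<open>g\<close> acts bijectively follows from the action of
  its inverse.\<close>

lemma grp_actionI:
  assumes "group G" "group E"
    and closed: "\<And>g e. \<lbrakk>g \<in> carrier G; e \<in> carrier E\<rbrakk> \<Longrightarrow> act g e \<in> carrier E"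
    and mult: "\<And>g e f. \<lbrakk>g \<in> carrier G; e \<in> carrier E; f \<in> carrier E\<rbrakk> \<Longrightarrow>
      act g (e \<otimes>\<^bsub>E\<^esub> f) = act g e \<otimes>\<^bsub>E\<^esub> act g f"
    and one: "\<And>e. e \<in> carrier E \<Longrightarrow> act \<one>\<^bsub>G\<^esub> e = e"
    and comp: "\<And>g h e. \<lbrakk>g \<in> carrier G; h \<in> carrier G; e \<in> carrier E\<rbrakk> \<Longrightarrow>
      act (g \<otimes>\<^bsub>G\<^esub> h) e = act g (act h e)"
  shows "grp_action G E act"
proof -
  interpret G: group G by fact
  interpret E: group E by fact
  let ?a = "\<lambda>g. restrict (act g) (carrier E)"
  have bij: "?a g \<in> Bij (carrier E)" if g: "g \<in> carrier G" for g
  proof -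
    have "bij_betw (?a g) (carrier E) (carrier E)"
      using g by (intro bij_betw_byWitness[of _ "act (inv\<^bsub>G\<^esub> g)"])
        (auto simp: closed one comp[symmetric])
    then show ?thesis by (simp add: Bij_def)
  qed
  have auto: "?a g \<in> carrier (AutoGroup E)" if g: "g \<in> carrier G" for g
    using g bij[OF g] by (auto simp: AutoGroup_def auto_def hom_def closed mult)
  show ?thesis
  proof (intro grp_action.intro homI auto)
    fix g h assume "g \<in> carrier G" "h \<in> carrier G"
    then show "?a (g \<otimes>\<^bsub>G\<^esub> h) = ?a g \<otimes>\<^bsub>AutoGroup E\<^esub> ?a h"
      using bij by (auto simp: AutoGroup_def BijGroup_def compose_def comp closed)
  qed
qed

lemma grp_action_cong:
  assumes "\<And>g e. \<lbrakk>g \<in> carrier G; e \<in> carrier E\<rbrakk> \<Longrightarrow> act g e = act' g e"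
    and "group G" "grp_action G E act"
  shows "grp_action G E act'"
proof -
  interpret G: group G by fact
  have eq: "restrict (act g) (carrier E) = restrict (act' g) (carrier E)" if "g \<in> carrier G" for g
    using that assms(1) by (auto simp: restrict_def)
  have h: "(\<lambda>g. restrict (act g) (carrier E)) \<in> hom G (AutoGroup E)"
    using assms(3) by (rule grp_action.action_hom)
  show ?thesis
    using hom_in_carrier[OF h] hom_mult[OF h] by (intro grp_action.intro homI) (simp_all add: eq)
qed

text \<open>The action on the top term of a 2-crossed module of groups or Lie algebras is defined through the lifting,
  whereas restricting the Hopf algebra crossed module yields the restricted Hopf algebra action. The two
  agree on carriers only, which is enough by the following two lemmas.\<close>

lemma grp_xmod_cong:
  assumes "grp_xmod E G d act"
    and eq: "\<And>g e. \<lbrakk>g \<in> carrier G; e \<in> carrier E\<rbrakk> \<Longrightarrow> act g e = act' g e"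
  shows "grp_xmod E G d act'"
proof -
  interpret X: grp_xmod E G d act by fact
  show ?thesis
    using grp_action_cong[OF eq X.group_G X.act] X.group_E X.group_G X.hom_d X.d_act X.peiffer
      hom_in_carrier[OF X.hom_d]
    by (intro grp_xmod.intro) (simp_all add: eq[symmetric])
qed

lemma lie_xmod_cong:
  assumes "lie_xmod \<kappa> E G d act"
    and eq: "\<And>g e. \<lbrakk>g \<in> carrier G; e \<in> carrier E\<rbrakk> \<Longrightarrow> act g e = act' g e"
  shows "lie_xmod \<kappa> E G d act'"
proof -
  interpret X: lie_xmod \<kappa> E G d act by fact
  interpret A: lie_action \<kappa> G E act by (rule X.act)
  interpret E: lie_algebra \<kappa> E by (rule X.lie_E)
  interpret G: lie_algebra \<kappa> G by (rule X.lie_G)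
  have lin: "linear_map \<kappa> E G d" using X.hom_d by (simp add: lie_hom_def)
  note cl = bilinear_map_simps(1)[OF A.act_bilinear] bilinear_map_simps(1)[OF E.bracket_bilinear]
    bilinear_map_simps(1)[OF G.bracket_bilinear] linear_mapD(1)[OF lin]
  have "lie_action \<kappa> G E act'"
    using A.act_bilinear bilinear_map_cong[OF G.module_axioms E.module_axioms eq, where C = E] A.bracket_act A.act_bracket
    by (intro lie_action.intro) (simp_all add: eq[symmetric] cl)
  then show ?thesis
    using X.lie_E X.lie_G X.hom_d X.d_act X.peiffer
    by (intro lie_xmod.intro) (simp_all add: eq[symmetric] cl)
qed

locale hopf_action = H: cocomm_hopf_algebra \<kappa> H + I: cocomm_hopf_algebra \<kappa> I + module_bialgebra \<kappa> H I act
  for \<kappa> :: "'k ring" and H :: "('k, 'h) hopf" and I :: "('k, 'i) hopf" and act (infixr "\<rhd>" 75)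
begin

lemmas act_zero [simp] = bilinear_map_zero[OF H.module_self I.module_self I.module_self act_bilinear]
lemmas act_neg = bilinear_map_neg[OF H.module_self I.module_self I.module_self act_bilinear]
lemmas act_minus = bilinear_map_minus[OF H.module_self I.module_self I.module_self act_bilinear]
lemmas act_simps [simp] = bilinear_map_simps(1)[OF act_bilinear] bilinear_map_slice[OF act_bilinear]

lemma act_Gl [simp]:
  assumes "a \<in> Gl \<kappa> H" "v \<in> Gl \<kappa> I"
  shows "a \<rhd> v \<in> Gl \<kappa> I"
  using assms
  by (intro GlI) (simp_all add: act_comult act_counit H.sweedler_Gl I.sweedler_Gl bilinear_mapI linear_map_id)

lemma act_one_Prim: "a \<in> Prim \<kappa> H \<Longrightarrow> a \<rhd> \<one>\<^bsub>I\<^esub> = \<zero>\<^bsub>I\<^esub>"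
  by (simp add: act_one H.counit_Prim)

text \<open>Of the four terms of \<open>\<Sum> (a' \<rhd> v') \<otimes> (a'' \<rhd> v'')\<close>, the two with \<open>a \<rhd> 1 = \<epsilon>(a) 1 = 0\<close> drop out.\<close>

lemma act_Prim [simp]:
  assumes "a \<in> Prim \<kappa> H" "v \<in> Prim \<kappa> I"
  shows "a \<rhd> v \<in> Prim \<kappa> I"
proof (rule PrimI)
  interpret T: module \<kappa> "tensor \<kappa> I I" by simp
  show "comult I (a \<rhd> v) = tens \<kappa> I I (a \<rhd> v) \<one>\<^bsub>I\<^esub> \<oplus>\<^bsub>tensor \<kappa> I I\<^esub> tens \<kappa> I I \<one>\<^bsub>I\<^esub> (a \<rhd> v)"
    using assms
    by (simp add: act_comult H.sweedler_Prim I.sweedler_Prim bilinear_mapI linear_map_id act_one_Prim one_act I.tens_zero)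
qed (use assms in simp)

lemma act_mult_Gl: "\<lbrakk>a \<in> Gl \<kappa> H; u \<in> carrier I; v \<in> carrier I\<rbrakk> \<Longrightarrow> a \<rhd> (u \<otimes>\<^bsub>I\<^esub> v) = (a \<rhd> u) \<otimes>\<^bsub>I\<^esub> (a \<rhd> v)"
  by (simp add: act_mult H.sweedler_Gl bilinear_mapI linear_map_id)

lemma act_mult_Prim: "\<lbrakk>a \<in> Prim \<kappa> H; u \<in> carrier I; v \<in> carrier I\<rbrakk> \<Longrightarrow>
    a \<rhd> (u \<otimes>\<^bsub>I\<^esub> v) = (a \<rhd> u) \<otimes>\<^bsub>I\<^esub> v \<oplus>\<^bsub>I\<^esub> u \<otimes>\<^bsub>I\<^esub> (a \<rhd> v)"
  by (simp add: act_mult H.sweedler_Prim bilinear_mapI linear_map_id one_act)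

lemma grp_action_Gl: "grp_action (gl_grp \<kappa> H) (gl_grp \<kappa> I) (\<lambda>a\<in>Gl \<kappa> H. \<lambda>v\<in>Gl \<kappa> I. a \<rhd> v)"
  by (rule grp_actionI) (simp_all add: H.group_gl_grp I.group_gl_grp act_mult_Gl one_act mult_act)

lemma lie_action_Prim: "lie_action \<kappa> (prim_lie \<kappa> H) (prim_lie \<kappa> I) (\<lambda>a\<in>Prim \<kappa> H. \<lambda>v\<in>Prim \<kappa> I. a \<rhd> v)"
  (is "lie_action _ _ _ ?act")
proof (rule lie_action.intro)
  show "bilinear_map \<kappa> (prim_lie \<kappa> H) (prim_lie \<kappa> I) (prim_lie \<kappa> I) ?act"
    by (rule bilinear_map_restrict_Prim[OF _ _ _ act_bilinear]) (simp_all add: H.cocomm_hopf_algebra_axioms I.cocomm_hopf_algebra_axioms)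
next
  fix g h e assume "g \<in> carrier (prim_lie \<kappa> H)" "h \<in> carrier (prim_lie \<kappa> H)" "e \<in> carrier (prim_lie \<kappa> I)"
  then show "?act (bracket (prim_lie \<kappa> H) g h) e
    = ?act g (?act h e)
      \<ominus>\<^bsub>prim_lie \<kappa> I\<^esub> ?act h (?act g e)"
    by (simp add: mult_act act_minus)
next
  fix g e f assume "g \<in> carrier (prim_lie \<kappa> H)" "e \<in> carrier (prim_lie \<kappa> I)" "f \<in> carrier (prim_lie \<kappa> I)"
  moreover from this have "g \<rhd> (e \<otimes>\<^bsub>I\<^esub> f \<ominus>\<^bsub>I\<^esub> f \<otimes>\<^bsub>I\<^esub> e)
      = ((g \<rhd> e) \<otimes>\<^bsub>I\<^esub> f \<ominus>\<^bsub>I\<^esub> f \<otimes>\<^bsub>I\<^esub> (g \<rhd> e)) \<oplus>\<^bsub>I\<^esub> (e \<otimes>\<^bsub>I\<^esub> (g \<rhd> f) \<ominus>\<^bsub>I\<^esub> (g \<rhd> f) \<otimes>\<^bsub>I\<^esub> e)"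
    by (simp add: act_mult_Prim act_minus) (simp add: a_minus_def I.minus_add I.a_ac)
  ultimately show "?act g (bracket (prim_lie \<kappa> I) e f)
    = bracket (prim_lie \<kappa> I) (?act g e) f
      \<oplus>\<^bsub>prim_lie \<kappa> I\<^esub> bracket (prim_lie \<kappa> I) e (?act g f)"
    by simp
qed

end

context hopf_xmod
begin

interpretation A: hopf_action \<kappa> H I act
  by (intro hopf_action.intro hopf_H hopf_I act)

lemma grp_xmod_Gl:
  "grp_xmod (gl_grp \<kappa> I) (gl_grp \<kappa> H) (\<lambda>x\<in>Gl \<kappa> I. \<partial> x) (\<lambda>a\<in>Gl \<kappa> H. \<lambda>v\<in>Gl \<kappa> I. a \<rhd> v)"
  by (intro grp_xmod.intro A.grp_action_Gl hom_restrict_Gl A.H.group_gl_grp A.I.group_gl_grp hopf_H hopf_I hom_d)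
    (simp_all add: hopf_hom_Gl[OF hopf_I hopf_H hom_d] d_act peiffer A.H.hopf_ad_Gl A.I.hopf_ad_Gl)

lemma lie_xmod_Prim:
  "lie_xmod \<kappa> (prim_lie \<kappa> I) (prim_lie \<kappa> H) (\<lambda>x\<in>Prim \<kappa> I. \<partial> x) (\<lambda>a\<in>Prim \<kappa> H. \<lambda>v\<in>Prim \<kappa> I. a \<rhd> v)"
proof -
  have "\<partial> x \<in> Prim \<kappa> H" if "x \<in> Prim \<kappa> I" for x using that by (rule hopf_hom_Prim[OF hopf_I hopf_H hom_d])
  then show ?thesis
    by (intro lie_xmod.intro A.lie_action_Prim lie_hom_restrict_Prim A.H.lie_algebra_prim_lie
        A.I.lie_algebra_prim_lie hopf_H hopf_I hom_d)
      (simp_all add: d_act peiffer A.H.hopf_ad_Prim A.I.hopf_ad_Prim)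
qed

end


section \<open>2-crossed modules\<close>

context hopf_x2mod
begin

interpretation K: cocomm_hopf_algebra \<kappa> K by (rule hopf_K)
interpretation I: cocomm_hopf_algebra \<kappa> I by (rule hopf_I)
interpretation H: cocomm_hopf_algebra \<kappa> H by (rule hopf_H)
interpretation AI: hopf_action \<kappa> H I actI by (intro hopf_action.intro hopf_H hopf_I actI)
interpretation AK: hopf_action \<kappa> H K actK by (intro hopf_action.intro hopf_H hopf_K actK)
interpretation X: hopf_xmod \<kappa> K I d2 "hopf_lift_act \<kappa> K \<partial>\<^sub>2 pf" by (rule lift_xmod)
interpretation AL: hopf_action \<kappa> I K "hopf_lift_act \<kappa> K \<partial>\<^sub>2 pf" by (intro hopf_action.intro hopf_I hopf_K X.act)

lemmas boundary_simps =
  linear_mapD(1)[OF hopf_homD(1)[OF hom_d1]] linear_mapD(1)[OF hopf_homD(1)[OF hom_d2]]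
  linear_map_comp[OF hopf_homD(1)[OF hom_d1]] linear_map_comp[OF hopf_homD(1)[OF hom_d2]]
  hopf_homD(3)[OF hom_d1] hopf_homD(3)[OF hom_d2]
  hopf_hom_Gl[OF hopf_K hopf_I hom_d2] hopf_hom_Gl[OF hopf_I hopf_H hom_d1]
  hopf_hom_Prim[OF hopf_K hopf_I hom_d2] hopf_hom_Prim[OF hopf_I hopf_H hom_d1]

lemmas lift_simps =
  bilinear_map_simps(1)[OF lift_bilinear] bilinear_map_slice[OF lift_bilinear]

lemmas bilinear_simps = bilinear_mapI linear_map_id boundary_simps lift_simps

lemma lift_Gl: "\<lbrakk>x \<in> Gl \<kappa> I; y \<in> Gl \<kappa> I\<rbrakk> \<Longrightarrow> pf x y \<in> Gl \<kappa> K"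
  by (rule GlI) (simp_all add: lift_comult lift_counit I.sweedler_Gl bilinear_simps)

lemma lift_act_Gl: "\<lbrakk>k \<in> Gl \<kappa> K; x \<in> carrier I\<rbrakk> \<Longrightarrow>
    hopf_lift_act \<kappa> K \<partial>\<^sub>2 pf x k = k \<otimes>\<^bsub>K\<^esub> pf (\<partial>\<^sub>2 (antipode K k)) x"
  unfolding hopf_lift_act_def by (simp add: K.sweedler_Gl bilinear_simps)

text \<open>On group-like elements every Sweedler sum collapses to one term, and each axiom for groups is the
  axiom for Hopf algebras read off at these elements.\<close>

lemma grp_x2mod_Gl:
  "grp_x2mod (gl_grp \<kappa> K) (gl_grp \<kappa> I) (gl_grp \<kappa> H) (\<lambda>k\<in>Gl \<kappa> K. \<partial>\<^sub>2 k) (\<lambda>x\<in>Gl \<kappa> I. \<partial>\<^sub>1 x)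
    (\<lambda>a\<in>Gl \<kappa> H. \<lambda>x\<in>Gl \<kappa> I. a \<rhd>\<^sub>I x) (\<lambda>a\<in>Gl \<kappa> H. \<lambda>k\<in>Gl \<kappa> K. a \<rhd>\<^sub>K k)
    (\<lambda>x\<in>Gl \<kappa> I. \<lambda>y\<in>Gl \<kappa> I. pf x y)"
proof (intro grp_x2mod.intro K.group_gl_grp I.group_gl_grp H.group_gl_grp AI.grp_action_Gl AK.grp_action_Gl
    hom_restrict_Gl hopf_K hopf_I hopf_H hom_d1 hom_d2, goal_cases)
  case (1 k)
  then show ?case by (simp add: boundary_simps chain_complex)
next
  case 2
  then show ?case by (simp add: lift_Gl)
next
  case (3 g e f)
  then show ?case by (simp add: lift_Gl lift_equivariant H.sweedler_Gl bilinear_simps)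
next
  case (4 g l)
  then show ?case by (simp add: boundary_simps d2_act)
next
  case (5 g e)
  then show ?case by (simp add: boundary_simps d1_act H.hopf_ad_Gl)
next
  case (6 e f)
  then show ?case by (simp add: lift_Gl boundary_simps d2_lift I.sweedler_Gl I.hopf_ad_Gl bilinear_simps)
next
  case (7 l m)
  then show ?case by (simp add: boundary_simps lift_d2 K.sweedler_Gl K.hopf_ad_Gl bilinear_simps)
next
  case (8 e f h)
  then show ?case
    by (simp add: lift_Gl boundary_simps lift_mult_right I.sweedler_Gl bilinear_simps grp_lift_act_def lift_act_Gl)
next
  case (9 e f h)
  then show ?case
    by (simp add: lift_Gl boundary_simps lift_mult_left I.sweedler_Gl I.hopf_ad_Gl bilinear_simps)
next
  case (10 l e)
  then show ?case
    using lift_d2_symm[of l e]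
    by (simp add: lift_Gl boundary_simps K.sweedler_Gl I.sweedler_Gl bilinear_simps)
next
  case 11
  show ?case
    by (rule grp_xmod_cong[OF X.grp_xmod_Gl]) (simp add: grp_lift_act_def lift_act_Gl lift_Gl boundary_simps)
qed

text \<open>The rule for \<open>{1,1\<cdot>1}\<close> gives \<open>p = p p\<close> for \<open>p = {1,1}\<close>. As the lifting is a coalgebra map, \<open>p\<close> is
  group-like and hence invertible.\<close>

lemma lift_one_one: "pf \<one>\<^bsub>I\<^esub> \<one>\<^bsub>I\<^esub> = \<one>\<^bsub>K\<^esub>"
proof -
  let ?p = "pf \<one>\<^bsub>I\<^esub> \<one>\<^bsub>I\<^esub>"
  have g: "?p \<in> Gl \<kappa> K" by (simp add: lift_Gl)
  have "?p = ?p \<otimes>\<^bsub>K\<^esub> ?p"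
    using lift_mult_right[of "\<one>\<^bsub>I\<^esub>" "\<one>\<^bsub>I\<^esub>" "\<one>\<^bsub>I\<^esub>"]
    by (simp add: I.sweedler_one bilinear_simps AI.one_act AL.one_act)
  then have "antipode K ?p \<otimes>\<^bsub>K\<^esub> ?p = antipode K ?p \<otimes>\<^bsub>K\<^esub> (?p \<otimes>\<^bsub>K\<^esub> ?p)" by simp
  also have "\<dots> = (antipode K ?p \<otimes>\<^bsub>K\<^esub> ?p) \<otimes>\<^bsub>K\<^esub> ?p"
    using g by (simp add: K.m_assoc)
  finally show ?thesis using g by (simp add: K.antipode_inverse_Gl)
qed

text \<open>With \<open>{1,1} = 1\<close>, the rule for \<open>{x,1\<cdot>1}\<close> at a primitive \<open>x\<close> has three terms: \<open>{x,1}\<close> twice, and a term with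
  \<open>\<partial>\<^sub>1 x \<rhd> 1 = 0\<close>. The mirror image uses the rule for \<open>{1\<cdot>1,x}\<close>.\<close>

lemma lift_one_right:
  assumes "x \<in> Prim \<kappa> I"
  shows "pf x \<one>\<^bsub>I\<^esub> = \<zero>\<^bsub>K\<^esub>"
proof -
  have x: "x \<in> carrier I" using assms by simp
  have "pf x (\<one>\<^bsub>I\<^esub> \<otimes>\<^bsub>I\<^esub> \<one>\<^bsub>I\<^esub>) = pf x \<one>\<^bsub>I\<^esub> \<oplus>\<^bsub>K\<^esub> pf x \<one>\<^bsub>I\<^esub>"
    using assms x
    by (subst lift_mult_right) (simp_all add: I.sweedler_one I.sweedler_Prim bilinear_simps AI.one_act
        AL.one_act lift_one_one AI.act_one_Prim)
  then have "pf x \<one>\<^bsub>I\<^esub> \<oplus>\<^bsub>K\<^esub> pf x \<one>\<^bsub>I\<^esub> = pf x \<one>\<^bsub>I\<^esub>" by (simp only: I.l_one I.one_closed)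
  then show ?thesis using x by (simp only: K.add.l_cancel_one lift_simps I.one_closed)
qed

lemma lift_one_left:
  assumes "x \<in> Prim \<kappa> I"
  shows "pf \<one>\<^bsub>I\<^esub> x = \<zero>\<^bsub>K\<^esub>"
proof -
  have x: "x \<in> carrier I" using assms by simp
  have "pf (\<one>\<^bsub>I\<^esub> \<otimes>\<^bsub>I\<^esub> \<one>\<^bsub>I\<^esub>) x = pf \<one>\<^bsub>I\<^esub> x \<oplus>\<^bsub>K\<^esub> pf \<one>\<^bsub>I\<^esub> x"
    using assms x
    by (subst lift_mult_left) (simp_all add: I.sweedler_one I.sweedler_Prim bilinear_simps AK.one_act
        lift_one_one I.hopf_ad_one_left)
  then have "pf \<one>\<^bsub>I\<^esub> x \<oplus>\<^bsub>K\<^esub> pf \<one>\<^bsub>I\<^esub> x = pf \<one>\<^bsub>I\<^esub> x" by (simp only: I.l_one I.one_closed)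
  then show ?thesis using x by (simp only: K.add.l_cancel_one lift_simps I.one_closed)
qed

lemmas lift_zero = bilinear_map_zero[OF I.module_self I.module_self K.module_self lift_bilinear]
lemmas lift_neg = bilinear_map_neg[OF I.module_self I.module_self K.module_self lift_bilinear]
lemmas lift_minus = bilinear_map_minus[OF I.module_self I.module_self K.module_self lift_bilinear]

lemma lift_Prim: "\<lbrakk>x \<in> Prim \<kappa> I; y \<in> Prim \<kappa> I\<rbrakk> \<Longrightarrow> pf x y \<in> Prim \<kappa> K"
proof (rule PrimI)
  interpret T: module \<kappa> "tensor \<kappa> K K" by simp
  assume "x \<in> Prim \<kappa> I" "y \<in> Prim \<kappa> I"
  then show "comult K (pf x y) = tens \<kappa> K K (pf x y) \<one>\<^bsub>K\<^esub> \<oplus>\<^bsub>tensor \<kappa> K K\<^esub> tens \<kappa> K K \<one>\<^bsub>K\<^esub> (pf x y)"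
    by (simp add: lift_comult I.sweedler_Prim bilinear_simps lift_one_one lift_one_left lift_one_right K.tens_zero)
qed (simp add: lift_simps)

lemmas evaluate_simps = I.sweedler_one K.sweedler_one I.sweedler_Prim K.sweedler_Prim H.sweedler_Prim bilinear_simps
  lift_one_one lift_one_left lift_one_right lift_zero lift_Prim
  AI.one_act AK.one_act AL.one_act AI.act_one_Prim AK.act_one_Prim AL.act_one_Prim
  I.hopf_ad_one_left K.hopf_ad_one_left I.hopf_ad_one_right K.hopf_ad_one_right I.counit_Prim K.counit_Prim
  linear_map_zero[OF K.module_self I.module_self hopf_homD(1)[OF hom_d2]]
  module_minus_self[OF K.module_self] module_minus_self[OF I.module_self]

lemma lift_act_Prim: "\<lbrakk>k \<in> Prim \<kappa> K; x \<in> Prim \<kappa> I\<rbrakk> \<Longrightarrow> hopf_lift_act \<kappa> K \<partial>\<^sub>2 pf x k = \<ominus>\<^bsub>K\<^esub> pf (\<partial>\<^sub>2 k) x"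
  unfolding hopf_lift_act_def
  by (simp add: evaluate_simps K.antipode_Prim lift_neg linear_map_neg[OF K.module_self I.module_self hopf_homD(1)[OF hom_d2]])

text \<open>Of the six terms only \<open>{1,1} (y \<rhd>' {x,z})\<close> survives: all others contain \<open>{x,1}\<close>, \<open>{1,y}\<close> or
  \<open>{1,z}\<close>. Antisymmetrizing in \<open>y\<close> and \<open>z\<close> gives the Lie axiom for \<open>{x,[y,z]}\<close>.\<close>

lemma lift_mult_right_Prim:
  assumes "x \<in> Prim \<kappa> I" "y \<in> Prim \<kappa> I" "z \<in> Prim \<kappa> I"
  shows "pf x (y \<otimes>\<^bsub>I\<^esub> z) = \<ominus>\<^bsub>K\<^esub> pf (\<partial>\<^sub>2 (pf x z)) y"
  using assms by (subst lift_mult_right) (simp_all add: evaluate_simps lift_act_Prim)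

text \<open>Likewise, of the eight terms the survivors are those in which \<open>x\<close>, \<open>y\<close> and \<open>z\<close> all go to the first or all
  to the second factor. Antisymmetrizing in \<open>x\<close> and \<open>y\<close> gives the Lie axiom for \<open>{[x,y],z}\<close>.\<close>

lemma lift_mult_left_Prim:
  assumes "x \<in> Prim \<kappa> I" "y \<in> Prim \<kappa> I" "z \<in> Prim \<kappa> I"
  shows "pf (x \<otimes>\<^bsub>I\<^esub> y) z = pf x (y \<otimes>\<^bsub>I\<^esub> z \<ominus>\<^bsub>I\<^esub> z \<otimes>\<^bsub>I\<^esub> y) \<oplus>\<^bsub>K\<^esub> (\<partial>\<^sub>1 x \<rhd>\<^sub>K pf y z)"
  using assms by (subst lift_mult_left) (simp_all add: evaluate_simps I.hopf_ad_Prim)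

lemma lie_x2mod_Prim:
  "lie_x2mod \<kappa> (prim_lie \<kappa> K) (prim_lie \<kappa> I) (prim_lie \<kappa> H) (\<lambda>k\<in>Prim \<kappa> K. \<partial>\<^sub>2 k) (\<lambda>x\<in>Prim \<kappa> I. \<partial>\<^sub>1 x)
    (\<lambda>a\<in>Prim \<kappa> H. \<lambda>x\<in>Prim \<kappa> I. a \<rhd>\<^sub>I x) (\<lambda>a\<in>Prim \<kappa> H. \<lambda>k\<in>Prim \<kappa> K. a \<rhd>\<^sub>K k)
    (\<lambda>x\<in>Prim \<kappa> I. \<lambda>y\<in>Prim \<kappa> I. pf x y)"
proof (intro lie_x2mod.intro K.lie_algebra_prim_lie I.lie_algebra_prim_lie H.lie_algebra_prim_lie
    AI.lie_action_Prim AK.lie_action_Prim lie_hom_restrict_Prim bilinear_map_restrict_Prim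
    hopf_K hopf_I hopf_H hom_d1 hom_d2 lift_bilinear, goal_cases)
  case (1 k)
  then show ?case by (simp add: boundary_simps chain_complex K.counit_Prim)
next
  case (2 x y)
  then show ?case by (rule lift_Prim)
next
  case (3 g e f)
  then show ?case by (simp add: lift_equivariant evaluate_simps)
next
  case (4 g l)
  then show ?case by (simp add: boundary_simps d2_act)
next
  case (5 g e)
  then show ?case by (simp add: boundary_simps d1_act H.hopf_ad_Prim)
next
  case (6 e f)
  then show ?case
    by (simp add: d2_lift evaluate_simps I.antipode_Prim I.hopf_ad_Prim AI.act_neg)
      (simp add: a_minus_def bilinear_simps)
next
  case (7 l m)
  then show ?case
    by (simp add: lift_d2 evaluate_simps K.antipode_Prim K.hopf_ad_Prim)
next
  case (8 u v w)
  then show ?case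
    by (simp add: lift_minus lift_mult_right_Prim evaluate_simps) (simp add: a_minus_def K.a_comm evaluate_simps)
next
  case (9 u v w)
  then have "pf (u \<otimes>\<^bsub>I\<^esub> v \<ominus>\<^bsub>I\<^esub> v \<otimes>\<^bsub>I\<^esub> u) w
      = (pf u (v \<otimes>\<^bsub>I\<^esub> w \<ominus>\<^bsub>I\<^esub> w \<otimes>\<^bsub>I\<^esub> v) \<oplus>\<^bsub>K\<^esub> (\<partial>\<^sub>1 u \<rhd>\<^sub>K pf v w))
        \<ominus>\<^bsub>K\<^esub> (pf v (u \<otimes>\<^bsub>I\<^esub> w \<ominus>\<^bsub>I\<^esub> w \<otimes>\<^bsub>I\<^esub> u) \<oplus>\<^bsub>K\<^esub> (\<partial>\<^sub>1 v \<rhd>\<^sub>K pf u w))"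
    by (simp add: lift_minus(1) lift_mult_left_Prim)
  also have "\<dots> = (\<partial>\<^sub>1 u \<rhd>\<^sub>K pf v w) \<oplus>\<^bsub>K\<^esub> pf u (v \<otimes>\<^bsub>I\<^esub> w \<ominus>\<^bsub>I\<^esub> w \<otimes>\<^bsub>I\<^esub> v)
      \<ominus>\<^bsub>K\<^esub> (\<partial>\<^sub>1 v \<rhd>\<^sub>K pf u w) \<ominus>\<^bsub>K\<^esub> pf v (u \<otimes>\<^bsub>I\<^esub> w \<ominus>\<^bsub>I\<^esub> w \<otimes>\<^bsub>I\<^esub> u)"
    using 9 by (simp add: evaluate_simps a_minus_def[of K] K.minus_add K.a_ac)
  finally show ?case using 9 by (simp add: evaluate_simps)
next
  case (10 l e)
  then show ?case
    using lift_d2_symm[of l e]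
    by (simp add: evaluate_simps K.antipode_Prim AK.act_neg)
next
  case 11
  show ?case
    by (rule lie_xmod_cong[OF X.lie_xmod_Prim]) (simp add: lie_lift_act_def lift_act_Prim lift_Prim boundary_simps)
qed

end


section \<open>The categories and the restriction functors\<close>

text \<open>Structured sets with their homomorphisms, so far as the categories of crossed modules depend on
  them. Identities and composites are extensional, as in the hom-sets of these categories. Hopf algebras,
  Lie algebras and groups thereby share one proof that (2-)crossed modules form a category.\<close>

locale structured_homs =
  fixes P :: "('a, 'm) partial_object_scheme \<Rightarrow> bool"
    and h :: "('a, 'm) partial_object_scheme \<Rightarrow> ('a, 'm) partial_object_scheme \<Rightarrow> ('a \<Rightarrow> 'a) \<Rightarrow> bool"
  assumes identity: "P A \<Longrightarrow> h A A (\<lambda>x\<in>carrier A. x)"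
    and composite: "\<lbrakk>P A; P B; P C; h A B f; h B C g\<rbrakk> \<Longrightarrow> h A C (compose (carrier A) g f)"
    and closed: "\<lbrakk>P A; P B; h A B f; x \<in> carrier A\<rbrakk> \<Longrightarrow> f x \<in> carrier B"

lemma compose_identities:
  assumes "f \<in> extensional A"
  shows "compose A f (\<lambda>x\<in>A. x) = f" "(\<And>x. x \<in> A \<Longrightarrow> f x \<in> B) \<Longrightarrow> compose A (\<lambda>x\<in>B. x) f = f"
  using assms by (auto simp: compose_def restrict_def extensional_def)

lemma compose_assoc_maps:
  "(\<And>x. x \<in> A \<Longrightarrow> f x \<in> B) \<Longrightarrow> compose A h (compose A g f) = compose A (compose B h g) f"
  by (auto simp: compose_def restrict_def)

text \<open>A composite commutes with boundaries and actions because these map the carriers into one another;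
  this closedness is what the objects contribute to the proof that they form a category.\<close>

locale xmod_objects = E: structured_homs PE homE + G: structured_homs PG homG
  for PE :: "('e, 'y) partial_object_scheme \<Rightarrow> bool" and homE
    and PG :: "('g, 'z) partial_object_scheme \<Rightarrow> bool" and homG +
  fixes is_obj :: "(('e, 'y) partial_object_scheme, ('g, 'z) partial_object_scheme, 'e, 'g) xmod \<Rightarrow> bool"
  assumes obj: "is_obj X \<Longrightarrow> PE (xtop X) \<and> PG (xbase X)"
    and bd: "\<lbrakk>is_obj X; x \<in> carrier (xtop X)\<rbrakk> \<Longrightarrow> xbd X x \<in> carrier (xbase X)"
    and act: "\<lbrakk>is_obj X; a \<in> carrier (xbase X); x \<in> carrier (xtop X)\<rbrakk> \<Longrightarrow> xact X a x \<in> carrier (xtop X)"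
begin

lemma is_category: "is_category (xmod_cat is_obj homE homG)" (is "is_category ?C")
proof -
  have cl: "\<forall>x\<in>carrier (xtop X). f2 x \<in> carrier (xtop Y)" "\<forall>a\<in>carrier (xbase X). f1 a \<in> carrier (xbase Y)"
    if "is_obj X" "is_obj Y" "(f2, f1) \<in> Hom ?C X Y" for X Y f2 f1
    using that E.closed[of "xtop X" "xtop Y" f2] G.closed[of "xbase X" "xbase Y" f1] obj
    by (auto simp: xmod_cat_def)
  have "Cmp ?C X Y Z g f \<in> Hom ?C X Z"
    if X: "is_obj X" and Y: "is_obj Y" and Z: "is_obj Z" and f: "f \<in> Hom ?C X Y" and g: "g \<in> Hom ?C Y Z"
    for X Y Z f g
  proof -
    obtain f2 f1 g2 g1 where fg: "f = (f2, f1)" "g = (g2, g1)" by force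
    have "homE (xtop X) (xtop Z) (compose (carrier (xtop X)) g2 f2)"
      using f g fg X Y Z obj by (intro E.composite[of _ "xtop Y"]) (auto simp: xmod_cat_def)
    moreover have "homG (xbase X) (xbase Z) (compose (carrier (xbase X)) g1 f1)"
      using f g fg X Y Z obj by (intro G.composite[of _ "xbase Y"]) (auto simp: xmod_cat_def)
    ultimately show ?thesis
      using f g X Y cl[OF X Y f[unfolded fg]] unfolding fg
      by (simp add: xmod_cat_def compose_eq bd act)
  qed
  moreover have "Cmp ?C X X Y f (Idn ?C X) = f \<and> Cmp ?C X Y Y (Idn ?C Y) f = f"
    if "is_obj X" "is_obj Y" "f \<in> Hom ?C X Y" for X Y f
    using that cl[of X Y "fst f" "snd f"] by (auto simp: xmod_cat_def intro!: compose_identities)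
  moreover have "Cmp ?C W Y Z h (Cmp ?C W X Y g f) = Cmp ?C W X Z (Cmp ?C X Y Z h g) f"
    if "is_obj W" "is_obj X" "f \<in> Hom ?C W X" for W X Y Z f g h
    using that cl[of W X "fst f" "snd f"]
    by (cases f; cases g; cases h) (auto simp: xmod_cat_def intro!: compose_assoc_maps)
  moreover have "Idn ?C X \<in> Hom ?C X X" if "is_obj X" for X
    using that obj by (auto simp: xmod_cat_def E.identity G.identity bd act)
  moreover have "X \<in> Obj ?C \<longleftrightarrow> is_obj X" for X by (simp add: xmod_cat_def)
  ultimately show ?thesis unfolding is_category_def by (intro conjI ballI) simp_all
qed

end

locale x2mod_objects = L: structured_homs PL homL + E: structured_homs PE homE + G: structured_homs PG homG
  for PL :: "('l, 'x) partial_object_scheme \<Rightarrow> bool" and homL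
    and PE :: "('e, 'y) partial_object_scheme \<Rightarrow> bool" and homE
    and PG :: "('g, 'z) partial_object_scheme \<Rightarrow> bool" and homG +
  fixes is_obj :: "(('l, 'x) partial_object_scheme, ('e, 'y) partial_object_scheme,
    ('g, 'z) partial_object_scheme, 'l, 'e, 'g) x2mod \<Rightarrow> bool"
  assumes obj: "is_obj X \<Longrightarrow> PL (top2 X) \<and> PE (mid2 X) \<and> PG (base2 X)"
    and bd2: "\<lbrakk>is_obj X; k \<in> carrier (top2 X)\<rbrakk> \<Longrightarrow> bd2 X k \<in> carrier (mid2 X)"
    and bd1: "\<lbrakk>is_obj X; x \<in> carrier (mid2 X)\<rbrakk> \<Longrightarrow> bd1 X x \<in> carrier (base2 X)"
    and act_mid: "\<lbrakk>is_obj X; a \<in> carrier (base2 X); x \<in> carrier (mid2 X)\<rbrakk> \<Longrightarrow> act_mid X a x \<in> carrier (mid2 X)"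
    and act_top: "\<lbrakk>is_obj X; a \<in> carrier (base2 X); k \<in> carrier (top2 X)\<rbrakk> \<Longrightarrow> act_top X a k \<in> carrier (top2 X)"
    and plift: "\<lbrakk>is_obj X; x \<in> carrier (mid2 X); y \<in> carrier (mid2 X)\<rbrakk> \<Longrightarrow> plift X x y \<in> carrier (top2 X)"
begin

lemma is_category: "is_category (x2mod_cat is_obj homL homE homG)" (is "is_category ?C")
proof -
  have cl: "\<forall>k\<in>carrier (top2 X). f3 k \<in> carrier (top2 Y)" "\<forall>x\<in>carrier (mid2 X). f2 x \<in> carrier (mid2 Y)"
    "\<forall>a\<in>carrier (base2 X). f1 a \<in> carrier (base2 Y)"
    if "is_obj X" "is_obj Y" "(f3, f2, f1) \<in> Hom ?C X Y" for X Y f3 f2 f1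
    using that L.closed[of "top2 X" "top2 Y" f3] E.closed[of "mid2 X" "mid2 Y" f2]
      G.closed[of "base2 X" "base2 Y" f1] obj
    by (auto simp: x2mod_cat_def)
  have "Cmp ?C X Y Z g f \<in> Hom ?C X Z"
    if X: "is_obj X" and Y: "is_obj Y" and Z: "is_obj Z" and f: "f \<in> Hom ?C X Y" and g: "g \<in> Hom ?C Y Z"
    for X Y Z f g
  proof -
    obtain f3 f2 f1 g3 g2 g1 where fg: "f = (f3, f2, f1)" "g = (g3, g2, g1)" by (metis surj_pair)
    have "homL (top2 X) (top2 Z) (compose (carrier (top2 X)) g3 f3)"
      using f g fg X Y Z obj by (intro L.composite[of _ "top2 Y"]) (auto simp: x2mod_cat_def)
    moreover have "homE (mid2 X) (mid2 Z) (compose (carrier (mid2 X)) g2 f2)"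
      using f g fg X Y Z obj by (intro E.composite[of _ "mid2 Y"]) (auto simp: x2mod_cat_def)
    moreover have "homG (base2 X) (base2 Z) (compose (carrier (base2 X)) g1 f1)"
      using f g fg X Y Z obj by (intro G.composite[of _ "base2 Y"]) (auto simp: x2mod_cat_def)
    ultimately show ?thesis
      using f g X Y cl[OF X Y f[unfolded fg]] unfolding fg
      by (simp add: x2mod_cat_def compose_eq bd1 bd2 act_mid act_top plift)
  qed
  moreover have "Cmp ?C X X Y f (Idn ?C X) = f \<and> Cmp ?C X Y Y (Idn ?C Y) f = f"
    if "is_obj X" "is_obj Y" "f \<in> Hom ?C X Y" for X Y f
    using that cl[of X Y "fst f" "fst (snd f)" "snd (snd f)"]
    by (auto simp: x2mod_cat_def intro!: compose_identities)
  moreover have "Cmp ?C W Y Z h (Cmp ?C W X Y g f) = Cmp ?C W X Z (Cmp ?C X Y Z h g) f"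
    if "is_obj W" "is_obj X" "f \<in> Hom ?C W X" for W X Y Z f g h
    using that cl[of W X "fst f" "fst (snd f)" "snd (snd f)"]
    by (cases f; cases g; cases h) (auto simp: x2mod_cat_def intro!: compose_assoc_maps)
  moreover have "Idn ?C X \<in> Hom ?C X X" if "is_obj X" for X
    using that obj by (auto simp: x2mod_cat_def L.identity E.identity G.identity bd1 bd2 act_mid act_top plift)
  moreover have "X \<in> Obj ?C \<longleftrightarrow> is_obj X" for X by (simp add: x2mod_cat_def)
  ultimately show ?thesis unfolding is_category_def by (intro conjI ballI) simp_all
qed

end

text \<open>A construction that passes to structures on subsets of the carriers and restricts maps, as
  \<open>Prim\<close> and \<open>Gl\<close> do. It commutes with composition because maps send the subsets into one another.\<close>

locale restriction =
  S: structured_homs P h + T: structured_homs Q k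
  for P :: "('a, 'm) partial_object_scheme \<Rightarrow> bool" and h
    and Q :: "('a, 'n) partial_object_scheme \<Rightarrow> bool" and k +
  fixes R :: "('a, 'm) partial_object_scheme \<Rightarrow> ('a, 'n) partial_object_scheme"
  assumes structured: "P A \<Longrightarrow> Q (R A)"
    and subset: "P A \<Longrightarrow> carrier (R A) \<subseteq> carrier A"
    and hom: "\<lbrakk>P A; P B; h A B f\<rbrakk> \<Longrightarrow> k (R A) (R B) (restrict f (carrier (R A)))"
begin

lemma maps_to: "\<lbrakk>P A; P B; h A B f; x \<in> carrier (R A)\<rbrakk> \<Longrightarrow> f x \<in> carrier (R B)"
  using T.closed[OF structured structured hom, of A B f x] by simp

lemma carrier_Int: "P A \<Longrightarrow> carrier A \<inter> carrier (R A) = carrier (R A)"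
  using subset[of A] by blast

lemma restrict_compose:
  "\<lbrakk>P A; P B; h A B f\<rbrakk> \<Longrightarrow> restrict (compose (carrier A) g f) (carrier (R A))
     = compose (carrier (R A)) (restrict g (carrier (R B))) (restrict f (carrier (R A)))"
  using subset[of A] maps_to[of A B f] by (auto simp: compose_def restrict_def fun_eq_iff)

end

definition restrict_xmod where
  "restrict_xmod RE RG X = \<lparr>
     xtop = RE (xtop X),
     xbase = RG (xbase X),
     xbd = restrict (xbd X) (carrier (RE (xtop X))),
     xact = (\<lambda>a\<in>carrier (RG (xbase X)). restrict (xact X a) (carrier (RE (xtop X))))\<rparr>"

definition restrict_x2mod where
  "restrict_x2mod RL RE RG X = \<lparr>
     top2 = RL (top2 X),
     mid2 = RE (mid2 X),
     base2 = RG (base2 X),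
     bd2 = restrict (bd2 X) (carrier (RL (top2 X))),
     bd1 = restrict (bd1 X) (carrier (RE (mid2 X))),
     act_mid = (\<lambda>a\<in>carrier (RG (base2 X)). restrict (act_mid X a) (carrier (RE (mid2 X)))),
     act_top = (\<lambda>a\<in>carrier (RG (base2 X)). restrict (act_top X a) (carrier (RL (top2 X)))),
     plift = (\<lambda>x\<in>carrier (RE (mid2 X)). restrict (plift X x) (carrier (RE (mid2 X))))\<rparr>"

lemma is_functor_restrict_xmod:
  assumes E: "restriction PE homE QE homE' RE" and G: "restriction PG homG QG homG' RG"
    and C: "xmod_objects PE homE PG homG is_obj" and D: "xmod_objects QE homE' QG homG' is_obj'"
    and obj': "\<And>X. is_obj X \<Longrightarrow> is_obj' (restrict_xmod RE RG X)"
  shows "is_functor (xmod_cat is_obj homE homG) (xmod_cat is_obj' homE' homG')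
    \<lparr>fobj = restrict_xmod RE RG,
     farr = (\<lambda>X Y (f2, f1). (restrict f2 (carrier (RE (xtop X))), restrict f1 (carrier (RG (xbase X)))))\<rparr>"
  (is "is_functor ?C ?D ?F")
proof -
  interpret E: restriction PE homE QE homE' RE by fact
  interpret G: restriction PG homG QG homG' RG by fact
  interpret C: xmod_objects PE homE PG homG is_obj by fact
  interpret D: xmod_objects QE homE' QG homG' is_obj' by fact
  note obj = C.obj
  have bd: "xbd X x \<in> carrier (RG (xbase X))" if "is_obj X" "x \<in> carrier (RE (xtop X))" for X x
    using D.bd[OF obj'[OF that(1)]] that(2) by (simp add: restrict_xmod_def)
  have act: "xact X a x \<in> carrier (RE (xtop X))"
    if "is_obj X" "a \<in> carrier (RG (xbase X))" "x \<in> carrier (RE (xtop X))" for X a x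
    using D.act[OF obj'[OF that(1)]] that(2,3) by (simp add: restrict_xmod_def)
  have sub: "x \<in> carrier (RE (xtop X)) \<Longrightarrow> x \<in> carrier (xtop X)" "a \<in> carrier (RG (xbase X)) \<Longrightarrow> a \<in> carrier (xbase X)"
    if "is_obj X" for X x a
    using E.subset[of "xtop X"] G.subset[of "xbase X"] obj[OF that] by blast+
  have "farr ?F X Y f \<in> Hom ?D (fobj ?F X) (fobj ?F Y)"
    if X: "is_obj X" and Y: "is_obj Y" and f: "f \<in> Hom ?C X Y" for X Y f
  proof -
    obtain f2 f1 where f': "f = (f2, f1)" by force
    have h: "homE (xtop X) (xtop Y) f2" "homG (xbase X) (xbase Y) f1"
      using f unfolding f' by (simp_all add: xmod_cat_def)
    have "\<forall>x\<in>carrier (RE (xtop X)). f2 x \<in> carrier (RE (xtop Y))"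
      "\<forall>a\<in>carrier (RG (xbase X)). f1 a \<in> carrier (RG (xbase Y))"
      using E.maps_to[OF _ _ h(1)] G.maps_to[OF _ _ h(2)] obj[OF X] obj[OF Y] by auto
    moreover have "homE' (RE (xtop X)) (RE (xtop Y)) (restrict f2 (carrier (RE (xtop X))))"
      "homG' (RG (xbase X)) (RG (xbase Y)) (restrict f1 (carrier (RG (xbase X))))"
      using h obj[OF X] obj[OF Y] by (simp_all add: E.hom G.hom)
    ultimately show ?thesis
      using f unfolding f' by (simp add: xmod_cat_def restrict_xmod_def X bd act sub)
  qed
  moreover have "farr ?F X X (Idn ?C X) = Idn ?D (fobj ?F X)" if "is_obj X" for X
    using obj[OF that] by (simp add: xmod_cat_def restrict_xmod_def E.carrier_Int G.carrier_Int)
  moreover have "farr ?F X Z (Cmp ?C X Y Z g f)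
      = Cmp ?D (fobj ?F X) (fobj ?F Y) (fobj ?F Z) (farr ?F Y Z g) (farr ?F X Y f)"
    if "is_obj X" "is_obj Y" "f \<in> Hom ?C X Y" for X Y Z f g
    using that obj
    by (auto simp: xmod_cat_def restrict_xmod_def split: prod.splits
        intro!: E.restrict_compose G.restrict_compose)
  moreover have "X \<in> Obj ?C \<longleftrightarrow> is_obj X" "Y \<in> Obj ?D \<longleftrightarrow> is_obj' Y" for X Y
    by (simp_all add: xmod_cat_def)
  ultimately show ?thesis unfolding is_functor_def using C.is_category D.is_category obj' by simp
qed

lemma is_functor_restrict_x2mod:
  assumes L: "restriction PL homL QL homL' RL" and E: "restriction PE homE QE homE' RE"
    and G: "restriction PG homG QG homG' RG"
    and C: "x2mod_objects PL homL PE homE PG homG is_obj"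
    and D: "x2mod_objects QL homL' QE homE' QG homG' is_obj'"
    and obj': "\<And>X. is_obj X \<Longrightarrow> is_obj' (restrict_x2mod RL RE RG X)"
  shows "is_functor (x2mod_cat is_obj homL homE homG) (x2mod_cat is_obj' homL' homE' homG')
    \<lparr>fobj = restrict_x2mod RL RE RG,
     farr = (\<lambda>X Y (f3, f2, f1). (restrict f3 (carrier (RL (top2 X))),
       restrict f2 (carrier (RE (mid2 X))), restrict f1 (carrier (RG (base2 X)))))\<rparr>"
  (is "is_functor ?C ?D ?F")
proof -
  interpret L: restriction PL homL QL homL' RL by fact
  interpret E: restriction PE homE QE homE' RE by fact
  interpret G: restriction PG homG QG homG' RG by fact
  interpret C: x2mod_objects PL homL PE homE PG homG is_obj by fact
  interpret D: x2mod_objects QL homL' QE homE' QG homG' is_obj' by fact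
  note obj = C.obj
  have cl: "k \<in> carrier (RL (top2 X)) \<Longrightarrow> bd2 X k \<in> carrier (RE (mid2 X))"
    "x \<in> carrier (RE (mid2 X)) \<Longrightarrow> bd1 X x \<in> carrier (RG (base2 X))"
    "\<lbrakk>a \<in> carrier (RG (base2 X)); x \<in> carrier (RE (mid2 X))\<rbrakk> \<Longrightarrow> act_mid X a x \<in> carrier (RE (mid2 X))"
    "\<lbrakk>a \<in> carrier (RG (base2 X)); k \<in> carrier (RL (top2 X))\<rbrakk> \<Longrightarrow> act_top X a k \<in> carrier (RL (top2 X))"
    "\<lbrakk>x \<in> carrier (RE (mid2 X)); y \<in> carrier (RE (mid2 X))\<rbrakk> \<Longrightarrow> plift X x y \<in> carrier (RL (top2 X))"
    if "is_obj X" for X k x y a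
    using D.bd2[OF obj'[OF that], of k] D.bd1[OF obj'[OF that], of x] D.act_mid[OF obj'[OF that], of a x]
      D.act_top[OF obj'[OF that], of a k] D.plift[OF obj'[OF that], of x y]
    by (simp_all add: restrict_x2mod_def)
  have sub: "k \<in> carrier (RL (top2 X)) \<Longrightarrow> k \<in> carrier (top2 X)"
    "x \<in> carrier (RE (mid2 X)) \<Longrightarrow> x \<in> carrier (mid2 X)" "a \<in> carrier (RG (base2 X)) \<Longrightarrow> a \<in> carrier (base2 X)"
    if "is_obj X" for X k x a
    using L.subset[of "top2 X"] E.subset[of "mid2 X"] G.subset[of "base2 X"] obj[OF that] by blast+
  have "farr ?F X Y f \<in> Hom ?D (fobj ?F X) (fobj ?F Y)"
    if X: "is_obj X" and Y: "is_obj Y" and f: "f \<in> Hom ?C X Y" for X Y f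
  proof -
    obtain f3 f2 f1 where f': "f = (f3, f2, f1)" by (metis surj_pair)
    have h: "homL (top2 X) (top2 Y) f3" "homE (mid2 X) (mid2 Y) f2" "homG (base2 X) (base2 Y) f1"
      using f unfolding f' by (simp_all add: x2mod_cat_def)
    have "\<forall>k\<in>carrier (RL (top2 X)). f3 k \<in> carrier (RL (top2 Y))"
      "\<forall>x\<in>carrier (RE (mid2 X)). f2 x \<in> carrier (RE (mid2 Y))"
      "\<forall>a\<in>carrier (RG (base2 X)). f1 a \<in> carrier (RG (base2 Y))"
      using L.maps_to[OF _ _ h(1)] E.maps_to[OF _ _ h(2)] G.maps_to[OF _ _ h(3)] obj[OF X] obj[OF Y] by auto
    moreover have "homL' (RL (top2 X)) (RL (top2 Y)) (restrict f3 (carrier (RL (top2 X))))"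
      "homE' (RE (mid2 X)) (RE (mid2 Y)) (restrict f2 (carrier (RE (mid2 X))))"
      "homG' (RG (base2 X)) (RG (base2 Y)) (restrict f1 (carrier (RG (base2 X))))"
      using h obj[OF X] obj[OF Y] by (simp_all add: L.hom E.hom G.hom)
    ultimately show ?thesis
      using f unfolding f'
      by (simp add: x2mod_cat_def restrict_x2mod_def X cl sub)
  qed
  moreover have "farr ?F X X (Idn ?C X) = Idn ?D (fobj ?F X)" if "is_obj X" for X
    using obj[OF that]
    by (simp add: x2mod_cat_def restrict_x2mod_def L.carrier_Int E.carrier_Int G.carrier_Int)
  moreover have "farr ?F X Z (Cmp ?C X Y Z g f)
      = Cmp ?D (fobj ?F X) (fobj ?F Y) (fobj ?F Z) (farr ?F Y Z g) (farr ?F X Y f)"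
    if "is_obj X" "is_obj Y" "f \<in> Hom ?C X Y" for X Y Z f g
    using that obj
    by (auto simp: x2mod_cat_def restrict_x2mod_def split: prod.splits
        intro!: L.restrict_compose E.restrict_compose G.restrict_compose)
  moreover have "X \<in> Obj ?C \<longleftrightarrow> is_obj X" "Y \<in> Obj ?D \<longleftrightarrow> is_obj' Y" for X Y
    by (simp_all add: x2mod_cat_def)
  ultimately show ?thesis unfolding is_functor_def using C.is_category D.is_category obj' by simp
qed


section \<open>The functors Prim and Gl\<close>

lemma structured_homs_hopf: "structured_homs (cocomm_hopf_algebra \<kappa>) (hopf_hom \<kappa>)"
proof
  fix A :: "('b, 'a) hopf" assume A: "cocomm_hopf_algebra \<kappa> A"
  interpret A: cocomm_hopf_algebra \<kappa> A by fact
  have lin: "linear_map \<kappa> A A (\<lambda>x\<in>carrier A. x)" by (rule linear_mapI) simp_all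
  moreover have "comult A x = sweedler \<kappa> A (tensor \<kappa> A A) x
      (\<lambda>x1 x2. tens \<kappa> A A ((\<lambda>x\<in>carrier A. x) x1) ((\<lambda>x\<in>carrier A. x) x2))" if "x \<in> carrier A" for x
    unfolding A.sweedler_tens[OF that, symmetric]
    using that by (intro A.sweedler_cong) (simp_all add: tens_bilinear)
  ultimately show "hopf_hom \<kappa> A A (\<lambda>x\<in>carrier A. x)"
    by (simp add: hopf_hom_def)
next
  fix A B C :: "('b, 'a) hopf" and f g
  assume A: "cocomm_hopf_algebra \<kappa> A" and B: "cocomm_hopf_algebra \<kappa> B" and C: "cocomm_hopf_algebra \<kappa> C"
    and f: "hopf_hom \<kappa> A B f" and g: "hopf_hom \<kappa> B C g"
  interpret A: cocomm_hopf_algebra \<kappa> A by fact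
  interpret B: cocomm_hopf_algebra \<kappa> B by fact
  interpret C: cocomm_hopf_algebra \<kappa> C by fact
  note lf = hopf_homD(1)[OF f] and lg = hopf_homD(1)[OF g]
  have "linear_map \<kappa> A C (compose (carrier A) g f)"
    by (rule linear_mapI) (simp_all add: compose_eq linear_mapD[OF lf] linear_mapD[OF lg])
  moreover have "comult C (g (f x)) = sweedler \<kappa> A (tensor \<kappa> C C) x
      (\<lambda>x1 x2. tens \<kappa> C C (compose (carrier A) g f x1) (compose (carrier A) g f x2))"
    if x: "x \<in> carrier A" for x
  proof -
    have "comult C (g (f x)) = sweedler \<kappa> B (tensor \<kappa> C C) (f x) (\<lambda>x1 x2. tens \<kappa> C C (g x1) (g x2))"
      using g x by (simp add: hopf_hom_def linear_mapD[OF lf])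
    also have "\<dots> = sweedler \<kappa> A (tensor \<kappa> C C) x (\<lambda>x1 x2. tens \<kappa> C C (g (f x1)) (g (f x2)))"
      using x by (intro sweedler_hopf_hom A B f) (simp_all add: bilinear_mapI lg linear_mapD[OF lg])
    also have "\<dots> = sweedler \<kappa> A (tensor \<kappa> C C) x
        (\<lambda>x1 x2. tens \<kappa> C C (compose (carrier A) g f x1) (compose (carrier A) g f x2))"
      using x by (intro A.sweedler_cong)
        (simp_all add: bilinear_mapI lf linear_map_comp[OF lg lf] linear_mapD[OF lf] linear_mapD[OF lg] compose_eq)
    finally show ?thesis .
  qed
  ultimately show "hopf_hom \<kappa> A C (compose (carrier A) g f)"
    by (simp add: hopf_hom_def compose_eq hopf_homD[OF f] hopf_homD[OF g] linear_mapD[OF lf] linear_mapD[OF lg])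
next
  fix A B :: "('b, 'a) hopf" and f x
  assume "hopf_hom \<kappa> A B f" "x \<in> carrier A"
  then show "f x \<in> carrier B" by (simp add: linear_mapD(1)[OF hopf_homD(1)])
qed

lemma structured_homs_lie: "structured_homs (lie_algebra \<kappa>) (lie_hom \<kappa>)"
proof
  fix A :: "('b, 'a) lie" assume A: "lie_algebra \<kappa> A"
  interpret A: lie_algebra \<kappa> A by fact
  show "lie_hom \<kappa> A A (\<lambda>x\<in>carrier A. x)"
    by (auto simp: lie_hom_def linear_map_def bilinear_map_simps[OF A.bracket_bilinear])
next
  fix A B C :: "('b, 'a) lie" and f g
  assume A: "lie_algebra \<kappa> A" and f: "lie_hom \<kappa> A B f" and g: "lie_hom \<kappa> B C g"
  interpret A: lie_algebra \<kappa> A by fact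
  show "lie_hom \<kappa> A C (compose (carrier A) g f)"
    using f g
    by (auto simp: lie_hom_def linear_map_def compose_eq bilinear_map_simps[OF A.bracket_bilinear] Pi_iff)
qed (auto simp: lie_hom_def linear_map_def)

lemma structured_homs_grp:
  "structured_homs (group :: ('a, 'm) monoid_scheme \<Rightarrow> bool) (\<lambda>A B f. f \<in> hom A B)"
proof
  fix A :: "('a, 'm) monoid_scheme" assume "group A"
  then interpret group A .
  show "(\<lambda>x\<in>carrier A. x) \<in> hom A A" by (auto simp: hom_def)
next
  fix A B C :: "('a, 'm) monoid_scheme" and f g
  assume "group A" and f: "f \<in> hom A B" "g \<in> hom B C"
  interpret group A by fact
  show "compose (carrier A) g f \<in> hom A C" using f by (auto simp: hom_def compose_eq Pi_iff)
qed (auto simp: hom_def)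

lemma restriction_prim_lie:
  "restriction (cocomm_hopf_algebra \<kappa>) (hopf_hom \<kappa>) (lie_algebra \<kappa>) (lie_hom \<kappa>) (prim_lie \<kappa>)"
proof (intro restriction.intro restriction_axioms.intro structured_homs_hopf structured_homs_lie)
  fix A B :: "('b, 'a) hopf" and f
  assume A: "cocomm_hopf_algebra \<kappa> A"
  show "lie_algebra \<kappa> (prim_lie \<kappa> A)" using A by (rule cocomm_hopf_algebra.lie_algebra_prim_lie)
  show "carrier (prim_lie \<kappa> A) \<subseteq> carrier A" by (auto simp: Prim_def)
  show "lie_hom \<kappa> (prim_lie \<kappa> A) (prim_lie \<kappa> B) (restrict f (carrier (prim_lie \<kappa> A)))"
    if "cocomm_hopf_algebra \<kappa> B" "hopf_hom \<kappa> A B f"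
    using lie_hom_restrict_Prim[OF A that] by simp
qed

lemma restriction_gl_grp:
  "restriction (cocomm_hopf_algebra \<kappa>) (hopf_hom \<kappa>) group (\<lambda>A B f. f \<in> hom A B) (gl_grp \<kappa>)"
proof (intro restriction.intro restriction_axioms.intro structured_homs_hopf structured_homs_grp)
  fix A B :: "('b, 'a) hopf" and f
  assume A: "cocomm_hopf_algebra \<kappa> A"
  show "group (gl_grp \<kappa> A)" using A by (rule cocomm_hopf_algebra.group_gl_grp)
  show "carrier (gl_grp \<kappa> A) \<subseteq> carrier A" by (auto simp: Gl_def)
  show "restrict f (carrier (gl_grp \<kappa> A)) \<in> hom (gl_grp \<kappa> A) (gl_grp \<kappa> B)"
    if "cocomm_hopf_algebra \<kappa> B" "hopf_hom \<kappa> A B f"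
    using hom_restrict_Gl[OF A that] by simp
qed

lemma lie_hom_closed: "\<lbrakk>lie_hom \<kappa> A B f; x \<in> carrier A\<rbrakk> \<Longrightarrow> f x \<in> carrier B"
  by (auto simp: lie_hom_def linear_map_def)

lemma lie_action_closed: "\<lbrakk>lie_action \<kappa> G E act; g \<in> carrier G; e \<in> carrier E\<rbrakk> \<Longrightarrow> act g e \<in> carrier E"
  by (rule bilinear_map_simps(1)[OF lie_action.act_bilinear])

lemma grp_action_closed:
  assumes "grp_action G E act" "g \<in> carrier G" "e \<in> carrier E"
  shows "act g e \<in> carrier E"
proof -
  have "restrict (act g) (carrier E) \<in> carrier (AutoGroup E)"
    using hom_in_carrier[OF grp_action.action_hom[OF assms(1)] assms(2)] by simp
  then have "restrict (act g) (carrier E) \<in> carrier E \<rightarrow> carrier E"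
    by (auto simp: AutoGroup_def auto_def hom_def)
  from funcset_mem[OF this assms(3)] show ?thesis using assms(3) by simp
qed

lemma grp_action_one:
  assumes "grp_action G E act" "group E" "g \<in> carrier G"
  shows "act g \<one>\<^bsub>E\<^esub> = \<one>\<^bsub>E\<^esub>"
proof -
  interpret E: group E by fact
  have "restrict (act g) (carrier E) \<in> carrier (AutoGroup E)"
    using hom_in_carrier[OF grp_action.action_hom[OF assms(1)] assms(3)] by simp
  then have "restrict (act g) (carrier E) \<in> hom E E"
    by (auto simp: AutoGroup_def auto_def)
  from hom_one[OF this] show ?thesis using assms by simp
qed

context hopf_xmod
begin

lemma closed:
  "x \<in> carrier I \<Longrightarrow> \<partial> x \<in> carrier H" "\<lbrakk>a \<in> carrier H; x \<in> carrier I\<rbrakk> \<Longrightarrow> a \<rhd> x \<in> carrier I"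
  using linear_mapD(1)[OF hopf_homD(1)[OF hom_d]] bilinear_map_simps(1)[OF module_bialgebra.act_bilinear[OF act]]
  by simp_all

end

lemma xmod_objects_Hopf: "xmod_objects (cocomm_hopf_algebra \<kappa>) (hopf_hom \<kappa>) (cocomm_hopf_algebra \<kappa>) (hopf_hom \<kappa>)
    (\<lambda>X. hopf_xmod \<kappa> (xtop X) (xbase X) (xbd X) (xact X))"
  by (intro xmod_objects.intro structured_homs_hopf xmod_objects_axioms.intro)
    (simp_all add: hopf_xmod.hopf_I hopf_xmod.hopf_H hopf_xmod.closed)

lemma xmod_objects_Lie: "xmod_objects (lie_algebra \<kappa>) (lie_hom \<kappa>) (lie_algebra \<kappa>) (lie_hom \<kappa>)
    (\<lambda>X. lie_xmod \<kappa> (xtop X) (xbase X) (xbd X) (xact X))"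
  by (intro xmod_objects.intro structured_homs_lie xmod_objects_axioms.intro)
    (simp_all add: lie_xmod.lie_E lie_xmod.lie_G lie_hom_closed[OF lie_xmod.hom_d] lie_action_closed[OF lie_xmod.act])

lemma xmod_objects_Grp: "xmod_objects group (\<lambda>A B f. f \<in> hom A B) group (\<lambda>A B f. f \<in> hom A B)
    (\<lambda>X. grp_xmod (xtop X) (xbase X) (xbd X) (xact X))"
  by (intro xmod_objects.intro structured_homs_grp xmod_objects_axioms.intro)
    (simp_all add: grp_xmod.group_E grp_xmod.group_G hom_in_carrier[OF grp_xmod.hom_d]
      grp_action_closed[OF grp_xmod.act])

lemma x2mod_objects_Hopf: "x2mod_objects (cocomm_hopf_algebra \<kappa>) (hopf_hom \<kappa>) (cocomm_hopf_algebra \<kappa>) (hopf_hom \<kappa>)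
    (cocomm_hopf_algebra \<kappa>) (hopf_hom \<kappa>)
    (\<lambda>X. hopf_x2mod \<kappa> (top2 X) (mid2 X) (base2 X) (bd2 X) (bd1 X) (act_mid X) (act_top X) (plift X))"
  by (intro x2mod_objects.intro structured_homs_hopf x2mod_objects_axioms.intro)
    (simp_all add: hopf_x2mod.hopf_K hopf_x2mod.hopf_I hopf_x2mod.hopf_H hopf_x2mod.boundary_simps(1,2)
      bilinear_map_simps(1)[OF module_bialgebra.act_bilinear[OF hopf_x2mod.actI]]
      bilinear_map_simps(1)[OF module_bialgebra.act_bilinear[OF hopf_x2mod.actK]]
      bilinear_map_simps(1)[OF hopf_x2mod.lift_bilinear])

lemma x2mod_objects_Lie: "x2mod_objects (lie_algebra \<kappa>) (lie_hom \<kappa>) (lie_algebra \<kappa>) (lie_hom \<kappa>)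
    (lie_algebra \<kappa>) (lie_hom \<kappa>)
    (\<lambda>X. lie_x2mod \<kappa> (top2 X) (mid2 X) (base2 X) (bd2 X) (bd1 X) (act_mid X) (act_top X) (plift X))"
  by (intro x2mod_objects.intro structured_homs_lie x2mod_objects_axioms.intro)
    (simp_all add: lie_x2mod.lie_L lie_x2mod.lie_E lie_x2mod.lie_G
      lie_hom_closed[OF lie_x2mod.hom_d2] lie_hom_closed[OF lie_x2mod.hom_d1]
      lie_action_closed[OF lie_x2mod.actE] lie_action_closed[OF lie_x2mod.actL]
      bilinear_map_simps(1)[OF lie_x2mod.lift_bilinear])

lemma x2mod_objects_Grp: "x2mod_objects group (\<lambda>A B f. f \<in> hom A B) group (\<lambda>A B f. f \<in> hom A B)
    group (\<lambda>A B f. f \<in> hom A B)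
    (\<lambda>X. grp_x2mod (top2 X) (mid2 X) (base2 X) (bd2 X) (bd1 X) (act_mid X) (act_top X) (plift X))"
  by (intro x2mod_objects.intro structured_homs_grp x2mod_objects_axioms.intro)
    (simp_all add: grp_x2mod.group_L grp_x2mod.group_E grp_x2mod.group_G
      hom_in_carrier[OF grp_x2mod.hom_d2] hom_in_carrier[OF grp_x2mod.hom_d1]
      grp_action_closed[OF grp_x2mod.actE] grp_action_closed[OF grp_x2mod.actL]
      funcset_mem[OF funcset_mem[OF grp_x2mod.lift_closed]])

lemma Prim_X_eq: "Prim_X \<kappa> = \<lparr>fobj = restrict_xmod (prim_lie \<kappa>) (prim_lie \<kappa>),
     farr = (\<lambda>X Y (f2, f1). (restrict f2 (carrier (prim_lie \<kappa> (xtop X))), restrict f1 (carrier (prim_lie \<kappa> (xbase X)))))\<rparr>"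
  by (auto simp: Prim_X_def restrict_xmod_def Let_def fun_eq_iff)

lemma Gl_X_eq: "Gl_X \<kappa> = \<lparr>fobj = restrict_xmod (gl_grp \<kappa>) (gl_grp \<kappa>),
     farr = (\<lambda>X Y (f2, f1). (restrict f2 (carrier (gl_grp \<kappa> (xtop X))), restrict f1 (carrier (gl_grp \<kappa> (xbase X)))))\<rparr>"
  by (auto simp: Gl_X_def restrict_xmod_def Let_def fun_eq_iff)

lemma Prim_X2_eq: "Prim_X2 \<kappa> = \<lparr>fobj = restrict_x2mod (prim_lie \<kappa>) (prim_lie \<kappa>) (prim_lie \<kappa>),
     farr = (\<lambda>X Y (f3, f2, f1). (restrict f3 (carrier (prim_lie \<kappa> (top2 X))),
       restrict f2 (carrier (prim_lie \<kappa> (mid2 X))), restrict f1 (carrier (prim_lie \<kappa> (base2 X)))))\<rparr>"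
  by (auto simp: Prim_X2_def restrict_x2mod_def Let_def fun_eq_iff)

lemma Gl_X2_eq: "Gl_X2 \<kappa> = \<lparr>fobj = restrict_x2mod (gl_grp \<kappa>) (gl_grp \<kappa>) (gl_grp \<kappa>),
     farr = (\<lambda>X Y (f3, f2, f1). (restrict f3 (carrier (gl_grp \<kappa> (top2 X))),
       restrict f2 (carrier (gl_grp \<kappa> (mid2 X))), restrict f1 (carrier (gl_grp \<kappa> (base2 X)))))\<rparr>"
  by (auto simp: Gl_X2_def restrict_x2mod_def Let_def fun_eq_iff)

lemma is_functor_Prim_X:
  fixes \<kappa> :: "'k ring"
  shows "is_functor (XHopf \<kappa> :: (('k, 'e, 'g) xhopf, ('e, 'g) mor2) cat) (XLie \<kappa>) (Prim_X \<kappa>)"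
  unfolding Prim_X_eq XHopf_def XLie_def
  by (rule is_functor_restrict_xmod[OF restriction_prim_lie restriction_prim_lie xmod_objects_Hopf xmod_objects_Lie])
    (simp add: restrict_xmod_def hopf_xmod.lie_xmod_Prim)

lemma is_functor_Gl_X:
  fixes \<kappa> :: "'k ring"
  shows "is_functor (XHopf \<kappa> :: (('k, 'e, 'g) xhopf, ('e, 'g) mor2) cat) XGrp (Gl_X \<kappa>)"
  unfolding Gl_X_eq XHopf_def XGrp_def
  by (rule is_functor_restrict_xmod[OF restriction_gl_grp restriction_gl_grp xmod_objects_Hopf xmod_objects_Grp])
    (simp add: restrict_xmod_def hopf_xmod.grp_xmod_Gl)

lemma is_functor_Prim_X2:
  fixes \<kappa> :: "'k ring"
  shows "is_functor (X2Hopf \<kappa> :: (('k, 'l, 'e, 'g) x2hopf, ('l, 'e, 'g) mor3) cat) (X2Lie \<kappa>) (Prim_X2 \<kappa>)"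
  unfolding Prim_X2_eq X2Hopf_def X2Lie_def
  by (rule is_functor_restrict_x2mod[OF restriction_prim_lie restriction_prim_lie restriction_prim_lie
        x2mod_objects_Hopf x2mod_objects_Lie])
    (simp add: restrict_x2mod_def hopf_x2mod.lie_x2mod_Prim)

lemma is_functor_Gl_X2:
  fixes \<kappa> :: "'k ring"
  shows "is_functor (X2Hopf \<kappa> :: (('k, 'l, 'e, 'g) x2hopf, ('l, 'e, 'g) mor3) cat) X2Grp (Gl_X2 \<kappa>)"
  unfolding Gl_X2_eq X2Hopf_def X2Grp_def
  by (rule is_functor_restrict_x2mod[OF restriction_gl_grp restriction_gl_grp restriction_gl_grp
        x2mod_objects_Hopf x2mod_objects_Grp])
    (simp add: restrict_x2mod_def hopf_x2mod.grp_x2mod_Gl)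


section \<open>The zero Hopf algebra\<close>

lemma hopf_zero_simps [simp]:
  "carrier (hopf_zero \<kappa>) = carrier \<kappa>" "mult (hopf_zero \<kappa>) = mult \<kappa>" "one (hopf_zero \<kappa>) = one \<kappa>"
  "zero (hopf_zero \<kappa>) = zero \<kappa>" "add (hopf_zero \<kappa>) = add \<kappa>" "smult (hopf_zero \<kappa>) = mult \<kappa>"
  "counit (hopf_zero \<kappa>) r = r" "antipode (hopf_zero \<kappa>) r = r"
  by (simp_all add: hopf_zero_def Let_def)

lemma antipode_hopf_zero: "antipode (hopf_zero \<kappa>) = (\<lambda>r. r)"
  by (simp add: hopf_zero_def Let_def)

text \<open>Stated with \<open>carrier \<kappa>\<close>, into which the simplifier rewrites the carrier of the zero object.\<close>

lemma bilinear_map_hopf_zeroI: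
  assumes "\<And>r. r \<in> carrier \<kappa> \<Longrightarrow> linear_map \<kappa> (hopf_zero \<kappa>) V (\<lambda>s. f r s)"
    and "\<And>s. s \<in> carrier \<kappa> \<Longrightarrow> linear_map \<kappa> (hopf_zero \<kappa>) V (\<lambda>r. f r s)"
  shows "bilinear_map \<kappa> (hopf_zero \<kappa>) (hopf_zero \<kappa>) V f"
  using assms by (intro bilinear_mapI) simp_all

text \<open>The coproduct is defined through the underlying module, as \<open>hopf_zero\<close> cannot refer to itself. A tensor
  product depends only on the module operations, so the two readings agree.\<close>

lemma comult_hopf_zero:
  "comult (hopf_zero \<kappa>) r = tens \<kappa> (hopf_zero \<kappa>) (hopf_zero \<kappa>) r \<one>\<^bsub>\<kappa>\<^esub>"
  by (simp add: hopf_zero_def Let_def tens_def tensor_kernel_def tensor_relations_def)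

context
  fixes \<kappa> :: "'k ring"
  assumes cring: "cring \<kappa>"
begin

interpretation R: cring \<kappa> by (rule cring)

lemma module_hopf_zero [simp]: "module \<kappa> (hopf_zero \<kappa>)"
proof -
  have "abelian_group (hopf_zero \<kappa>)"
    by (rule abelian_groupI) (auto simp: R.a_ac intro: R.l_neg)
  then show ?thesis
    by (intro moduleI cring) (simp_all add: R.l_distr R.r_distr R.m_assoc)
qed

lemma ring_hopf_zero: "ring (hopf_zero \<kappa>)"
proof (intro ringI)
  show "abelian_group (hopf_zero \<kappa>)" by (rule module.axioms(2)[OF module_hopf_zero])
  show "monoid (hopf_zero \<kappa>)" by (rule monoidI) (simp_all add: R.m_assoc)
qed (simp_all add: R.l_distr R.r_distr)

lemma tens_hopf_zero:
  assumes "r \<in> carrier \<kappa>" "s \<in> carrier \<kappa>"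
  shows "tens \<kappa> (hopf_zero \<kappa>) (hopf_zero \<kappa>) r s
    = (r \<otimes>\<^bsub>\<kappa>\<^esub> s) \<odot>\<^bsub>tensor \<kappa> (hopf_zero \<kappa>) (hopf_zero \<kappa>)\<^esub> tens \<kappa> (hopf_zero \<kappa>) (hopf_zero \<kappa>) \<one>\<^bsub>\<kappa>\<^esub> \<one>\<^bsub>\<kappa>\<^esub>"
proof -
  interpret T: module \<kappa> "tensor \<kappa> (hopf_zero \<kappa>) (hopf_zero \<kappa>)" by (intro module_tensor module_hopf_zero)
  note b = bilinear_map_simps[OF tens_bilinear[OF module_hopf_zero module_hopf_zero]]
  show ?thesis
    using b(4)[of r "\<one>\<^bsub>\<kappa>\<^esub>" s] b(5)[of s "\<one>\<^bsub>\<kappa>\<^esub>" "\<one>\<^bsub>\<kappa>\<^esub>"] b(1)[of "\<one>\<^bsub>\<kappa>\<^esub>" "\<one>\<^bsub>\<kappa>\<^esub>"] assms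
    by (simp add: T.smult_assoc1)
qed

lemma sweedler_hopf_zero:
  assumes "module \<kappa> V" "bilinear_map \<kappa> (hopf_zero \<kappa>) (hopf_zero \<kappa>) V f" "r \<in> carrier \<kappa>"
  shows "sweedler \<kappa> (hopf_zero \<kappa>) V r f = f r \<one>\<^bsub>\<kappa>\<^esub>"
  using assms by (simp add: sweedler_def comult_hopf_zero tensor_lift_tens)

text \<open>For summands that are recognizably bilinear only after simplification at carrier elements, such as those
  that are Sweedler sums themselves.\<close>

lemma sweedler_hopf_zero_cong:
  assumes V: "module \<kappa> V" and g: "bilinear_map \<kappa> (hopf_zero \<kappa>) (hopf_zero \<kappa>) V g" and r: "r \<in> carrier \<kappa>"
    and eq: "\<And>s t. \<lbrakk>s \<in> carrier \<kappa>; t \<in> carrier \<kappa>\<rbrakk> \<Longrightarrow> f s t = g s t"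
  shows "sweedler \<kappa> (hopf_zero \<kappa>) V r f = g r \<one>\<^bsub>\<kappa>\<^esub>"
proof -
  have "bilinear_map \<kappa> (hopf_zero \<kappa>) (hopf_zero \<kappa>) V f"
    using g bilinear_map_cong[OF module_hopf_zero module_hopf_zero, of f g V] eq by simp
  then show ?thesis using V r eq by (simp add: sweedler_hopf_zero)
qed

lemma mult_linear_hopf_zero:
  assumes "linear_map \<kappa> A (hopf_zero \<kappa>) f" "c \<in> carrier \<kappa>"
  shows "linear_map \<kappa> A (hopf_zero \<kappa>) (\<lambda>x. f x \<otimes>\<^bsub>\<kappa>\<^esub> c)" "linear_map \<kappa> A (hopf_zero \<kappa>) (\<lambda>x. c \<otimes>\<^bsub>\<kappa>\<^esub> f x)"
  using assms unfolding linear_map_def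
  by (simp_all add: Pi_iff R.l_distr R.r_distr R.m_assoc R.m_lcomm)

lemma cocomm_hopf_algebra_hopf_zero: "cocomm_hopf_algebra \<kappa> (hopf_zero \<kappa>)"
proof -
  let ?Z = "hopf_zero \<kappa>"
  note T = module_tensor[OF module_hopf_zero module_hopf_zero]
  note TT = module_tensor[OF module_hopf_zero T]
  note tens = tens_simps[OF module_hopf_zero module_hopf_zero] tens_simps[OF module_hopf_zero T]
  note tens' = tens[simplified]
  note simps = sweedler_hopf_zero T TT bilinear_map_hopf_zeroI linear_map_id tens' mult_linear_hopf_zero
  show ?thesis
  proof (intro cocomm_hopf_algebra.intro module_hopf_zero ring_hopf_zero cocomm_hopf_algebra_axioms.intro)
    show "linear_map \<kappa> ?Z (tensor \<kappa> ?Z ?Z) (comult ?Z)"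
      unfolding comult_hopf_zero[abs_def] by (simp add: tens' linear_map_id)
  next
    let ?V = "tensor \<kappa> ?Z (tensor \<kappa> ?Z ?Z)" and ?t = "tens \<kappa> ?Z (tensor \<kappa> ?Z ?Z)"
    fix x assume x: "x \<in> carrier ?Z"
    have "sweedler \<kappa> ?Z ?V x (\<lambda>x1 x2. sweedler \<kappa> ?Z ?V x1 (\<lambda>x11 x12. ?t x11 (tens \<kappa> ?Z ?Z x12 x2)))
        = ?t x (tens \<kappa> ?Z ?Z \<one>\<^bsub>\<kappa>\<^esub> \<one>\<^bsub>\<kappa>\<^esub>)"
      using x by (intro sweedler_hopf_zero_cong[where g = "\<lambda>x1 x2. ?t x1 (tens \<kappa> ?Z ?Z \<one>\<^bsub>\<kappa>\<^esub> x2)"] TT)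
        (simp_all add: simps)
    then show "sweedler \<kappa> ?Z ?V x (\<lambda>x1 x2. sweedler \<kappa> ?Z ?V x1 (\<lambda>x11 x12. ?t x11 (tens \<kappa> ?Z ?Z x12 x2)))
        = sweedler \<kappa> ?Z ?V x (\<lambda>x1 x2. ?t x1 (comult ?Z x2))"
      using x by (simp add: simps comult_hopf_zero)
  next
    let ?V = "tensor \<kappa> ?Z ?Z" and ?t = "tens \<kappa> ?Z ?Z"
    fix x y assume xy: "x \<in> carrier ?Z" "y \<in> carrier ?Z"
    have "sweedler \<kappa> ?Z ?V x (\<lambda>x1 x2. sweedler \<kappa> ?Z ?V y (\<lambda>y1 y2. ?t (x1 \<otimes>\<^bsub>?Z\<^esub> y1) (x2 \<otimes>\<^bsub>?Z\<^esub> y2)))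
        = ?t (x \<otimes>\<^bsub>\<kappa>\<^esub> y) \<one>\<^bsub>\<kappa>\<^esub>"
      using xy by (intro sweedler_hopf_zero_cong[where g = "\<lambda>x1 x2. ?t (x1 \<otimes>\<^bsub>\<kappa>\<^esub> y) x2"] T)
        (simp_all add: simps)
    then show "comult ?Z (x \<otimes>\<^bsub>?Z\<^esub> y)
        = sweedler \<kappa> ?Z ?V x (\<lambda>x1 x2. sweedler \<kappa> ?Z ?V y (\<lambda>y1 y2. ?t (x1 \<otimes>\<^bsub>?Z\<^esub> y1) (x2 \<otimes>\<^bsub>?Z\<^esub> y2)))"
      by (simp add: comult_hopf_zero)
  next
    fix r assume r: "r \<in> carrier ?Z"
    then have comm: "tens \<kappa> ?Z ?Z \<one>\<^bsub>\<kappa>\<^esub> r = tens \<kappa> ?Z ?Z r \<one>\<^bsub>\<kappa>\<^esub>"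
      by (subst (1 2) tens_hopf_zero) (simp_all add: R.m_comm)
    have "sweedler \<kappa> ?Z (tensor \<kappa> ?Z ?Z) r (\<lambda>x1 x2. tens \<kappa> ?Z ?Z x2 x1) = tens \<kappa> ?Z ?Z \<one>\<^bsub>\<kappa>\<^esub> r"
      using r by (intro sweedler_hopf_zero T bilinear_mapI tens' linear_map_id) simp_all
    then show "sweedler \<kappa> ?Z (tensor \<kappa> ?Z ?Z) r (\<lambda>x1 x2. tens \<kappa> ?Z ?Z x2 x1) = comult ?Z r"
      by (simp only: comm comult_hopf_zero)
  qed (simp_all add: R.m_assoc R.m_lcomm R.l_distr R.r_distr simps comult_hopf_zero antipode_hopf_zero)
qed

end

text \<open>The sum \<open>\<Sum> \<epsilon>(x') \<epsilon>(x'')\<close> is \<open>\<epsilon>(x)\<close>. Bilinearity of \<open>f\<close> is a consequence of the product form; this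
  evaluates the sums for the lifting \<open>\<epsilon>(x) \<epsilon>(y)\<close> from the inside out.\<close>

lemma (in cocomm_hopf_algebra) sweedler_counit_scalar:
  assumes V: "module \<kappa> V" and v: "v \<in> carrier V" and x: "x \<in> carrier H"
    and f: "\<And>x1 x2. \<lbrakk>x1 \<in> carrier H; x2 \<in> carrier H\<rbrakk> \<Longrightarrow>
      f x1 x2 = (counit H x1 \<otimes>\<^bsub>\<kappa>\<^esub> counit H x2) \<odot>\<^bsub>V\<^esub> v"
  shows "sweedler \<kappa> H V x f = counit H x \<odot>\<^bsub>V\<^esub> v"
proof -
  interpret V: module \<kappa> V by fact
  have lin: "linear_map \<kappa> H V (\<lambda>x. counit H x \<odot>\<^bsub>V\<^esub> v)"
    using V v by (simp add: linear_map_id)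
  have "sweedler \<kappa> H V x (\<lambda>x1 x2. counit H x1 \<odot>\<^bsub>V\<^esub> (counit H x2 \<odot>\<^bsub>V\<^esub> v)) = sweedler \<kappa> H V x f"
    using V v x by (intro sweedler_cong)
      (simp_all add: bilinear_mapI linear_map_id f V.smult_assoc1 linear_map_smult)
  then show ?thesis using sweedler_counit_left[OF V lin x] by simp
qed

lemma (in cocomm_hopf_algebra) sweedler_counit_mult:
  assumes c: "c \<in> carrier \<kappa>" and x: "x \<in> carrier H"
    and f: "\<And>x1 x2. \<lbrakk>x1 \<in> carrier H; x2 \<in> carrier H\<rbrakk> \<Longrightarrow>
      f x1 x2 = (counit H x1 \<otimes>\<^bsub>\<kappa>\<^esub> counit H x2) \<otimes>\<^bsub>\<kappa>\<^esub> c"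
  shows "sweedler \<kappa> H (hopf_zero \<kappa>) x f = counit H x \<otimes>\<^bsub>\<kappa>\<^esub> c"
  using sweedler_counit_scalar[of "hopf_zero \<kappa>" c x f] assms module_hopf_zero[OF R.cring_axioms] by simp

text \<open>The trivial action on \<open>\<kappa>\<close>. It is given by an equation on the carriers, so that actions merely agreeing
  with it there, such as the one induced by the lifting \<open>\<epsilon>(x) \<epsilon>(y)\<close>, are instances.\<close>

lemma module_bialgebra_trivial:
  assumes H: "cocomm_hopf_algebra \<kappa> H"
    and act: "\<And>a r. \<lbrakk>a \<in> carrier H; r \<in> carrier \<kappa>\<rbrakk> \<Longrightarrow> act a r = counit H a \<otimes>\<^bsub>\<kappa>\<^esub> r"
  shows "module_bialgebra \<kappa> H (hopf_zero \<kappa>) act"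
proof -
  interpret H: cocomm_hopf_algebra \<kappa> H by fact
  note cring = H.R.cring_axioms
  let ?Z = "hopf_zero \<kappa>" and ?T = "tensor \<kappa> (hopf_zero \<kappa>) (hopf_zero \<kappa>)"
  note Z = module_hopf_zero[OF cring]
  note T = module_tensor[OF Z Z]
  note tens = tens_simps[OF Z Z, simplified]
  interpret T: module \<kappa> ?T by (rule T)
  have "bilinear_map \<kappa> H ?Z ?Z (\<lambda>a r. counit H a \<otimes>\<^bsub>\<kappa>\<^esub> r)"
    using H.counit_comp_linear[OF Z linear_map_id]
    by (intro bilinear_mapI mult_linear_hopf_zero(2)[OF cring]) (simp_all add: linear_map_id)
  moreover have "bilinear_map \<kappa> H ?Z ?Z act \<longleftrightarrow> bilinear_map \<kappa> H ?Z ?Z (\<lambda>a r. counit H a \<otimes>\<^bsub>\<kappa>\<^esub> r)"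
    by (intro bilinear_map_cong H.module_self Z) (simp_all add: act)
  ultimately have bil: "bilinear_map \<kappa> H ?Z ?Z act" by simp
  note slice = bilinear_map_slice[OF bil, simplified]
  show ?thesis
  proof (intro module_bialgebra.intro bil)
    fix x u v assume "x \<in> carrier H" "u \<in> carrier ?Z" "v \<in> carrier ?Z"
    then show "act x (u \<otimes>\<^bsub>?Z\<^esub> v) = sweedler \<kappa> H ?Z x (\<lambda>x1 x2. act x1 u \<otimes>\<^bsub>?Z\<^esub> act x2 v)"
      by (subst H.sweedler_counit_mult[of "u \<otimes>\<^bsub>\<kappa>\<^esub> v"]) (simp_all add: act H.R.m_ac)
  next
    fix x v assume x: "x \<in> carrier H" and v: "v \<in> carrier ?Z"
    have inner: "sweedler \<kappa> ?Z ?T v (\<lambda>v1 v2. tens \<kappa> ?Z ?Z (act x1 v1) (act x2 v2))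
        = (counit H x1 \<otimes>\<^bsub>\<kappa>\<^esub> counit H x2) \<odot>\<^bsub>?T\<^esub> (v \<odot>\<^bsub>?T\<^esub> tens \<kappa> ?Z ?Z \<one>\<^bsub>\<kappa>\<^esub> \<one>\<^bsub>\<kappa>\<^esub>)"
      if "x1 \<in> carrier H" "x2 \<in> carrier H" for x1 x2
    proof -
      have "sweedler \<kappa> ?Z ?T v (\<lambda>v1 v2. tens \<kappa> ?Z ?Z (act x1 v1) (act x2 v2))
          = tens \<kappa> ?Z ?Z (act x1 v) (act x2 \<one>\<^bsub>\<kappa>\<^esub>)"
        using that v by (intro sweedler_hopf_zero[OF cring T] bilinear_mapI tens slice linear_map_id)
          (simp_all add: act)
      also have "\<dots> = (counit H x1 \<otimes>\<^bsub>\<kappa>\<^esub> counit H x2) \<odot>\<^bsub>?T\<^esub> (v \<odot>\<^bsub>?T\<^esub> tens \<kappa> ?Z ?Z \<one>\<^bsub>\<kappa>\<^esub> \<one>\<^bsub>\<kappa>\<^esub>)"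
        using that v by (subst tens_hopf_zero[OF cring])
          (simp_all add: act T.smult_assoc1[symmetric] tens H.R.m_ac)
      finally show ?thesis .
    qed
    have "sweedler \<kappa> H ?T x (\<lambda>x1 x2. sweedler \<kappa> ?Z ?T v (\<lambda>v1 v2. tens \<kappa> ?Z ?Z (act x1 v1) (act x2 v2)))
        = counit H x \<odot>\<^bsub>?T\<^esub> (v \<odot>\<^bsub>?T\<^esub> tens \<kappa> ?Z ?Z \<one>\<^bsub>\<kappa>\<^esub> \<one>\<^bsub>\<kappa>\<^esub>)"
      using v x by (intro H.sweedler_counit_scalar T inner) (simp_all add: tens)
    also have "\<dots> = comult ?Z (act x v)"
      using x v unfolding comult_hopf_zero
      by (subst (2) tens_hopf_zero[OF cring]) (simp_all add: act T.smult_assoc1[symmetric] tens)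
    finally show "comult ?Z (act x v)
      = sweedler \<kappa> H ?T x (\<lambda>x1 x2. sweedler \<kappa> ?Z ?T v (\<lambda>v1 v2. tens \<kappa> ?Z ?Z (act x1 v1) (act x2 v2)))"
      by simp
  qed (simp_all add: act H.counit_one H.counit_mult H.R.m_assoc)
qed

lemma hopf_hom_unit:
  assumes I: "cocomm_hopf_algebra \<kappa> I"
  shows "hopf_hom \<kappa> (hopf_zero \<kappa>) I (\<lambda>r. r \<odot>\<^bsub>I\<^esub> \<one>\<^bsub>I\<^esub>)"
proof -
  interpret I: cocomm_hopf_algebra \<kappa> I by fact
  note Z = module_hopf_zero[OF I.R.cring_axioms]
  have lin: "linear_map \<kappa> (hopf_zero \<kappa>) I (\<lambda>r. r \<odot>\<^bsub>I\<^esub> \<one>\<^bsub>I\<^esub>)"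
    by (rule linear_mapI) (simp_all add: I.smult_l_distr I.smult_assoc1)
  have "comult I (r \<odot>\<^bsub>I\<^esub> \<one>\<^bsub>I\<^esub>) = sweedler \<kappa> (hopf_zero \<kappa>) (tensor \<kappa> I I) r
      (\<lambda>x1 x2. tens \<kappa> I I (x1 \<odot>\<^bsub>I\<^esub> \<one>\<^bsub>I\<^esub>) (x2 \<odot>\<^bsub>I\<^esub> \<one>\<^bsub>I\<^esub>))" if r: "r \<in> carrier \<kappa>" for r
  proof -
    have "sweedler \<kappa> (hopf_zero \<kappa>) (tensor \<kappa> I I) r
        (\<lambda>x1 x2. tens \<kappa> I I (x1 \<odot>\<^bsub>I\<^esub> \<one>\<^bsub>I\<^esub>) (x2 \<odot>\<^bsub>I\<^esub> \<one>\<^bsub>I\<^esub>)) = tens \<kappa> I I (r \<odot>\<^bsub>I\<^esub> \<one>\<^bsub>I\<^esub>) \<one>\<^bsub>I\<^esub>"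
      using r by (subst sweedler_hopf_zero[OF I.R.cring_axioms]) (simp_all add: bilinear_map_hopf_zeroI lin)
    also have "\<dots> = r \<odot>\<^bsub>tensor \<kappa> I I\<^esub> tens \<kappa> I I \<one>\<^bsub>I\<^esub> \<one>\<^bsub>I\<^esub>"
      using r by (simp add: bilinear_map_simps(4)[OF tens_bilinear[OF I.module_self I.module_self]])
    also have "\<dots> = comult I (r \<odot>\<^bsub>I\<^esub> \<one>\<^bsub>I\<^esub>)"
      using r by (simp add: linear_mapD(3)[OF I.comult_linear] I.comult_one)
    finally show ?thesis by simp
  qed
  moreover have "(x \<otimes>\<^bsub>\<kappa>\<^esub> y) \<odot>\<^bsub>I\<^esub> \<one>\<^bsub>I\<^esub> = x \<odot>\<^bsub>I\<^esub> \<one>\<^bsub>I\<^esub> \<otimes>\<^bsub>I\<^esub> (y \<odot>\<^bsub>I\<^esub> \<one>\<^bsub>I\<^esub>)"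
    if "x \<in> carrier \<kappa>" "y \<in> carrier \<kappa>" for x y
    using that by (simp add: I.smult_mult_left I.smult_assoc1)
  ultimately show ?thesis
    using lin by (simp add: hopf_hom_def I.counit_smult I.counit_one)
qed


section \<open>Crossed modules as 2-crossed modules\<close>

context hopf_xmod
begin

interpretation A: hopf_action \<kappa> H I act
  by (intro hopf_action.intro hopf_H hopf_I act)

abbreviation (input) "Z \<equiv> hopf_zero \<kappa>"
abbreviation (input) "counit_lift \<equiv> \<lambda>x y. counit I x \<otimes>\<^bsub>\<kappa>\<^esub> counit I y"
abbreviation (input) "unit_map \<equiv> \<lambda>r. r \<odot>\<^bsub>I\<^esub> \<one>\<^bsub>I\<^esub>"

lemma hopf_Z: "cocomm_hopf_algebra \<kappa> Z"
  by (rule cocomm_hopf_algebra_hopf_zero[OF A.H.R.cring_axioms])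

interpretation Z: cocomm_hopf_algebra \<kappa> Z by (rule hopf_Z)

lemma counit_linear: "linear_map \<kappa> I Z (counit I)" "linear_map \<kappa> H Z (counit H)"
  by (rule linear_mapI; simp add: A.I.counit_add A.I.counit_smult A.H.counit_add A.H.counit_smult)+

lemma lift_act_Z:
  assumes "u \<in> carrier I" "k \<in> carrier \<kappa>"
  shows "hopf_lift_act \<kappa> Z unit_map counit_lift u k = counit I u \<otimes>\<^bsub>\<kappa>\<^esub> k"
proof -
  have "linear_map \<kappa> Z Z (\<lambda>k2. counit I (k2 \<odot>\<^bsub>I\<^esub> \<one>\<^bsub>I\<^esub>))"
    by (rule linear_map_comp[OF counit_linear(1) hopf_homD(1)[OF hopf_hom_unit[OF hopf_I]]])
  note lin = mult_linear_hopf_zero[OF A.H.R.cring_axioms] this linear_map_id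
  have "hopf_lift_act \<kappa> Z unit_map counit_lift u k = k \<otimes>\<^bsub>\<kappa>\<^esub> (counit I (\<one>\<^bsub>\<kappa>\<^esub> \<odot>\<^bsub>I\<^esub> \<one>\<^bsub>I\<^esub>) \<otimes>\<^bsub>\<kappa>\<^esub> counit I u)"
    unfolding hopf_lift_act_def using assms
    by (subst sweedler_hopf_zero[OF A.H.R.cring_axioms]) (simp_all, intro bilinear_mapI lin, simp_all)
  then show ?thesis using assms by (simp add: A.I.counit_one A.H.R.m_comm)
qed

text \<open>The Peiffer identity replaces the adjoint action by that of \<open>\<partial> u\<close>, which is compatible with \<open>\<epsilon>\<close>.\<close>

lemma counit_ad: "\<lbrakk>u \<in> carrier I; v \<in> carrier I\<rbrakk> \<Longrightarrow> counit I (hopf_ad \<kappa> I u v) = counit I u \<otimes>\<^bsub>\<kappa>\<^esub> counit I v"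
  by (simp add: peiffer[symmetric] A.act_counit closed hopf_homD(4)[OF hom_d])

lemma hopf_ad_Z: "\<lbrakk>r \<in> carrier \<kappa>; s \<in> carrier \<kappa>\<rbrakk> \<Longrightarrow> hopf_ad \<kappa> Z r s = r \<otimes>\<^bsub>\<kappa>\<^esub> s"
  unfolding hopf_ad_def
  by (subst sweedler_hopf_zero[OF A.H.R.cring_axioms])
    (simp_all, intro bilinear_mapI mult_linear_hopf_zero[OF A.H.R.cring_axioms] linear_map_id, simp_all)

lemma Z_to_I_xmod: "hopf_xmod \<kappa> Z I unit_map (hopf_lift_act \<kappa> Z unit_map counit_lift)"
proof (intro hopf_xmod.intro hopf_Z hopf_I hopf_hom_unit module_bialgebra_trivial lift_act_Z)
  fix x r assume x: "x \<in> carrier I" and r: "r \<in> carrier Z"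
  have "hopf_ad \<kappa> I x (r \<odot>\<^bsub>I\<^esub> \<one>\<^bsub>I\<^esub>) = r \<odot>\<^bsub>I\<^esub> hopf_ad \<kappa> I x \<one>\<^bsub>I\<^esub>"
    using x r by (simp add: bilinear_map_simps(5)[OF A.I.hopf_ad_bilinear])
  then show "hopf_lift_act \<kappa> Z unit_map counit_lift x r \<odot>\<^bsub>I\<^esub> \<one>\<^bsub>I\<^esub> = hopf_ad \<kappa> I x (r \<odot>\<^bsub>I\<^esub> \<one>\<^bsub>I\<^esub>)"
    using x r by (simp add: lift_act_Z A.I.hopf_ad_one_right A.I.smult_assoc1[symmetric] A.H.R.m_comm)
next
  fix u v assume "u \<in> carrier Z" "v \<in> carrier Z"
  then show "hopf_lift_act \<kappa> Z unit_map counit_lift (u \<odot>\<^bsub>I\<^esub> \<one>\<^bsub>I\<^esub>) v = hopf_ad \<kappa> Z u v"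
    by (simp add: lift_act_Z hopf_ad_Z A.I.counit_smult A.I.counit_one)
qed simp_all

text \<open>The right-hand side of the axiom for \<open>\<partial>\<^sub>2 {x,y}\<close> must be trivial. By the Peiffer identity,
  \<open>ad(x') y' = \<partial> x' \<rhd> y'\<close>, so that the sum over \<open>x\<close> is \<open>\<partial> x \<rhd> (y' S(y''))\<close>, and the sum over \<open>y\<close> of
  these is \<open>\<partial> x \<rhd> \<epsilon>(y) 1 = \<epsilon>(x) \<epsilon>(y) 1\<close>.\<close>

lemma adjoint_cancel:
  assumes x: "x \<in> carrier I" and y: "y \<in> carrier I"
  shows "sweedler \<kappa> I I x (\<lambda>x1 x2. sweedler \<kappa> I I y (\<lambda>y1 y2.
      hopf_ad \<kappa> I x1 y1 \<otimes>\<^bsub>I\<^esub> (\<partial> x2 \<rhd> antipode I y2))) = (counit I x \<otimes>\<^bsub>\<kappa>\<^esub> counit I y) \<odot>\<^bsub>I\<^esub> \<one>\<^bsub>I\<^esub>"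
proof -
  note lin = hopf_homD(1)[OF hom_d]
  note bils = bilinear_mapI linear_map_id linear_map_comp[OF lin] lin linear_mapD[OF lin]
  have "sweedler \<kappa> I I x (\<lambda>x1 x2. sweedler \<kappa> I I y (\<lambda>y1 y2. hopf_ad \<kappa> I x1 y1 \<otimes>\<^bsub>I\<^esub> (\<partial> x2 \<rhd> antipode I y2)))
      = sweedler \<kappa> I I y (\<lambda>y1 y2. sweedler \<kappa> I I x (\<lambda>x1 x2. hopf_ad \<kappa> I x1 y1 \<otimes>\<^bsub>I\<^esub> (\<partial> x2 \<rhd> antipode I y2)))"
    using x y by (intro sweedler_swap hopf_I) (simp_all add: bils)
  also have "\<dots> = sweedler \<kappa> I I y (\<lambda>y1 y2. \<partial> x \<rhd> (y1 \<otimes>\<^bsub>I\<^esub> antipode I y2))"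
  proof (rule A.I.sweedler_cong)
    fix y1 y2 assume y12: "y1 \<in> carrier I" "y2 \<in> carrier I"
    have "sweedler \<kappa> I I x (\<lambda>x1 x2. hopf_ad \<kappa> I x1 y1 \<otimes>\<^bsub>I\<^esub> (\<partial> x2 \<rhd> antipode I y2))
        = sweedler \<kappa> I I x (\<lambda>x1 x2. (\<partial> x1 \<rhd> y1) \<otimes>\<^bsub>I\<^esub> (\<partial> x2 \<rhd> antipode I y2))"
      using x y12 by (intro A.I.sweedler_cong) (simp_all add: bils peiffer)
    also have "\<dots> = sweedler \<kappa> H I (\<partial> x) (\<lambda>a1 a2. (a1 \<rhd> y1) \<otimes>\<^bsub>I\<^esub> (a2 \<rhd> antipode I y2))"
      using x y12 by (intro sweedler_hopf_hom[symmetric] hopf_I hopf_H hom_d) (simp_all add: bils)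
    also have "\<dots> = \<partial> x \<rhd> (y1 \<otimes>\<^bsub>I\<^esub> antipode I y2)"
      using x y12 by (simp add: A.act_mult closed)
    finally show "sweedler \<kappa> I I x (\<lambda>x1 x2. hopf_ad \<kappa> I x1 y1 \<otimes>\<^bsub>I\<^esub> (\<partial> x2 \<rhd> antipode I y2))
        = \<partial> x \<rhd> (y1 \<otimes>\<^bsub>I\<^esub> antipode I y2)" .
  qed (use x y in \<open>simp_all add: bils\<close>)
  also have "\<dots> = \<partial> x \<rhd> sweedler \<kappa> I I y (\<lambda>y1 y2. y1 \<otimes>\<^bsub>I\<^esub> antipode I y2)"
    using x y by (intro A.I.sweedler_apply[symmetric]) (simp_all add: bils closed)
  also have "\<dots> = (counit I x \<otimes>\<^bsub>\<kappa>\<^esub> counit I y) \<odot>\<^bsub>I\<^esub> \<one>\<^bsub>I\<^esub>"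
    using x y
    by (simp add: A.I.antipode_right bilinear_map_simps(5)[OF A.act_bilinear] closed A.act_one
        hopf_homD(4)[OF hom_d] A.I.smult_assoc1[symmetric] A.H.R.m_comm)
  finally show ?thesis .
qed

text \<open>The values of the lifting are products of counits. Apart from \<open>adjoint_cancel\<close>, the axioms about it
  therefore equate scalars or their coproducts, and the Sweedler sums are evaluated one variable at a
  time by \<open>sweedler_counit_mult\<close> and \<open>sweedler_counit_scalar\<close>.\<close>

lemma hopf_x2mod_incl:
  "hopf_x2mod \<kappa> Z I H unit_map d act (\<lambda>a r. counit H a \<otimes>\<^bsub>\<kappa>\<^esub> r) counit_lift"
proof -
  let ?T = "tensor \<kappa> Z Z"
  note R = A.H.R.cring_axioms
  note Z = module_hopf_zero[OF R]
  note T = module_tensor[OF Z Z]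
  interpret T: module \<kappa> ?T by (rule T)
  note tens_closed = tens_simps(1)[OF Z Z, simplified]
  note eps = hopf_homD(4)[OF hom_d] closed A.act_counit counit_ad
  note lin = counit_linear linear_map_comp[OF counit_linear(1)] mult_linear_hopf_zero[OF R]
  have bil: "bilinear_map \<kappa> I I Z counit_lift"
    by (intro bilinear_mapI lin linear_map_id) simp_all
  note IZ = A.I.sweedler_counit_mult and HZ = A.H.sweedler_counit_mult
  show ?thesis
  proof (intro hopf_x2mod.intro hopf_Z hopf_I hopf_H hopf_hom_unit hom_d act bil Z_to_I_xmod module_bialgebra_trivial, goal_cases)
    case (1 k)
    then show ?case by (simp add: linear_mapD(3)[OF hopf_homD(1)[OF hom_d]] hopf_homD(3)[OF hom_d])
  next
    case (2 a r)
    show ?case by simp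
  next
    case (3 x y)
    let ?t = "tens \<kappa> Z Z \<one>\<^bsub>\<kappa>\<^esub> \<one>\<^bsub>\<kappa>\<^esub>"
    have inner: "sweedler \<kappa> I ?T y (\<lambda>y1 y2. tens \<kappa> Z Z (counit_lift x1 y1) (counit_lift x2 y2))
        = (counit I x1 \<otimes>\<^bsub>\<kappa>\<^esub> counit I x2) \<odot>\<^bsub>?T\<^esub> (counit I y \<odot>\<^bsub>?T\<^esub> ?t)"
      if "x1 \<in> carrier I" "x2 \<in> carrier I" for x1 x2
    proof -
      have "sweedler \<kappa> I ?T y (\<lambda>y1 y2. tens \<kappa> Z Z (counit_lift x1 y1) (counit_lift x2 y2))
          = counit I y \<odot>\<^bsub>?T\<^esub> ((counit I x1 \<otimes>\<^bsub>\<kappa>\<^esub> counit I x2) \<odot>\<^bsub>?T\<^esub> ?t)"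
        using that 3 by (intro A.I.sweedler_counit_scalar T)
          (simp_all add: tens_hopf_zero[OF R, of "_ \<otimes>\<^bsub>\<kappa>\<^esub> _"] tens_closed T.smult_assoc1[symmetric] A.H.R.m_ac)
      then show ?thesis using that 3 by (simp add: tens_closed T.smult_assoc1[symmetric] A.H.R.m_ac)
    qed
    have "sweedler \<kappa> I ?T x (\<lambda>x1 x2.
        sweedler \<kappa> I ?T y (\<lambda>y1 y2. tens \<kappa> Z Z (counit_lift x1 y1) (counit_lift x2 y2)))
      = counit I x \<odot>\<^bsub>?T\<^esub> (counit I y \<odot>\<^bsub>?T\<^esub> ?t)"
      using 3 by (intro A.I.sweedler_counit_scalar T inner) (simp_all add: tens_closed)
    then show ?case
      using 3 tens_hopf_zero[OF R, of "counit_lift x y" "\<one>\<^bsub>\<kappa>\<^esub>"]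
      by (simp add: comult_hopf_zero tens_closed T.smult_assoc1)
  next
    case (4 x y)
    then show ?case by simp
  next
    case (5 a x y)
    then show ?case
      by (subst HZ[of "counit_lift x y"]) (simp_all add: eps A.H.R.m_ac)
  next
    case (6 a k)
    then show ?case
      by (simp add: bilinear_map_simps(5)[OF A.act_bilinear] A.act_one A.I.smult_assoc1[symmetric] A.H.R.m_comm)
  next
    case (7 a x)
    then show ?case by (rule d_act)
  next
    case (8 x y)
    then show ?case by (simp only: adjoint_cancel)
  next
    case (9 k l)
    have "sweedler \<kappa> Z Z l (\<lambda>l1 l2. hopf_ad \<kappa> Z k l1 \<otimes>\<^bsub>Z\<^esub> antipode Z l2) = k \<otimes>\<^bsub>\<kappa>\<^esub> l \<otimes>\<^bsub>\<kappa>\<^esub> \<one>\<^bsub>\<kappa>\<^esub>"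
      using 9 by (intro sweedler_hopf_zero_cong[OF R Z, where g = "\<lambda>l1 l2. k \<otimes>\<^bsub>\<kappa>\<^esub> l1 \<otimes>\<^bsub>\<kappa>\<^esub> l2"]
          bilinear_map_hopf_zeroI lin linear_map_id) (simp_all add: hopf_ad_Z)
    then show ?case using 9 by (simp add: A.I.counit_smult A.I.counit_one)
  next
    case (10 x y z)
    let ?g = "\<lambda>x1 x2 x3 y1 y2. counit_lift x1 y1 \<otimes>\<^bsub>Z\<^esub> hopf_lift_act \<kappa> Z unit_map counit_lift (\<partial> x2 \<rhd> y2) (counit_lift x3 z)"
    have inner: "sweedler \<kappa> I Z y (\<lambda>y1 y2. ?g x1 x2 x3 y1 y2)
        = counit I y \<otimes>\<^bsub>\<kappa>\<^esub> (counit I x1 \<otimes>\<^bsub>\<kappa>\<^esub> counit I x2 \<otimes>\<^bsub>\<kappa>\<^esub> counit I x3 \<otimes>\<^bsub>\<kappa>\<^esub> counit I z)"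
      if "x1 \<in> carrier I" "x2 \<in> carrier I" "x3 \<in> carrier I" for x1 x2 x3
      using that 10 by (intro IZ) (simp_all add: lift_act_Z eps A.H.R.m_ac)
    have middle: "sweedler \<kappa> I Z x23 (\<lambda>x2 x3. sweedler \<kappa> I Z y (\<lambda>y1 y2. ?g x1 x2 x3 y1 y2))
        = counit I x23 \<otimes>\<^bsub>\<kappa>\<^esub> (counit I x1 \<otimes>\<^bsub>\<kappa>\<^esub> counit I y \<otimes>\<^bsub>\<kappa>\<^esub> counit I z)"
      if "x1 \<in> carrier I" "x23 \<in> carrier I" for x1 x23
      using that 10 by (intro IZ) (simp_all only: inner, simp_all add: A.H.R.m_ac)
    have "sweedler \<kappa> I Z x (\<lambda>x1 x23. sweedler \<kappa> I Z x23 (\<lambda>x2 x3. sweedler \<kappa> I Z y (\<lambda>y1 y2. ?g x1 x2 x3 y1 y2)))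
        = counit I x \<otimes>\<^bsub>\<kappa>\<^esub> (counit I y \<otimes>\<^bsub>\<kappa>\<^esub> counit I z)"
      using 10 by (intro IZ) (simp_all only: middle, simp_all add: A.H.R.m_ac)
    then show ?case using 10 by (simp add: A.I.counit_mult)
  next
    case (11 x y z)
    let ?g = "\<lambda>x1 x2 y1 y2 z1 z2. counit_lift x1 (hopf_ad \<kappa> I y1 z1) \<otimes>\<^bsub>Z\<^esub> (counit H (\<partial> x2) \<otimes>\<^bsub>\<kappa>\<^esub> counit_lift y2 z2)"
    have inner: "sweedler \<kappa> I Z z (\<lambda>z1 z2. ?g x1 x2 y1 y2 z1 z2)
        = counit I z \<otimes>\<^bsub>\<kappa>\<^esub> (counit I x1 \<otimes>\<^bsub>\<kappa>\<^esub> counit I x2 \<otimes>\<^bsub>\<kappa>\<^esub> counit I y1 \<otimes>\<^bsub>\<kappa>\<^esub> counit I y2)"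
      if "x1 \<in> carrier I" "x2 \<in> carrier I" "y1 \<in> carrier I" "y2 \<in> carrier I" for x1 x2 y1 y2
      using that 11 by (intro IZ) (simp_all add: eps A.H.R.m_ac)
    have middle: "sweedler \<kappa> I Z y (\<lambda>y1 y2. sweedler \<kappa> I Z z (\<lambda>z1 z2. ?g x1 x2 y1 y2 z1 z2))
        = counit I y \<otimes>\<^bsub>\<kappa>\<^esub> (counit I x1 \<otimes>\<^bsub>\<kappa>\<^esub> counit I x2 \<otimes>\<^bsub>\<kappa>\<^esub> counit I z)"
      if "x1 \<in> carrier I" "x2 \<in> carrier I" for x1 x2
      using that 11 by (intro IZ) (simp_all only: inner, simp_all add: A.H.R.m_ac)
    have "sweedler \<kappa> I Z x (\<lambda>x1 x2. sweedler \<kappa> I Z y (\<lambda>y1 y2. sweedler \<kappa> I Z z (\<lambda>z1 z2. ?g x1 x2 y1 y2 z1 z2)))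
        = counit I x \<otimes>\<^bsub>\<kappa>\<^esub> (counit I y \<otimes>\<^bsub>\<kappa>\<^esub> counit I z)"
      using 11 by (intro IZ) (simp_all only: middle, simp_all add: A.H.R.m_ac)
    then show ?case using 11 by (simp add: A.I.counit_mult A.H.R.m_assoc)
  next
    case (12 k x)
    have inner: "sweedler \<kappa> I Z x (\<lambda>x1 x2. counit_lift (unit_map k1) x1 \<otimes>\<^bsub>Z\<^esub> counit_lift x2 (unit_map k2)) = counit I x \<otimes>\<^bsub>\<kappa>\<^esub> k1 \<otimes>\<^bsub>\<kappa>\<^esub> k2"
      if "k1 \<in> carrier \<kappa>" "k2 \<in> carrier \<kappa>" for k1 k2
    proof -
      have "sweedler \<kappa> I Z x (\<lambda>x1 x2. counit_lift (unit_map k1) x1 \<otimes>\<^bsub>Z\<^esub> counit_lift x2 (unit_map k2)) = counit I x \<otimes>\<^bsub>\<kappa>\<^esub> (k1 \<otimes>\<^bsub>\<kappa>\<^esub> k2)"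
        using that 12 by (intro IZ) (simp_all add: A.I.counit_smult A.I.counit_one A.H.R.m_ac)
      then show ?thesis using that 12 by (simp add: A.H.R.m_assoc)
    qed
    have "sweedler \<kappa> Z Z k (\<lambda>k1 k2. sweedler \<kappa> I Z x (\<lambda>x1 x2. counit_lift (unit_map k1) x1 \<otimes>\<^bsub>Z\<^esub> counit_lift x2 (unit_map k2)))
        = counit I x \<otimes>\<^bsub>\<kappa>\<^esub> k \<otimes>\<^bsub>\<kappa>\<^esub> \<one>\<^bsub>\<kappa>\<^esub>"
      using 12 by (intro sweedler_hopf_zero_cong[OF R Z, where g = "\<lambda>k1 k2. counit I x \<otimes>\<^bsub>\<kappa>\<^esub> k1 \<otimes>\<^bsub>\<kappa>\<^esub> k2"]
          bilinear_map_hopf_zeroI lin linear_map_id inner) simp_all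
    moreover have "sweedler \<kappa> Z Z k (\<lambda>k1 k2. k1 \<otimes>\<^bsub>Z\<^esub> (counit H (\<partial> x) \<otimes>\<^bsub>\<kappa>\<^esub> antipode Z k2))
        = k \<otimes>\<^bsub>\<kappa>\<^esub> (counit I x \<otimes>\<^bsub>\<kappa>\<^esub> \<one>\<^bsub>\<kappa>\<^esub>)"
      using 12 by (intro sweedler_hopf_zero_cong[OF R Z, where g = "\<lambda>k1 k2. k1 \<otimes>\<^bsub>\<kappa>\<^esub> (counit I x \<otimes>\<^bsub>\<kappa>\<^esub> k2)"]
          bilinear_map_hopf_zeroI lin linear_map_id) (simp_all add: eps)
    ultimately show ?case using 12 by (simp add: A.H.R.m_comm)
  qed
qed

end


text \<open>A crossed module extended by a fixed top term \<open>T\<close>. The boundary from \<open>T\<close>, the action on \<open>T\<close> and the lifting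
  are functions of the crossed module, so that their naturality can be stated.\<close>

definition extend_xmod where
  "extend_xmod T b t p X = \<lparr>top2 = T, mid2 = xtop X, base2 = xbase X, bd2 = b X, bd1 = xbd X,
     act_mid = xact X, act_top = t X, plift = p X\<rparr>"

lemma is_functor_extend:
  assumes C: "xmod_objects PE homE PG homG is_obj" and D: "x2mod_objects PL homL PE homE PG homG is_obj'"
    and T: "homL T T (\<lambda>k\<in>carrier T. k)"
    and obj: "\<And>X. is_obj X \<Longrightarrow> is_obj' (extend_xmod T b t p X)"
    and b: "\<And>X Y f2 k. \<lbrakk>is_obj X; is_obj Y; homE (xtop X) (xtop Y) f2; k \<in> carrier T\<rbrakk> \<Longrightarrow> f2 (b X k) = b Y k"
    and t: "\<And>X Y f1 a k. \<lbrakk>is_obj X; is_obj Y; homG (xbase X) (xbase Y) f1; a \<in> carrier (xbase X); k \<in> carrier T\<rbrakk> \<Longrightarrow>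
      t Y (f1 a) k = t X a k"
    and p: "\<And>X Y f2 x y. \<lbrakk>is_obj X; is_obj Y; homE (xtop X) (xtop Y) f2; x \<in> carrier (xtop X); y \<in> carrier (xtop X)\<rbrakk> \<Longrightarrow>
      p Y (f2 x) (f2 y) = p X x y"
  shows "is_functor (xmod_cat is_obj homE homG) (x2mod_cat is_obj' homL homE homG)
    \<lparr>fobj = extend_xmod T b t p, farr = (\<lambda>X Y (f2, f1). (\<lambda>k\<in>carrier T. k, f2, f1))\<rparr>" (is "is_functor ?C ?D ?F")
proof -
  interpret C: xmod_objects PE homE PG homG is_obj by fact
  interpret D: x2mod_objects PL homL PE homE PG homG is_obj' by fact
  have cl: "\<lbrakk>a \<in> carrier (xbase X); k \<in> carrier T\<rbrakk> \<Longrightarrow> t X a k \<in> carrier T"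
    "\<lbrakk>x \<in> carrier (xtop X); y \<in> carrier (xtop X)\<rbrakk> \<Longrightarrow> p X x y \<in> carrier T" if "is_obj X" for X a k x y
    using D.act_top[OF obj[OF that], of a k] D.plift[OF obj[OF that], of x y] by (simp_all add: extend_xmod_def)
  have "farr ?F X Y f \<in> Hom ?D (fobj ?F X) (fobj ?F Y)"
    if X: "is_obj X" and Y: "is_obj Y" and f: "f \<in> Hom ?C X Y" for X Y f
  proof -
    obtain f2 f1 where f': "f = (f2, f1)" by force
    have h: "homE (xtop X) (xtop Y) f2" "homG (xbase X) (xbase Y) f1"
      using f unfolding f' by (simp_all add: xmod_cat_def)
    show ?thesis
      using f unfolding f' by (simp add: xmod_cat_def x2mod_cat_def extend_xmod_def T b[OF X Y h(1)] t[OF X Y h(2)] p[OF X Y h(1)] cl[OF X])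
  qed
  moreover have "farr ?F X X (Idn ?C X) = Idn ?D (fobj ?F X)" for X
    by (simp add: xmod_cat_def x2mod_cat_def extend_xmod_def)
  moreover have "farr ?F X Z (Cmp ?C X Y Z g f)
      = Cmp ?D (fobj ?F X) (fobj ?F Y) (fobj ?F Z) (farr ?F Y Z g) (farr ?F X Y f)" for X Y Z f g
    by (auto simp: xmod_cat_def x2mod_cat_def extend_xmod_def compose_def restrict_def split: prod.splits)
  moreover have "X \<in> Obj ?C \<longleftrightarrow> is_obj X" "Y \<in> Obj ?D \<longleftrightarrow> is_obj' Y" for X Y
    by (simp_all add: xmod_cat_def x2mod_cat_def extend_xmod_def)
  ultimately show ?thesis unfolding is_functor_def using C.is_category D.is_category obj by simp
qed

lemma Incl_Hopf_eq: "Incl_Hopf \<kappa> = \<lparr>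
     fobj = extend_xmod (hopf_zero \<kappa>) (\<lambda>X r. r \<odot>\<^bsub>xtop X\<^esub> \<one>\<^bsub>xtop X\<^esub>) (\<lambda>X a r. counit (xbase X) a \<otimes>\<^bsub>\<kappa>\<^esub> r)
       (\<lambda>X x y. counit (xtop X) x \<otimes>\<^bsub>\<kappa>\<^esub> counit (xtop X) y),
     farr = (\<lambda>X Y (f2, f1). (\<lambda>k\<in>carrier (hopf_zero \<kappa>). k, f2, f1))\<rparr>"
  by (simp add: Incl_Hopf_def extend_xmod_def[abs_def])

lemma is_functor_Incl_Hopf:
  fixes \<kappa> :: "'k ring"
  assumes "cring \<kappa>"
  shows "is_functor (XHopf \<kappa> :: (('k, 'e, 'g) xhopf, ('e, 'g) mor2) cat) (X2Hopf \<kappa>) (Incl_Hopf \<kappa>)"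
  unfolding Incl_Hopf_eq XHopf_def X2Hopf_def
proof (rule is_functor_extend[OF xmod_objects_Hopf x2mod_objects_Hopf], goal_cases)
  case 1
  show ?case
    by (rule structured_homs.identity[OF structured_homs_hopf cocomm_hopf_algebra_hopf_zero[OF assms]])
next
  case (2 X)
  then show ?case by (simp add: extend_xmod_def hopf_xmod.hopf_x2mod_incl)
next
  case (3 X Y f2 k)
  interpret I: cocomm_hopf_algebra \<kappa> "xtop X" using 3(1) by (rule hopf_xmod.hopf_I)
  show ?case
    using 3(4) linear_mapD(3)[OF hopf_homD(1)[OF 3(3)], of k "\<one>\<^bsub>xtop X\<^esub>"] by (simp add: hopf_homD(3)[OF 3(3)])
qed (simp_all add: hopf_homD(4))

lemma lie_algebra_lie_zero:
  assumes "cring \<kappa>"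
  shows "lie_algebra \<kappa> (lie_zero \<kappa> z)"
proof -
  interpret cring \<kappa> by fact
  have "module \<kappa> (lie_zero \<kappa> z)"
    by (intro moduleI abelian_groupI assms) (simp_all add: lie_zero_def)
  then show ?thesis
    by (intro lie_algebra.intro lie_algebra_axioms.intro bilinear_mapI linear_mapI) (simp_all add: lie_zero_def)
qed

lemma (in lie_xmod) lie_x2mod_incl:
  assumes "cring \<kappa>"
  shows "lie_x2mod \<kappa> (lie_zero \<kappa> z) E G (\<lambda>l\<in>{z}. \<zero>\<^bsub>E\<^esub>) d act (\<lambda>a\<in>carrier G. \<lambda>l\<in>{z}. z)
    (\<lambda>x\<in>carrier E. \<lambda>y\<in>carrier E. z)"
proof -
  interpret E: lie_algebra \<kappa> E by (rule lie_E)
  interpret G: lie_algebra \<kappa> G by (rule lie_G)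
  interpret A: lie_action \<kappa> G E act by (rule act)
  interpret Z: lie_algebra \<kappa> "lie_zero \<kappa> z" by (rule lie_algebra_lie_zero[OF assms])
  note bl = bilinear_map_zero[OF E.module_axioms E.module_axioms E.module_axioms E.bracket_bilinear]
  note act_zero = bilinear_map_zero[OF G.module_axioms E.module_axioms E.module_axioms A.act_bilinear]
  note br = bilinear_map_simps(1)[OF E.bracket_bilinear] bilinear_map_simps(1)[OF G.bracket_bilinear]
    bilinear_map_simps(1)[OF A.act_bilinear]
  have lin: "linear_map \<kappa> E G \<partial>" using hom_d by (simp add: lie_hom_def)
  have Zs [simp]: "carrier (lie_zero \<kappa> z) = {z}" by (simp add: lie_zero_def)
  have Zops [simp]: "z \<oplus>\<^bsub>lie_zero \<kappa> z\<^esub> z = z" "bracket (lie_zero \<kappa> z) z z = z" "\<zero>\<^bsub>lie_zero \<kappa> z\<^esub> = z"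
    "r \<in> carrier \<kappa> \<Longrightarrow> r \<odot>\<^bsub>lie_zero \<kappa> z\<^esub> z = z" for r
    by (simp_all add: lie_zero_def)
  have [simp]: "\<ominus>\<^bsub>lie_zero \<kappa> z\<^esub> z = z" "z \<ominus>\<^bsub>lie_zero \<kappa> z\<^esub> z = z"
    using Z.M.a_inv_closed[of z] Z.M.minus_closed[of z z] by simp_all
  have hom: "lie_hom \<kappa> (lie_zero \<kappa> z) E (\<lambda>l\<in>{z}. \<zero>\<^bsub>E\<^esub>)"
    by (auto simp: lie_hom_def linear_map_def bl)
  have actZ: "lie_action \<kappa> G (lie_zero \<kappa> z) f" if "\<And>a. a \<in> carrier G \<Longrightarrow> f a z = z" for f
    using that by (intro lie_action.intro bilinear_mapI linear_mapI) (simp_all add: br)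
  have actZ': "lie_action \<kappa> E (lie_zero \<kappa> z) f" if "\<And>a. a \<in> carrier E \<Longrightarrow> f a z = z" for f
    using that by (intro lie_action.intro bilinear_mapI linear_mapI) (simp_all add: br)
  have xm: "lie_xmod \<kappa> (lie_zero \<kappa> z) E (\<lambda>l\<in>{z}. \<zero>\<^bsub>E\<^esub>)
      (lie_lift_act (lie_zero \<kappa> z) (\<lambda>l\<in>{z}. \<zero>\<^bsub>E\<^esub>) (\<lambda>x\<in>carrier E. \<lambda>y\<in>carrier E. z))"
    by (intro lie_xmod.intro Z.lie_algebra_axioms lie_E hom actZ') (simp_all add: lie_lift_act_def bl)
  have bilZ: "bilinear_map \<kappa> E E (lie_zero \<kappa> z) (\<lambda>x\<in>carrier E. \<lambda>y\<in>carrier E. z)"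
    by (intro bilinear_mapI linear_mapI) simp_all
  show ?thesis
    by (intro lie_x2mod.intro Z.lie_algebra_axioms lie_E lie_G hom hom_d act xm bilZ actZ)
      (simp_all add: br act_zero linear_mapD[OF lin] linear_map_zero[OF E.module_axioms G.module_axioms lin]
        peiffer d_act module_minus_self[OF E.module_axioms])
qed

lemma Incl_Lie_eq: "Incl_Lie \<kappa> z = \<lparr>
     fobj = extend_xmod (lie_zero \<kappa> z) (\<lambda>X. \<lambda>l\<in>{z}. \<zero>\<^bsub>xtop X\<^esub>)
       (\<lambda>X. \<lambda>a\<in>carrier (xbase X). \<lambda>l\<in>{z}. z)
       (\<lambda>X. \<lambda>x\<in>carrier (xtop X). \<lambda>y\<in>carrier (xtop X). z),
     farr = (\<lambda>X Y (f2, f1). (\<lambda>k\<in>carrier (lie_zero \<kappa> z). k, f2, f1))\<rparr>"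
proof -
  have "(\<lambda>k\<in>carrier (lie_zero \<kappa> z). k) = (\<lambda>l\<in>{z}. z)"
    by (auto simp: lie_zero_def restrict_def)
  then show ?thesis by (simp add: Incl_Lie_def extend_xmod_def[abs_def])
qed

lemma is_functor_Incl_Lie:
  fixes \<kappa> :: "'k ring" and z :: 'l
  assumes "cring \<kappa>"
  shows "is_functor (XLie \<kappa> :: (('k, 'e, 'g) xlie, ('e, 'g) mor2) cat) (X2Lie \<kappa>) (Incl_Lie \<kappa> z)"
  unfolding Incl_Lie_eq XLie_def X2Lie_def
proof (rule is_functor_extend[OF xmod_objects_Lie x2mod_objects_Lie], goal_cases)
  case 1
  show ?case by (rule structured_homs.identity[OF structured_homs_lie lie_algebra_lie_zero[OF assms]])
next
  case (2 X)
  then show ?case by (simp add: extend_xmod_def lie_xmod.lie_x2mod_incl[OF _ assms])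
next
  case (3 X Y f2 k)
  then have "f2 \<zero>\<^bsub>xtop X\<^esub> = \<zero>\<^bsub>xtop Y\<^esub>"
    by (intro linear_map_zero[of \<kappa>] lie_algebra.axioms(1)[OF lie_xmod.lie_E]) (auto simp: lie_hom_def)
  then show ?case using 3 by (simp add: lie_zero_def)
qed (auto simp: lie_zero_def lie_hom_closed)

lemma group_grp_trivial: "group (grp_trivial z)"
  by (rule groupI) (auto simp: grp_trivial_def)

lemma (in grp_xmod) grp_x2mod_incl:
  "grp_x2mod (grp_trivial z) E G (\<lambda>l\<in>{z}. \<one>\<^bsub>E\<^esub>) d act (\<lambda>a\<in>carrier G. \<lambda>l\<in>{z}. z)
    (\<lambda>x\<in>carrier E. \<lambda>y\<in>carrier E. z)"
proof -
  interpret E: group E by (rule group_E)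
  interpret G: group G by (rule group_G)
  interpret Z: group "grp_trivial z" by (rule group_grp_trivial)
  have [simp]: "carrier (grp_trivial z) = {z}" "z \<otimes>\<^bsub>grp_trivial z\<^esub> z = z" "\<one>\<^bsub>grp_trivial z\<^esub> = z"
    by (simp_all add: grp_trivial_def)
  have [simp]: "inv\<^bsub>grp_trivial z\<^esub> z = z" using Z.inv_closed[of z] by simp
  have hom: "(\<lambda>l\<in>{z}. \<one>\<^bsub>E\<^esub>) \<in> hom (grp_trivial z) E" by (auto simp: hom_def)
  have actZ: "grp_action G (grp_trivial z) f" if "\<And>a. a \<in> carrier G \<Longrightarrow> f a z = z" for f
    by (rule grp_actionI[OF group_G group_grp_trivial]) (simp_all add: that)
  have actZ': "grp_action E (grp_trivial z) f" if "\<And>a. a \<in> carrier E \<Longrightarrow> f a z = z" for f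
    by (rule grp_actionI[OF group_E group_grp_trivial]) (simp_all add: that)
  have xm: "grp_xmod (grp_trivial z) E (\<lambda>l\<in>{z}. \<one>\<^bsub>E\<^esub>)
      (grp_lift_act (grp_trivial z) (\<lambda>l\<in>{z}. \<one>\<^bsub>E\<^esub>) (\<lambda>x\<in>carrier E. \<lambda>y\<in>carrier E. z))"
    by (intro grp_xmod.intro group_grp_trivial group_E hom actZ') (simp_all add: grp_lift_act_def)
  have inverse: "e \<otimes>\<^bsub>E\<^esub> f \<otimes>\<^bsub>E\<^esub> inv\<^bsub>E\<^esub> e \<otimes>\<^bsub>E\<^esub> (e \<otimes>\<^bsub>E\<^esub> inv\<^bsub>E\<^esub> f \<otimes>\<^bsub>E\<^esub> inv\<^bsub>E\<^esub> e) = \<one>\<^bsub>E\<^esub>"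
    if "e \<in> carrier E" "f \<in> carrier E" for e f
  proof -
    have "inv\<^bsub>E\<^esub> (e \<otimes>\<^bsub>E\<^esub> f \<otimes>\<^bsub>E\<^esub> inv\<^bsub>E\<^esub> e) = e \<otimes>\<^bsub>E\<^esub> inv\<^bsub>E\<^esub> f \<otimes>\<^bsub>E\<^esub> inv\<^bsub>E\<^esub> e"
      using that by (simp add: E.inv_mult_group E.m_assoc)
    then show ?thesis using that E.r_inv[of "e \<otimes>\<^bsub>E\<^esub> f \<otimes>\<^bsub>E\<^esub> inv\<^bsub>E\<^esub> e"] by simp
  qed
  have dc: "e \<in> carrier E \<Longrightarrow> \<partial> e \<in> carrier G" for e using hom_in_carrier[OF hom_d] .
  have one: "\<partial> \<one>\<^bsub>E\<^esub> = \<one>\<^bsub>G\<^esub>" using hom_one[OF hom_d group_E group_G] .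
  show ?thesis
    by (intro grp_x2mod.intro group_grp_trivial group_E group_G hom hom_d act xm actZ)
      (simp_all add: dc one peiffer inverse grp_action_one[OF act group_E] grp_action_closed[OF act] d_act
        grp_lift_act_def)
qed

lemma Incl_Grp_eq: "Incl_Grp z = \<lparr>
     fobj = extend_xmod (grp_trivial z) (\<lambda>X. \<lambda>l\<in>{z}. \<one>\<^bsub>xtop X\<^esub>)
       (\<lambda>X. \<lambda>a\<in>carrier (xbase X). \<lambda>l\<in>{z}. z)
       (\<lambda>X. \<lambda>x\<in>carrier (xtop X). \<lambda>y\<in>carrier (xtop X). z),
     farr = (\<lambda>X Y (f2, f1). (\<lambda>k\<in>carrier (grp_trivial z). k, f2, f1))\<rparr>"
proof -
  have "(\<lambda>k\<in>carrier (grp_trivial z). k) = (\<lambda>l\<in>{z}. z)"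
    by (auto simp: grp_trivial_def restrict_def)
  then show ?thesis by (simp add: Incl_Grp_def extend_xmod_def[abs_def])
qed

lemma is_functor_Incl_Grp:
  fixes z :: 'l
  shows "is_functor (XGrp :: (('e, 'g) xgrp, ('e, 'g) mor2) cat) X2Grp (Incl_Grp z)"
  unfolding Incl_Grp_eq XGrp_def X2Grp_def
proof (rule is_functor_extend[OF xmod_objects_Grp x2mod_objects_Grp], goal_cases)
  case 1
  show ?case by (rule structured_homs.identity[OF structured_homs_grp group_grp_trivial])
next
  case (2 X)
  then show ?case by (simp add: extend_xmod_def grp_xmod.grp_x2mod_incl)
next
  case (3 X Y f2 k)
  then show ?case using hom_one[OF 3(3) grp_xmod.group_E grp_xmod.group_E] by (simp add: grp_trivial_def)
qed (auto simp: grp_trivial_def hom_in_carrier)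

text \<open>On \<open>\<kappa>\<close> the counit is the identity, and it is \<open>0\<close> on primitive and \<open>1\<close> on group-like elements.\<close>

lemma Prim_hopf_zero:
  assumes "cring \<kappa>"
  shows "Prim \<kappa> (hopf_zero \<kappa>) = {\<zero>\<^bsub>\<kappa>\<^esub>}"
proof -
  note Z = cocomm_hopf_algebra_hopf_zero[OF assms]
  have "x = \<zero>\<^bsub>\<kappa>\<^esub>" if "x \<in> Prim \<kappa> (hopf_zero \<kappa>)" for x
    using cocomm_hopf_algebra.counit_Prim[OF Z that] by simp
  moreover have "\<zero>\<^bsub>\<kappa>\<^esub> \<in> Prim \<kappa> (hopf_zero \<kappa>)"
    using cocomm_hopf_algebra.Prim_closed(1)[OF Z] by simp
  ultimately show ?thesis by blast
qed

lemma Gl_hopf_zero: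
  assumes "cring \<kappa>"
  shows "Gl \<kappa> (hopf_zero \<kappa>) = {\<one>\<^bsub>\<kappa>\<^esub>}"
proof -
  note Z = cocomm_hopf_algebra_hopf_zero[OF assms]
  have "x = \<one>\<^bsub>\<kappa>\<^esub>" if "x \<in> Gl \<kappa> (hopf_zero \<kappa>)" for x
    using cocomm_hopf_algebra.GlD(3)[OF Z that] by simp
  moreover have "\<one>\<^bsub>\<kappa>\<^esub> \<in> Gl \<kappa> (hopf_zero \<kappa>)"
    using cocomm_hopf_algebra.one_Gl[OF Z] by simp
  ultimately show ?thesis by blast
qed

lemma prim_lie_hopf_zero:
  assumes "cring \<kappa>"
  shows "prim_lie \<kappa> (hopf_zero \<kappa>) = lie_zero \<kappa> \<zero>\<^bsub>\<kappa>\<^esub>"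
proof -
  interpret cring \<kappa> by fact
  have "\<zero>\<^bsub>\<kappa>\<^esub> \<ominus>\<^bsub>hopf_zero \<kappa>\<^esub> \<zero>\<^bsub>\<kappa>\<^esub> = \<zero>\<^bsub>\<kappa>\<^esub>"
    using module_minus_self[OF module_hopf_zero[OF assms], of "\<zero>\<^bsub>\<kappa>\<^esub>"] by simp
  then show ?thesis
    unfolding prim_lie_def lie_zero_def Prim_hopf_zero[OF assms]
    by (auto simp: fun_eq_iff restrict_def)
qed

lemma gl_grp_hopf_zero:
  assumes "cring \<kappa>"
  shows "gl_grp \<kappa> (hopf_zero \<kappa>) = grp_trivial \<one>\<^bsub>\<kappa>\<^esub>"
proof -
  interpret cring \<kappa> by fact
  show ?thesis
    unfolding gl_grp_def grp_trivial_def Gl_hopf_zero[OF assms] by (auto simp: fun_eq_iff restrict_def)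
qed

text \<open>The lifting \<open>\<epsilon>(x) \<epsilon>(y)\<close> restricts to the constant \<open>0\<close> on primitive elements, and to the constant \<open>1\<close> on
  group-like elements in the analogous square for \<open>Gl\<close>.\<close>

lemma Prim_Incl:
  fixes \<kappa> :: "'k ring"
  assumes "cring \<kappa>"
  shows "funct_eq (XHopf \<kappa> :: (('k, 'e, 'g) xhopf, ('e, 'g) mor2) cat)
       (funct_comp (Prim_X2 \<kappa>) (Incl_Hopf \<kappa>)) (funct_comp (Incl_Lie \<kappa> \<zero>\<^bsub>\<kappa>\<^esub>) (Prim_X \<kappa>))"
  unfolding funct_eq_def
proof (intro conjI ballI)
  interpret cring \<kappa> by fact
  fix X Y :: "('k, 'e, 'g) xhopf" and f
  assume X: "X \<in> Obj (XHopf \<kappa>)"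
  interpret X: hopf_xmod \<kappa> "xtop X" "xbase X" "xbd X" "xact X" using X by (simp add: XHopf_def xmod_cat_def)
  interpret I: cocomm_hopf_algebra \<kappa> "xtop X" by (rule X.hopf_I)
  interpret H: cocomm_hopf_algebra \<kappa> "xbase X" by (rule X.hopf_H)
  show "fobj (funct_comp (Prim_X2 \<kappa>) (Incl_Hopf \<kappa>)) X = fobj (funct_comp (Incl_Lie \<kappa> \<zero>\<^bsub>\<kappa>\<^esub>) (Prim_X \<kappa>)) X"
    by (auto simp: funct_comp_def Prim_X2_def Incl_Hopf_def Incl_Lie_def Prim_X_def Let_def
        prim_lie_hopf_zero[OF assms] Prim_hopf_zero[OF assms] I.counit_Prim fun_eq_iff restrict_def)
  show "farr (funct_comp (Prim_X2 \<kappa>) (Incl_Hopf \<kappa>)) X Y f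
      = farr (funct_comp (Incl_Lie \<kappa> \<zero>\<^bsub>\<kappa>\<^esub>) (Prim_X \<kappa>)) X Y f"
    by (cases f) (auto simp: funct_comp_def Prim_X2_def Incl_Hopf_def Incl_Lie_def Prim_X_def
        Prim_hopf_zero[OF assms] fun_eq_iff restrict_def)
qed

lemma Gl_Incl:
  fixes \<kappa> :: "'k ring"
  assumes "cring \<kappa>"
  shows "funct_eq (XHopf \<kappa> :: (('k, 'e, 'g) xhopf, ('e, 'g) mor2) cat)
       (funct_comp (Gl_X2 \<kappa>) (Incl_Hopf \<kappa>)) (funct_comp (Incl_Grp \<one>\<^bsub>\<kappa>\<^esub>) (Gl_X \<kappa>))"
  unfolding funct_eq_def
proof (intro conjI ballI)
  interpret cring \<kappa> by fact
  fix X Y :: "('k, 'e, 'g) xhopf" and f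
  assume X: "X \<in> Obj (XHopf \<kappa>)"
  interpret X: hopf_xmod \<kappa> "xtop X" "xbase X" "xbd X" "xact X" using X by (simp add: XHopf_def xmod_cat_def)
  interpret I: cocomm_hopf_algebra \<kappa> "xtop X" by (rule X.hopf_I)
  interpret H: cocomm_hopf_algebra \<kappa> "xbase X" by (rule X.hopf_H)
  show "fobj (funct_comp (Gl_X2 \<kappa>) (Incl_Hopf \<kappa>)) X = fobj (funct_comp (Incl_Grp \<one>\<^bsub>\<kappa>\<^esub>) (Gl_X \<kappa>)) X"
    by (auto simp: funct_comp_def Gl_X2_def Incl_Hopf_def Incl_Grp_def Gl_X_def Let_def
        gl_grp_hopf_zero[OF assms] Gl_hopf_zero[OF assms] fun_eq_iff restrict_def)
  show "farr (funct_comp (Gl_X2 \<kappa>) (Incl_Hopf \<kappa>)) X Y f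
      = farr (funct_comp (Incl_Grp \<one>\<^bsub>\<kappa>\<^esub>) (Gl_X \<kappa>)) X Y f"
    by (cases f) (auto simp: funct_comp_def Gl_X2_def Incl_Hopf_def Incl_Grp_def Gl_X_def
        Gl_hopf_zero[OF assms] fun_eq_iff restrict_def)
qed


theorem proposition6p12:
  fixes \<kappa> :: "'k ring"
  assumes "field \<kappa>"
  shows
    "is_functor (X2Hopf \<kappa> :: (('k, 'l, 'e, 'g) x2hopf, ('l, 'e, 'g) mor3) cat) (X2Lie \<kappa>) (Prim_X2 \<kappa>)
   \<and> is_functor (X2Hopf \<kappa> :: (('k, 'l, 'e, 'g) x2hopf, ('l, 'e, 'g) mor3) cat) X2Grp (Gl_X2 \<kappa>)
   \<and> is_functor (XHopf \<kappa> :: (('k, 'e, 'g) xhopf, ('e, 'g) mor2) cat) (XLie \<kappa>) (Prim_X \<kappa>)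
   \<and> is_functor (XHopf \<kappa> :: (('k, 'e, 'g) xhopf, ('e, 'g) mor2) cat) XGrp (Gl_X \<kappa>)
   \<and> is_functor (XHopf \<kappa> :: (('k, 'e, 'g) xhopf, ('e, 'g) mor2) cat) (X2Hopf \<kappa>) (Incl_Hopf \<kappa>)
   \<and> is_functor (XLie \<kappa> :: (('k, 'e, 'g) xlie, ('e, 'g) mor2) cat) (X2Lie \<kappa>) (Incl_Lie \<kappa> \<zero>\<^bsub>\<kappa>\<^esub>)
   \<and> is_functor (XGrp :: (('e, 'g) xgrp, ('e, 'g) mor2) cat) X2Grp (Incl_Grp \<one>\<^bsub>\<kappa>\<^esub>)
   \<and> funct_eq (XHopf \<kappa> :: (('k, 'e, 'g) xhopf, ('e, 'g) mor2) cat)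
       (funct_comp (Prim_X2 \<kappa>) (Incl_Hopf \<kappa>)) (funct_comp (Incl_Lie \<kappa> \<zero>\<^bsub>\<kappa>\<^esub>) (Prim_X \<kappa>))
   \<and> funct_eq (XHopf \<kappa> :: (('k, 'e, 'g) xhopf, ('e, 'g) mor2) cat)
       (funct_comp (Gl_X2 \<kappa>) (Incl_Hopf \<kappa>)) (funct_comp (Incl_Grp \<one>\<^bsub>\<kappa>\<^esub>) (Gl_X \<kappa>))"
proof -
  have cring: "cring \<kappa>"
    using assms by (rule field.axioms(1)[THEN domain.axioms(1)])
  show ?thesis
    by (intro conjI is_functor_Prim_X2 is_functor_Gl_X2 is_functor_Prim_X is_functor_Gl_X
        is_functor_Incl_Hopf is_functor_Incl_Lie is_functor_Incl_Grp Prim_Incl Gl_Incl cring)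
qed

end
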